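(* Let $G$ be a locally compact group with left Haar measure $\mathrm{m}$. Then the following are equivalent: (i) $G$ is amenable; (ii) for every $\varepsilon>0$, there exists $n_\varepsilon\in\mathbb{N}$ such that for every finite subset $F\subseteq G$ with $|F|\ge n_\varepsilon$ there exists a compact subset $C\subseteq G$ with the property that $$\mathrm{m}(EC)<\varepsilon\,|E|\,\mathrm{m}(C)\qquad\text{for every } E\subseteq F \text{ with } |E|\ge n_\varepsilon ;$$ (iii) there exist $\varepsilon_0\in(0,1)$ and $n_0\in\mathbb{N}$ such that for every finite subset $F\subseteq G$ with $|F|\ge n_0$ there exists a compact subset $C\subseteq G$ with the property that $$\mathrm{m}(EC)<\varepsilon_0\,|E|\,\mathrm{m}(C)\qquad\text{for every } E\subseteq F \text{ with } |E|\ge n_0 .$$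
   Context: $\mathbb{N}=\{1,2,\ldots\}$; $|E|$ is the cardinality of a finite set $E$, and $EC=\{tc: t\in E, c\in C\}$. $L^\infty(G)$ is identified with the dual of $L^1(G)=L^1(G,\mathrm{m})$. A locally compact group $G$ is amenable if there is a left-invariant mean on $L^\infty(G)$, i.e. a positive linear functional $\Lambda:L^\infty(G)\to\mathbb{C}$ with $\Lambda(\mathbf{1})=1$ and $\delta_s\cdot\Lambda=\Lambda$ for all $s\in G$, where $(\delta_s\cdot\Lambda)(\varphi)=\Lambda(\varphi\cdot\delta_s)$ and $(\varphi\cdot\delta_s)(x)=\varphi(sx)$. *)

theory Defs
  imports "HOL-Analysis.Analysis" "HOL-Library.Set_Algebras"
begin

text \<open>
  Groups are written additively, as in the library class
  \<^class>\<open>topological_group_add\<close>, whose addition is \<^bold>\<open>not\<close> assumed to be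
  commutative: \<^term>\<open>s + x\<close> stands for the product $sx$ (so \<^term>\<open>s\<close> acts from
  the left) and the setwise sum \<^term>\<open>E + C\<close> stands for $EC$.
\<close>

text \<open>
  A left Haar measure is a nonzero left-invariant Radon measure on the Borel sets.  The group
  need not be \<open>\<sigma>\<close>-compact, so inner regularity is only required on open sets.
\<close>

definition left_haar_measure :: "'a::{topological_group_add, t2_space} measure \<Rightarrow> bool" where
  "left_haar_measure m \<longleftrightarrow>
     sets m = sets borel \<and>
     (\<forall>K. compact K \<longrightarrow> emeasure m K < \<infinity>) \<and>
     (\<forall>A\<in>sets borel. emeasure m A = (INF U\<in>{U. open U \<and> A \<subseteq> U}. emeasure m U)) \<and>
     (\<forall>U. open U \<longrightarrow> emeasure m U = (SUP K\<in>{K. compact K \<and> K \<subseteq> U}. emeasure m K)) \<and>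
     (\<forall>s. \<forall>A\<in>sets borel. emeasure m ((\<lambda>x. s + x) ` A) = emeasure m A) \<and>
     emeasure m UNIV \<noteq> 0"

text \<open>
  As the measure need not be \<open>\<sigma>\<close>-finite, $L^\infty$ is the dual of $L^1$ only if
  measurability and null sets are understood locally, that is, on each measurable set of finite
  measure.  Elements of $L^\infty$ are represented by functions; passing to classes modulo local
  a.e. equality is reflected by a condition on the functionals below.
\<close>

definition locally_AE :: "'a measure \<Rightarrow> ('a \<Rightarrow> bool) \<Rightarrow> bool" where
  "locally_AE M P \<longleftrightarrow>
     (\<forall>A\<in>sets M. emeasure M A < \<infinity> \<longrightarrow> (AE x in M. x \<in> A \<longrightarrow> P x))"

definition locally_measurable :: "'a measure \<Rightarrow> ('a \<Rightarrow> complex) \<Rightarrow> bool" where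
  "locally_measurable M f \<longleftrightarrow>
     (\<forall>A\<in>sets M. emeasure M A < \<infinity> \<longrightarrow> set_borel_measurable M A f)"

definition Linfty :: "'a measure \<Rightarrow> ('a \<Rightarrow> complex) set" where
  "Linfty M = {f. locally_measurable M f \<and> (\<exists>c. locally_AE M (\<lambda>x. norm (f x) \<le> c))}"

text \<open>The first conjunct says that \<open>\<Lambda>\<close> is well defined on classes; the values of \<open>\<Lambda>\<close>
  outside \<^const>\<open>Linfty\<close> are irrelevant.\<close>

definition left_invariant_mean ::
    "'a::{topological_group_add, t2_space} measure \<Rightarrow> (('a \<Rightarrow> complex) \<Rightarrow> complex) \<Rightarrow> bool" where
  "left_invariant_mean m \<Lambda> \<longleftrightarrow>
     (\<forall>f\<in>Linfty m. \<forall>g\<in>Linfty m. locally_AE m (\<lambda>x. f x = g x) \<longrightarrow> \<Lambda> f = \<Lambda> g) \<and>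
     (\<forall>f\<in>Linfty m. \<forall>g\<in>Linfty m. \<Lambda> (\<lambda>x. f x + g x) = \<Lambda> f + \<Lambda> g) \<and>
     (\<forall>c. \<forall>f\<in>Linfty m. \<Lambda> (\<lambda>x. c * f x) = c * \<Lambda> f) \<and>
     (\<forall>f\<in>Linfty m. locally_AE m (\<lambda>x. f x \<in> \<real>\<^sub>\<ge>\<^sub>0) \<longrightarrow> \<Lambda> f \<in> \<real>\<^sub>\<ge>\<^sub>0) \<and>
     \<Lambda> (\<lambda>x. 1) = 1 \<and>
     (\<forall>s. \<forall>f\<in>Linfty m. \<Lambda> (\<lambda>x. f (s + x)) = \<Lambda> f)"

definition amenable :: "'a::{topological_group_add, t2_space} measure \<Rightarrow> bool" where
  "amenable m \<longleftrightarrow> (\<exists>\<Lambda>. left_invariant_mean m \<Lambda>)"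

end

theory Submission
  imports Defs
begin

text \<open>
  \<^bold>\<open>(i) implies (ii).\<close> An invariant mean yields, for every finite set \<open>S\<close>, a compact set \<open>C\<close> with
  $\sum_{t \in S} m(tC \setminus C) < m(C)$; then $m(EC) < 2\,m(C)$ for $E \subseteq S$, whatever
  $|E|$ is. If there were no such \<open>C\<close>, then every density would be moved by \<open>S\<close> by a definite amount
  in $L^1$. Instead of separating by the Hahn--Banach theorem, which would need the dual of $L^1$ for a
  measure that is not \<open>\<sigma>\<close>-finite, one applies Ekeland's variational principle to the smooth functional
  $\sum_t \int (u - tu)^2 / (u + tu)$ on the densities of each coset of a \<open>\<sigma>\<close>-compact open subgroup
  containing \<open>S\<close>. The first-order condition provides explicit bounded functions $\rho_t$ with
  $\sum_t (\rho_t(x) - \rho_t(tx)) \ge c > 0$, which are glued over the cosets. An invariant mean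
  maps this sum to \<open>0\<close>, a contradiction.

  \<^bold>\<open>(iii) implies (i).\<close> Let $\eta$ be a convex combination of the indicators of $tC$, $t \in F$. As
  \<open>n\<^sub>0\<close> translates of \<open>C\<close> by elements of \<open>F\<close> are never almost disjoint, $\|\eta\|_2^2 \ge c\,m(C)$ with
  \<open>c\<close> independent of \<open>F\<close>. Hence, if \<open>F\<close> contains a large ball, a combination of nearly minimal norm is
  almost invariant. Its square is almost invariant in $L^1$, and a cluster point of such densities in
  the dual of $L^\infty$ is an invariant mean.
\<close>

subsection \<open>Left Haar measures\<close>

text \<open>In (iii) the bound is a fixed number, and the set \<open>C\<close> found for
  \<open>F\<close> need not be nearly invariant under anything. The hypothesis supplies only a
  scale: no average of translates of \<open>C\<close> over \<open>F\<close> has a square norm below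
  a fixed fraction of \<open>measure m C\<close>. Invariance has to come from averaging, and it is
  sought in L2 because the parallelogram law converts a small loss of norm into a small
  displacement. In the other direction a minimizer of the variation among densities would suffice,
  but the minimum need not be attained, since bounded sets of L1 are not weakly compact; Ekeland's
  principle provides a point that is minimal up to a small slope. The functional is not
  differentiable where a density and its translate both vanish. Adding a small, strictly positive
  integrable function to all densities removes this obstacle. Such a function exists on a
  sigma-compact set only, hence the passage to the cosets of a sigma-compact open subgroup.\<close>

locale left_haar =
  fixes m :: "'a::{topological_group_add, t2_space} measure"
  assumes haar: "left_haar_measure m"
begin

lemmas haar_conjuncts = haar[unfolded left_haar_measure_def, THEN conjunct2]

lemmas compact_finite = haar_conjuncts[THEN conjunct1, rule_format]
lemmas outer_regular_INF = haar_conjuncts[THEN conjunct2, THEN conjunct1, rule_format]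
lemmas inner_regular_SUP = haar_conjuncts[THEN conjunct2, THEN conjunct2, THEN conjunct1, rule_format]
lemmas emeasure_translate =
  haar_conjuncts[THEN conjunct2, THEN conjunct2, THEN conjunct2, THEN conjunct1, rule_format]
lemmas emeasure_UNIV = haar_conjuncts[THEN conjunct2, THEN conjunct2, THEN conjunct2, THEN conjunct2]

lemma sets_m [simp, measurable_cong]: "sets m = sets borel"
  using haar unfolding left_haar_measure_def by (rule conjunct1)

lemma space_m [simp]: "space m = UNIV"
  using sets_eq_imp_space_eq[OF sets_m] by simp

lemma continuous_translate: "continuous_on A (\<lambda>x::'a. s + x)"
  by (intro continuous_intros)

lemma translate_measurable [measurable]: "(\<lambda>x::'a. s + x) \<in> borel_measurable borel"
  by (intro borel_measurable_continuous_onI continuous_translate)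

text \<open>The Haar condition speaks of images, while measurability, openness and the evaluation of
  indicators need preimages.\<close>

lemma translate_image: "(\<lambda>x::'a. s + x) ` A = (\<lambda>x. - s + x) -` A"
proof (intro set_eqI iffI)
  fix y assume "y \<in> (\<lambda>x. - s + x) -` A"
  then show "y \<in> (\<lambda>x. s + x) ` A"
    by (intro image_eqI[of _ _ "- s + y"]) (simp_all add: add.assoc[symmetric])
qed (auto simp: add.assoc[symmetric])

lemma sets_translate [measurable]:
  assumes "A \<in> sets borel" shows "(\<lambda>x::'a. s + x) ` A \<in> sets borel"
  unfolding translate_image using measurable_sets[OF translate_measurable assms] by simp

lemma measure_translate: "A \<in> sets borel \<Longrightarrow> measure m ((\<lambda>x. s + x) ` A) = measure m A"
  by (simp add: measure_def emeasure_translate)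

lemma distr_translate: "distr m m (\<lambda>x. s + x) = m"
proof (rule measure_eqI)
  fix A assume "A \<in> sets (distr m m (\<lambda>x. s + x))"
  then have A: "A \<in> sets borel" by simp
  have "(\<lambda>x. s + x) -` A = (\<lambda>x. - s + x) ` A"
    using translate_image[of "- s" A] by simp
  then show "emeasure (distr m m (\<lambda>x. s + x)) A = emeasure m A"
    using A emeasure_translate[OF A, of "- s"] by (subst emeasure_distr) simp_all
qed simp

lemma integrable_translate:
  fixes f :: "'a \<Rightarrow> 'b::{banach, second_countable_topology}"
  assumes "integrable m f"
  shows "integrable m (\<lambda>x. f (s + x))"
proof -
  have [measurable]: "f \<in> borel_measurable borel"
    using borel_measurable_integrable[OF assms] by simp
  show ?thesis
    using assms integrable_distr_eq[of "\<lambda>x. s + x" m m f] by (simp add: distr_translate)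
qed

lemma integral_translate:
  fixes f :: "'a \<Rightarrow> 'b::{banach, second_countable_topology}"
  assumes [measurable]: "f \<in> borel_measurable borel"
  shows "(\<integral>x. f (s + x) \<partial>m) = (\<integral>x. f x \<partial>m)"
  using integral_distr[of "\<lambda>x. s + x" m m f] by (simp add: distr_translate)

lemma compact_translate: "compact C \<Longrightarrow> compact ((\<lambda>x::'a. s + x) ` C)"
  by (rule compact_continuous_image[OF continuous_translate])

lemma compact_fmeasurable: "compact C \<Longrightarrow> C \<in> fmeasurable m"
  by (intro fmeasurableI compact_finite) (simp_all add: borel_closed compact_imp_closed)

lemma set_plus_eq_Union: "E + C = (\<Union>t\<in>E. (\<lambda>x::'a. t + x) ` C)"
  by (auto simp: set_plus_def)

lemma outer_regular:
  assumes "A \<in> fmeasurable m" "0 < e"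
  obtains U where "open U" "A \<subseteq> U" "U \<in> fmeasurable m" "measure m (U - A) < e"
proof -
  have A: "A \<in> sets borel" using assms by (auto dest: fmeasurableD)
  have fin: "emeasure m A < \<infinity>" using assms by (auto simp: fmeasurable_def)
  have inf: "emeasure m A = (INF U\<in>{U. open U \<and> A \<subseteq> U}. emeasure m U)"
    by (rule outer_regular_INF[OF A])
  have "emeasure m A < emeasure m A + ennreal e"
    using assms by (simp add: emeasure_eq_measure2[OF assms(1)] ennreal_plus[symmetric] ennreal_less_iff del: ennreal_plus)
  then have "(INF U\<in>{U. open U \<and> A \<subseteq> U}. emeasure m U) < emeasure m A + ennreal e"
    using inf by simp
  then obtain U where U: "open U" "A \<subseteq> U" "emeasure m U < emeasure m A + ennreal e"
    by (auto simp: INF_less_iff)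
  have Um: "U \<in> fmeasurable m"
    using U fin by (auto simp: fmeasurable_def intro: order.strict_trans)
  have "measure m U < measure m A + e"
    using U(3) assms Um
    by (simp add: emeasure_eq_measure2[OF Um] emeasure_eq_measure2[OF assms(1)] ennreal_plus[symmetric] ennreal_less_iff del: ennreal_plus)
  then have "measure m (U - A) < e"
    using measurable_measure_Diff[OF Um] A U(2) by auto
  with U Um that show ?thesis by blast
qed

text \<open>Inner regularity is assumed on open sets only. Inside an open \<open>U\<close> around
  \<open>A\<close> take a compact \<open>K\<close> that almost fills \<open>U\<close>, then remove
  an open \<open>V\<close> that covers \<open>U - A\<close> with little excess: \<open>K - V\<close>
  is compact, lies in \<open>A\<close>, and misses at most \<open>U - K\<close> and
  \<open>V - (U - A)\<close>.\<close>

lemma inner_regular: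
  assumes A: "A \<in> fmeasurable m" and "0 < e"
  obtains C where "compact C" "C \<subseteq> A" "measure m (A - C) < e"
proof -
  obtain U where U: "open U" "A \<subseteq> U" "U \<in> fmeasurable m"
    using outer_regular[OF A \<open>0 < e\<close>] by metis
  have [measurable]: "A \<in> sets borel" "U \<in> sets borel" using assms U by (auto dest: fmeasurableD)
  have "\<exists>K. compact K \<and> K \<subseteq> U \<and> measure m (U - K) < e / 2"
  proof -
    have sup: "emeasure m U = (SUP K\<in>{K. compact K \<and> K \<subseteq> U}. emeasure m K)"
      by (rule inner_regular_SUP[OF U(1)])
    show ?thesis
    \<comment> \<open>If \<open>measure m U - e / 2\<close> is negative, \<open>ennreal\<close>
      truncates it to 0 and the strict comparison below could fail.\<close>
    proof (cases "measure m U < e / 2")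
      case True
      then show ?thesis by (intro exI[of _ "{}"]) auto
    next
      case False
      then have "ennreal (measure m U - e / 2) < ennreal (measure m U)"
        using \<open>0 < e\<close> by (intro ennreal_lessI) auto
      then have "ennreal (measure m U - e / 2) < (SUP K\<in>{K. compact K \<and> K \<subseteq> U}. emeasure m K)"
        using sup by (simp add: emeasure_eq_measure2[OF U(3)])
      then obtain K where K: "compact K" "K \<subseteq> U" "ennreal (measure m U - e / 2) < emeasure m K"
        by (auto simp: less_SUP_iff)
      have "measure m U - e / 2 < measure m K"
        using K(3) False by (simp add: emeasure_eq_measure2[OF compact_fmeasurable[OF K(1)]] ennreal_less_iff)
      moreover have "measure m (U - K) = measure m U - measure m K"
        using K compact_fmeasurable[OF K(1)] by (intro measurable_measure_Diff U) (auto dest: fmeasurableD)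
      ultimately show ?thesis using K by (intro exI[of _ K]) auto
    qed
  qed
  then obtain K where K: "compact K" "K \<subseteq> U" "measure m (U - K) < e / 2" by blast
  have Km: "K \<in> fmeasurable m" by (rule compact_fmeasurable[OF K(1)])
  then have [measurable]: "K \<in> sets borel" by (auto dest: fmeasurableD)
  have "U - A \<in> fmeasurable m" using U(3) by (rule fmeasurable_Diff) simp
  then obtain V where V: "open V" "U - A \<subseteq> V" "V \<in> fmeasurable m" "measure m (V - (U - A)) < e / 2"
    using outer_regular[of "U - A" "e / 2"] \<open>0 < e\<close> by (metis half_gt_zero)
  have [measurable]: "V \<in> sets borel" using V by auto
  have "compact (K - V)" by (rule compact_diff[OF K(1) V(1)])
  moreover have "K - V \<subseteq> A" using K V by auto
  moreover have "measure m (A - (K - V)) < e"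
  proof -
    have "A - (K - V) \<subseteq> (U - K) \<union> (V - (U - A))" using U K V by auto
    moreover have UK: "U - K \<in> fmeasurable m" "V - (U - A) \<in> fmeasurable m"
      using U(3) V(3) by (auto intro!: fmeasurable_Diff)
    ultimately have "measure m (A - (K - V)) \<le> measure m ((U - K) \<union> (V - (U - A)))"
      by (intro measure_mono_fmeasurable) auto
    also have "\<dots> \<le> measure m (U - K) + measure m (V - (U - A))"
      using UK by (intro measure_Un_le) auto
    also have "\<dots> < e" using K V by simp
    finally show ?thesis .
  qed
  ultimately show ?thesis using that by blast
qed

text \<open>Finitely many translates of a nonempty open set cover any compact set. If the open set
  were null, all compact sets would be null, and by inner regularity the whole group.\<close>

lemma open_pos:
  assumes "open U" "x \<in> U" shows "emeasure m U \<noteq> 0"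
proof
  assume 0: "emeasure m U = 0"
  have "emeasure m K = 0" if K: "compact K" for K
  proof -
    let ?V = "\<lambda>k. (\<lambda>y. (k - x) + y) ` U"
    have oV: "open (?V k)" for k
      unfolding translate_image by (rule open_vimage[OF assms(1) continuous_translate])
    have KV: "K \<subseteq> (\<Union>k\<in>K. ?V k)"
    proof
      fix k assume "k \<in> K"
      moreover have "k = (k - x) + x" by simp
      then have "k \<in> ?V k" using assms(2) by (rule image_eqI)
      ultimately show "k \<in> (\<Union>k\<in>K. ?V k)" by (rule UN_I)
    qed
    obtain D where D: "D \<subseteq> K" "finite D" "K \<subseteq> (\<Union>k\<in>D. ?V k)"
      using compactE_image[OF K oV KV] by blast
    have "(\<Union>k\<in>D. ?V k) \<in> null_sets m"
      using D 0 assms oV by (intro null_sets_UN' countable_finite null_setsI) (simp_all add: emeasure_translate)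
    then have "K \<in> null_sets m"
      using fmeasurableD[OF compact_fmeasurable[OF K]] D(3) by (rule null_sets_subset)
    then show ?thesis by (rule null_setsD1)
  qed
  then have "(SUP K\<in>{K. compact K \<and> K \<subseteq> UNIV}. emeasure m K) = 0"
    by (intro antisym SUP_least) auto
  moreover have "emeasure m UNIV = (SUP K\<in>{K. compact K \<and> K \<subseteq> UNIV}. emeasure m K)"
    by (rule inner_regular_SUP[OF open_UNIV])
  ultimately show False using emeasure_UNIV by metis
qed

subsection \<open>Averages of translates of a compact set\<close>

text \<open>Inclusion-exclusion cut off after the pairwise terms. Adding a set to \<open>k\<close>
  others costs at most \<open>k * \<beta>\<close>; the square is a generous bound for the resulting
  number of pairs.\<close>

lemma measure_Union_ge:
  assumes "finite E" "A ` E \<subseteq> fmeasurable m"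
    and "\<And>t. t \<in> E \<Longrightarrow> \<mu> \<le> measure m (A t)"
    and "\<And>s t. s \<in> E \<Longrightarrow> t \<in> E \<Longrightarrow> s \<noteq> t \<Longrightarrow> measure m (A s \<inter> A t) \<le> \<beta>" "0 \<le> \<beta>"
  shows "real (card E) * \<mu> - (real (card E))\<^sup>2 * \<beta> \<le> measure m (\<Union>t\<in>E. A t)"
  using assms
proof (induction E rule: finite_induct)
  case (insert x E)
  let ?k = "real (card E)"
  let ?U = "\<Union>t\<in>E. A t"
  have U: "?U \<in> fmeasurable m" "A x \<in> fmeasurable m"
    using insert by (auto intro!: fmeasurable.finite_UN)
  have "measure m (A x \<inter> ?U) = measure m (\<Union>t\<in>E. A x \<inter> A t)"
    by (simp only: Int_UN_distrib)
  also have "\<dots> \<le> (\<Sum>t\<in>E. measure m (A x \<inter> A t))"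
    using insert by (intro measure_UNION_le) (auto simp: fmeasurableD)
  also have "\<dots> \<le> ?k * \<beta>"
    using insert by (intro sum_bounded_above) auto
  finally have "measure m (A x \<inter> ?U) \<le> ?k * \<beta>" .
  moreover have "measure m (A x \<union> ?U) = measure m (A x) + measure m ?U - measure m (A x \<inter> ?U)"
    using measure_Un3[OF U(2,1)] .
  moreover have "?k * \<mu> - ?k\<^sup>2 * \<beta> \<le> measure m ?U"
    using insert by (intro insert.IH) auto
  moreover have "\<mu> \<le> measure m (A x)" using insert by auto
  moreover have "?k * \<beta> + ?k\<^sup>2 * \<beta> \<le> (?k + 1)\<^sup>2 * \<beta>"
    using insert.prems(4) by (simp add: power2_eq_square algebra_simps)
  ultimately show ?case
    using insert.hyps by (simp add: algebra_simps)
qed simp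

text \<open>This is the convolution of the weight \<open>a\<close> on \<open>F\<close> with the
  indicator of \<open>C\<close>. A left translate of an average is therefore an average over the
  translated index set.\<close>

definition avg :: "('a \<Rightarrow> real) \<Rightarrow> 'a set \<Rightarrow> 'a set \<Rightarrow> 'a \<Rightarrow> real" where
  "avg a F C x = (\<Sum>t\<in>F. a t * indicator C (- t + x))"

lemma indicator_translate: "indicator C (- t + x) = (indicator ((\<lambda>x::'a. t + x) ` C) x :: real)"
  unfolding translate_image by (simp add: indicator_def)

lemma avg_translate:
  assumes "finite F"
  shows "avg a F C (- s + x) = avg (\<lambda>t. a (- s + t)) ((\<lambda>t. s + t) ` F) C x"
  unfolding avg_def
  by (subst sum.reindex) (auto simp: inj_on_def add.assoc[symmetric] minus_add)

lemma avg_measurable [measurable]: "C \<in> sets borel \<Longrightarrow> avg a F C \<in> borel_measurable borel"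
  unfolding avg_def indicator_translate
  by (intro borel_measurable_sum borel_measurable_times borel_measurable_const borel_measurable_indicator) simp

definition weights :: "('a \<Rightarrow> real) \<Rightarrow> 'a set \<Rightarrow> bool" where
  "weights a F \<longleftrightarrow> finite F \<and> (\<forall>t\<in>F. 0 \<le> a t) \<and> sum a F = 1"

lemma avg_bounds:
  assumes "weights a F" shows "0 \<le> avg a F C x" "avg a F C x \<le> 1"
proof -
  show "0 \<le> avg a F C x"
    using assms by (auto simp: avg_def weights_def intro!: sum_nonneg)
  have "avg a F C x \<le> sum a F"
    unfolding avg_def using assms by (intro sum_mono) (auto simp: weights_def indicator_def)
  then show "avg a F C x \<le> 1" using assms by (simp add: weights_def)
qed

lemma avg_integral:
  assumes "weights a F" "compact C"
  shows "integrable m (avg a F C)" "(\<integral>x. avg a F C x \<partial>m) = measure m C"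
proof -
  have C: "C \<in> fmeasurable m" "C \<in> sets borel"
    using compact_fmeasurable[OF assms(2)] by (auto dest: fmeasurableD)
  have i: "integrable m (\<lambda>x. a t * indicator ((\<lambda>x. t + x) ` C) x)" for t
    using compact_fmeasurable[OF compact_translate[OF assms(2)]]
    by (intro integrable_mult_right integrable_real_indicator) (auto simp: fmeasurable_def)
  then show "integrable m (avg a F C)"
    unfolding avg_def indicator_translate by (intro Bochner_Integration.integrable_sum)
  have "(\<integral>x. avg a F C x \<partial>m) = (\<Sum>t\<in>F. a t * measure m C)"
    unfolding avg_def indicator_translate using i C
    by (subst Bochner_Integration.integral_sum) (auto simp: measure_translate)
  also have "\<dots> = measure m C"
    using assms(1) by (simp add: weights_def flip: sum_distrib_right)
  finally show "(\<integral>x. avg a F C x \<partial>m) = measure m C" .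
qed

lemma integrable_mult_bounded:
  fixes u v :: "'a \<Rightarrow> real"
  assumes "integrable m u" "integrable m v" "\<And>x. \<bar>v x\<bar> \<le> c"
  shows "integrable m (\<lambda>x. u x * v x)"
proof (rule Bochner_Integration.integrable_bound[where f = "\<lambda>x. c * u x"])
  show "AE x in m. norm (u x * v x) \<le> norm (c * u x)"
  proof (rule AE_I2)
    fix x show "norm (u x * v x) \<le> norm (c * u x)"
      using mult_right_mono[OF order_trans[OF assms(3)[of x] abs_ge_self], of "\<bar>u x\<bar>"]
      by (simp add: abs_mult mult.commute)
  qed
qed (use assms in \<open>auto dest: borel_measurable_integrable\<close>)

text \<open>A maximal set of translates with pairwise small overlap has fewer than \<open>n\<close> elements, so
  every average overlaps substantially with one of boundedly many translates.\<close>

lemma avg_square_ge: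
  assumes C: "compact C" and F: "finite F" "n \<le> card F" "1 \<le> n"
    and e: "e < 1" "0 \<le> e"
    and small: "\<And>E. E \<subseteq> F \<Longrightarrow> n \<le> card E \<Longrightarrow> measure m (E + C) < e * real (card E) * measure m C"
    and a: "weights a F"
  shows "((1 - e) / (real n)\<^sup>2)\<^sup>2 * measure m C \<le> (\<integral>x. (avg a F C x)\<^sup>2 \<partial>m)"
proof -
  \<comment> \<open>Makes \<open>n * \<mu> - n\<^sup>2 * (g * \<mu>)\<close> equal to
    \<open>e * n * \<mu>\<close>: the union of \<open>n\<close> translates with pairwise overlaps
    below \<open>g * \<mu>\<close> is too large for the hypothesis \<open>small\<close>.\<close>
  define g where "g = (1 - e) / n"
  define \<mu> where "\<mu> = measure m C"
  let ?T = "\<lambda>t. (\<lambda>x. t + x) ` C"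
  have C': "C \<in> sets borel" and T: "?T t \<in> fmeasurable m" for t
    using compact_fmeasurable[OF C] compact_fmeasurable[OF compact_translate[OF C]]
    by (auto dest: fmeasurableD)
  have \<mu>: "measure m (?T t) = \<mu>" for t
    using C' by (simp add: \<mu>_def measure_translate)
  have g: "0 < g" "g \<le> 1" using F e by (auto simp: g_def field_simps)
  define sep where "sep E \<longleftrightarrow> E \<subseteq> F \<and> (\<forall>s\<in>E. \<forall>t\<in>E. s \<noteq> t \<longrightarrow> measure m (?T s \<inter> ?T t) < g * \<mu>)" for E
  have sep_card: "card E < n" if "sep E" for E
  proof (rule ccontr)
    assume "\<not> card E < n"
    then obtain E' where E': "E' \<subseteq> E" "card E' = n" "finite E'"
      by (meson not_less obtain_subset_with_card_n)
    have "real (card E') * \<mu> - (real (card E'))\<^sup>2 * (g * \<mu>) \<le> measure m (\<Union>t\<in>E'. ?T t)"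
    proof (rule measure_Union_ge)
      show "measure m (?T s \<inter> ?T t) \<le> g * \<mu>" if "s \<in> E'" "t \<in> E'" "s \<noteq> t" for s t
        using that \<open>sep E\<close> E'(1) unfolding sep_def by (meson less_imp_le subsetD)
    qed (use E'(3) T \<mu> g(1) in \<open>auto simp: \<mu>_def\<close>)
    moreover have "measure m (E' + C) < e * real (card E') * \<mu>"
      using small[of E'] E' that by (auto simp: sep_def \<mu>_def)
    moreover have "real n * \<mu> - (real n)\<^sup>2 * (g * \<mu>) = e * n * \<mu>"
      using F by (simp add: g_def field_simps power2_eq_square)
    ultimately show False using E' by (simp add: set_plus_eq_Union)
  qed
  have "finite {E. sep E}" using F by (auto intro: finite_subset[of _ "Pow F"] simp: sep_def)
  moreover have "sep {}" by (simp add: sep_def)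
  ultimately obtain E where E: "sep E" "\<And>E'. sep E' \<Longrightarrow> E \<subseteq> E' \<Longrightarrow> E' = E"
    using finite_has_maximal[of "{E. sep E}"] by auto
  have finE: "finite E" using E F by (auto simp: sep_def intro: finite_subset)
  have mono: "g * \<mu> \<le> (\<Sum>s\<in>E. measure m (?T s \<inter> ?T t))" if "t \<in> F" for t
  proof -
    have "\<exists>s\<in>E. g * \<mu> \<le> measure m (?T s \<inter> ?T t)"
    proof (cases "t \<in> E")
      case True
      moreover have "g * \<mu> \<le> \<mu>" using g by (intro mult_left_le_one_le) (auto simp: \<mu>_def)
      ultimately show ?thesis using \<mu> by (intro bexI[of _ t]) simp_all
    next
      case False
      then have "\<not> sep (insert t E)" using E(2)[of "insert t E"] by auto
      then show ?thesis using E(1) that by (force simp: sep_def Int_commute not_less)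
    qed
    then show ?thesis
      using finE by (meson member_le_sum measure_nonneg order_trans)
  qed
  define \<eta> where "\<eta> = avg a F C"
  \<comment> \<open>The parameter of Young's inequality
    \<open>\<eta> \<le> \<eta>\<^sup>2 / (2 * \<kappa>) + \<kappa> / 2\<close>. Since
    \<open>g = n * \<kappa>\<close>, its last term uses up half of the lower bound, which leaves
    \<open>\<kappa>\<^sup>2 * \<mu>\<close> below the integral of the square.\<close>
  define \<kappa> where "\<kappa> = g / n"
  have \<kappa>: "0 < \<kappa>" using g F by (simp add: \<kappa>_def)
  have [measurable]: "C \<in> sets borel" "?T t \<in> sets borel" for t using C' by auto
  have i\<eta>: "integrable m \<eta>" using avg_integral[OF a C] by (simp add: \<eta>_def)
  have b\<eta>: "\<bar>\<eta> x\<bar> \<le> 1" for x using avg_bounds[OF a] by (simp add: \<eta>_def)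
  have iT: "integrable m (indicator (?T t) :: _ \<Rightarrow> real)" for t
    using T[of t] by (intro integrable_real_indicator) (auto simp: fmeasurable_def)
  have i\<eta>T: "integrable m (\<lambda>x. \<eta> x * indicator (?T t) x)" for t
    using i\<eta> iT by (rule integrable_mult_bounded[where c = 1]) auto
  have i\<eta>2: "integrable m (\<lambda>x. (\<eta> x)\<^sup>2)"
    unfolding power2_eq_square using i\<eta> i\<eta> b\<eta> by (rule integrable_mult_bounded)
  \<comment> \<open>Averaging the overlap bound \<open>mono\<close> over \<open>F\<close> with the
    weights \<open>a\<close> gives a lower bound for the pairings of \<open>\<eta>\<close> with the
    translates indexed by \<open>E\<close>.\<close>
  have "g * \<mu> = (\<Sum>t\<in>F. a t * (g * \<mu>))"
    using a by (simp add: weights_def flip: sum_distrib_right)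
  also have "\<dots> \<le> (\<Sum>t\<in>F. a t * (\<Sum>s\<in>E. measure m (?T s \<inter> ?T t)))"
    using a mono by (intro sum_mono mult_left_mono) (auto simp: weights_def)
  also have "\<dots> = (\<Sum>s\<in>E. \<Sum>t\<in>F. a t * measure m (?T s \<inter> ?T t))"
    unfolding sum_distrib_left by (rule sum.swap)
  also have "\<dots> = (\<Sum>s\<in>E. \<integral>x. \<eta> x * indicator (?T s) x \<partial>m)"
  proof (rule sum.cong[OF refl])
    fix s
    have "integrable m (indicator (?T s \<inter> ?T t) :: _ \<Rightarrow> real)" for t
      using fmeasurable_Int_fmeasurable[OF T[of s], of "?T t"]
      by (intro integrable_real_indicator) (auto simp: fmeasurable_def)
    then have "(\<integral>x. (\<Sum>t\<in>F. a t * indicator (?T s \<inter> ?T t) x) \<partial>m) = (\<Sum>t\<in>F. a t * measure m (?T s \<inter> ?T t))"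
      by (subst Bochner_Integration.integral_sum) auto
    moreover have "(\<lambda>x. \<Sum>t\<in>F. a t * indicator (?T s \<inter> ?T t) x) = (\<lambda>x. \<eta> x * indicator (?T s) x)"
      unfolding \<eta>_def avg_def indicator_translate sum_distrib_right
      by (intro ext sum.cong) (auto simp: indicator_def)
    ultimately show "(\<Sum>t\<in>F. a t * measure m (?T s \<inter> ?T t)) = (\<integral>x. \<eta> x * indicator (?T s) x \<partial>m)"
      by simp
  qed
  also have "\<dots> \<le> (\<Sum>s\<in>E. (\<integral>x. (\<eta> x)\<^sup>2 \<partial>m) / (2 * \<kappa>) + \<kappa> / 2 * \<mu>)"
  proof (rule sum_mono)
    fix s
    have "(\<integral>x. \<eta> x * indicator (?T s) x \<partial>m) \<le> (\<integral>x. (\<eta> x)\<^sup>2 / (2 * \<kappa>) + \<kappa> / 2 * indicator (?T s) x \<partial>m)"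
    proof (rule integral_mono)
      fix x
      have "2 * \<kappa> * \<eta> x \<le> (\<eta> x)\<^sup>2 + \<kappa>\<^sup>2"
        using zero_le_power2[of "\<eta> x - \<kappa>"] by (simp add: power2_diff algebra_simps)
      then have "\<eta> x \<le> (\<eta> x)\<^sup>2 / (2 * \<kappa>) + \<kappa> / 2"
        using \<kappa> by (simp add: field_simps power2_eq_square)
      then show "\<eta> x * indicator (?T s) x \<le> (\<eta> x)\<^sup>2 / (2 * \<kappa>) + \<kappa> / 2 * indicator (?T s) x"
        using \<kappa> by (auto simp: indicator_def)
    qed (use i\<eta>T i\<eta>2 iT in auto)
    also have "\<dots> = (\<integral>x. (\<eta> x)\<^sup>2 \<partial>m) / (2 * \<kappa>) + \<kappa> / 2 * \<mu>"
      using i\<eta>2 iT \<mu> by (subst Bochner_Integration.integral_add) auto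
    finally show "(\<integral>x. \<eta> x * indicator (?T s) x \<partial>m) \<le> (\<integral>x. (\<eta> x)\<^sup>2 \<partial>m) / (2 * \<kappa>) + \<kappa> / 2 * \<mu>" .
  qed
  also have "\<dots> = real (card E) * ((\<integral>x. (\<eta> x)\<^sup>2 \<partial>m) / (2 * \<kappa>) + \<kappa> / 2 * \<mu>)"
    by simp
  also have "\<dots> \<le> real n * ((\<integral>x. (\<eta> x)\<^sup>2 \<partial>m) / (2 * \<kappa>) + \<kappa> / 2 * \<mu>)"
    using sep_card[OF E(1)] \<kappa> by (intro mult_right_mono) (auto simp: \<mu>_def)
  finally have "g * \<mu> \<le> real n * ((\<integral>x. (\<eta> x)\<^sup>2 \<partial>m) / (2 * \<kappa>) + \<kappa> / 2 * \<mu>)" .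
  moreover have "g = n * \<kappa>" using F by (simp add: \<kappa>_def)
  ultimately have "n * (\<kappa> * \<mu>) \<le> n * ((\<integral>x. (\<eta> x)\<^sup>2 \<partial>m) / (2 * \<kappa>) + \<kappa> / 2 * \<mu>)"
    by simp
  then have "\<kappa> * \<mu> \<le> (\<integral>x. (\<eta> x)\<^sup>2 \<partial>m) / (2 * \<kappa>) + \<kappa> / 2 * \<mu>"
    using F by simp
  then have "\<kappa>\<^sup>2 * \<mu> \<le> (\<integral>x. (\<eta> x)\<^sup>2 \<partial>m)"
    using \<kappa> by (simp add: field_simps power2_eq_square)
  moreover have "\<kappa> = (1 - e) / (real n)\<^sup>2"
    by (simp add: \<kappa>_def g_def power2_eq_square)
  ultimately show ?thesis by (simp add: \<mu>_def \<eta>_def)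
qed

section \<open>Almost invariant averages over growing word balls\<close>

lemma weights_mono:
  assumes "weights a F" "F \<subseteq> F'" "finite F'"
  obtains b where "weights b F'" "avg b F' C = avg a F C"
proof
  let ?b = "\<lambda>t. if t \<in> F then a t else 0"
  have F: "F' \<inter> {t. t \<in> F} = F" using assms(2) by auto
  have "sum ?b F' = sum a F"
    using assms(3) F by (simp add: sum.If_cases)
  then show "weights ?b F'" using assms by (auto simp: weights_def)
  show "avg ?b F' C = avg a F C"
    using assms(3) F unfolding avg_def by (simp add: if_distrib[where f = "\<lambda>u. u * _"] sum.If_cases fun_eq_iff cong: if_cong)
qed

lemma weights_translate:
  assumes "weights a F" shows "weights (\<lambda>t. a (- s + t)) ((\<lambda>t. s + t) ` F)"
  using assms unfolding weights_def
  by (auto simp: add.assoc[symmetric] sum.reindex inj_on_def)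

lemma weights_midpoint:
  assumes "weights a F" "weights b F"
  shows "weights (\<lambda>t. (a t + b t) / 2) F"
    "avg (\<lambda>t. (a t + b t) / 2) F C x = (avg a F C x + avg b F C x) / 2"
  using assms by (auto simp: weights_def avg_def sum.distrib add_divide_distrib algebra_simps
      simp flip: sum_divide_distrib sum_distrib_right)

text \<open>Products of at most \<open>k\<close> elements of \<open>S\<close>. The new factor is put
  on the left, so that left translation by an element of \<open>S\<close> maps each ball into the
  next. An average and its translate are then both averages over the next ball.\<close>

primrec word_ball :: "'a set \<Rightarrow> nat \<Rightarrow> 'a set" where
  "word_ball S 0 = {0}"
| "word_ball S (Suc k) = word_ball S k \<union> (\<Union>s\<in>S. (\<lambda>x. s + x) ` word_ball S k)"

lemma finite_word_ball: "finite S \<Longrightarrow> finite (word_ball S k)"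
  by (induction k) auto

lemma zero_in_word_ball: "0 \<in> word_ball S k"
  by (induction k) auto

lemma word_ball_mono: "k \<le> n \<Longrightarrow> word_ball S k \<subseteq> word_ball S n"
  by (induction n) (auto simp: le_Suc_eq)

lemma avg_square_integrable:
  assumes "weights a F" "compact C"
  shows "integrable m (\<lambda>x. (avg a F C x)\<^sup>2)"
  unfolding power2_eq_square using avg_bounds[OF assms(1)]
  by (intro integrable_mult_bounded[where c = 1] avg_integral assms) auto

lemma avg_square_le:
  assumes "weights a F" "compact C"
  shows "(\<integral>x. (avg a F C x)\<^sup>2 \<partial>m) \<le> measure m C"
proof -
  have "(\<integral>x. (avg a F C x)\<^sup>2 \<partial>m) \<le> (\<integral>x. avg a F C x \<partial>m)"
    using avg_bounds[OF assms(1)]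
    by (intro integral_mono avg_square_integrable avg_integral assms)
      (simp add: power2_eq_square mult_left_le)
  then show ?thesis using avg_integral[OF assms] by simp
qed

text \<open>The infimum of the squared norms of averages over the \<open>k\<close>-ball decreases in \<open>k\<close> but
  stays in \<open>[0, \<mu>]\<close>, so some step is small; near-minimizers there are almost invariant by the
  parallelogram law.\<close>

lemma ex_almost_invariant_avg:
  assumes C: "compact C" and S: "finite S" and n: "0 < n" and pos: "0 < measure m C"
  obtains k a where "k < n" "weights a (word_ball S k)"
    "\<And>s. s \<in> S \<Longrightarrow> (\<integral>x. (avg a (word_ball S k) C x - avg a (word_ball S k) C (- s + x))\<^sup>2 \<partial>m) \<le> 8 * measure m C / n"
proof -
  define \<mu> where "\<mu> = measure m C"
  have [measurable]: "C \<in> sets borel" using compact_fmeasurable[OF C] by (auto dest: fmeasurableD)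
  define W where "W k = {a. weights a (word_ball S k)}" for k
  define Q where "Q k a = (\<integral>x. (avg a (word_ball S k) C x)\<^sup>2 \<partial>m)" for k a
  define d where "d k = Inf (Q k ` W k)" for k
  have bdd: "bdd_below (Q k ` W k)" for k by (intro bdd_belowI[of _ 0]) (auto simp: Q_def)
  have "(\<lambda>t. if t = 0 then 1 else 0) \<in> W k" for k
    using finite_word_ball[OF S] zero_in_word_ball by (simp add: W_def weights_def)
  then have ne: "Q k ` W k \<noteq> {}" for k by blast
  have d0: "0 \<le> d k" for k unfolding d_def by (rule cInf_greatest[OF ne]) (auto simp: Q_def)
  have dQ: "d k \<le> Q k a" if "a \<in> W k" for k a
    unfolding d_def using that bdd by (intro cInf_lower) auto
  have d1: "d k \<le> \<mu>" for k
    using ne[of k] dQ[of _ k] avg_square_le[OF _ C] by (force simp: W_def Q_def \<mu>_def intro: order_trans)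
  \<comment> \<open>Pigeonhole: the \<open>n\<close> consecutive drops sum to at most
    \<open>\<mu>\<close>.\<close>
  have "\<exists>k<n. d k - d (Suc k) \<le> \<mu> / n"
  proof (rule ccontr)
    assume "\<not> ?thesis"
    then have "(\<Sum>k<n. \<mu> / n) < (\<Sum>k<n. d k - d (Suc k))"
      using n by (intro sum_strict_mono) auto
    also have "\<dots> = d 0 - d n" by (rule sum_lessThan_telescope')
    also have "\<dots> \<le> \<mu>" using d0[of n] d1[of 0] by simp
    finally show False using n by simp
  qed
  then obtain k where k: "k < n" "d k - d (Suc k) \<le> \<mu> / n" by blast
  \<comment> \<open>This slack and the small drop contribute \<open>\<mu> / n\<close> each to the
    gap between the norm of \<open>a\<close> and that of the midpoint below; the parallelogram law
    multiplies the gap by 4, which gives the factor 8.\<close>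
  have "Inf (Q k ` W k) < d k + \<mu> / n" using pos n by (simp add: d_def \<mu>_def)
  then obtain a where a: "a \<in> W k" "Q k a < d k + \<mu> / n"
    using cInf_lessD[OF ne] by blast
  have aw: "weights a (word_ball S k)" using a by (simp add: W_def)
  define \<eta> where "\<eta> = avg a (word_ball S k) C"
  have [measurable]: "\<eta> \<in> borel_measurable borel" by (simp add: \<eta>_def)
  have i2: "integrable m (\<lambda>x. (\<eta> x)\<^sup>2)" unfolding \<eta>_def by (rule avg_square_integrable[OF aw C])
  show ?thesis
  proof (rule that[OF k(1) aw])
    fix s assume s: "s \<in> S"
    let ?B = "word_ball S (Suc k)"
    have fB: "finite ?B" by (rule finite_word_ball[OF S])
    obtain b1 where b1: "weights b1 ?B" "avg b1 ?B C = \<eta>"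
      using weights_mono[OF aw _ fB, of C] by (auto simp: \<eta>_def)
    have "(\<lambda>t. s + t) ` word_ball S k \<subseteq> ?B" using s by auto
    then obtain b2 where b2: "weights b2 ?B"
      "avg b2 ?B C = avg (\<lambda>t. a (- s + t)) ((\<lambda>t. s + t) ` word_ball S k) C"
      using weights_mono[OF weights_translate[OF aw] _ fB, of s C] by blast
    then have b2': "avg b2 ?B C x = \<eta> (- s + x)" for x
      using avg_translate[OF finite_word_ball[OF S]] by (simp add: \<eta>_def)
    have i2s: "integrable m (\<lambda>x. (\<eta> (- s + x))\<^sup>2)" using integrable_translate[OF i2] .
    let ?mid = "\<lambda>x. (\<eta> x + \<eta> (- s + x)) / 2"
    \<comment> \<open>The midpoint of the average and its translate is an average over the next
      ball, so its norm cannot fall below the infimum there.\<close>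
    have "d (Suc k) \<le> Q (Suc k) (\<lambda>t. (b1 t + b2 t) / 2)"
      using weights_midpoint(1)[OF b1(1) b2(1)] by (intro dQ) (simp add: W_def)
    also have "\<dots> = (\<integral>x. (?mid x)\<^sup>2 \<partial>m)"
      unfolding Q_def weights_midpoint(2)[OF b1(1) b2(1)] b1(2) b2' ..
    finally have mid: "d (Suc k) \<le> (\<integral>x. (?mid x)\<^sup>2 \<partial>m)" .
    have imid: "integrable m (\<lambda>x. (?mid x)\<^sup>2)"
      using avg_square_integrable[OF weights_midpoint(1)[OF b1(1) b2(1)] C]
      unfolding weights_midpoint(2)[OF b1(1) b2(1)] b1(2) b2' .
    have "(\<lambda>x. (\<eta> x - \<eta> (- s + x))\<^sup>2) = (\<lambda>x. 2 * (\<eta> x)\<^sup>2 + 2 * (\<eta> (- s + x))\<^sup>2 - 4 * (?mid x)\<^sup>2)"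
      by (simp add: fun_eq_iff power2_eq_square field_simps)
    then have "(\<integral>x. (\<eta> x - \<eta> (- s + x))\<^sup>2 \<partial>m)
        = 2 * (\<integral>x. (\<eta> x)\<^sup>2 \<partial>m) + 2 * (\<integral>x. (\<eta> (- s + x))\<^sup>2 \<partial>m) - 4 * (\<integral>x. (?mid x)\<^sup>2 \<partial>m)"
      using i2 i2s imid by simp
    also have "(\<integral>x. (\<eta> (- s + x))\<^sup>2 \<partial>m) = (\<integral>x. (\<eta> x)\<^sup>2 \<partial>m)"
      by (rule integral_translate) simp
    also have "2 * (\<integral>x. (\<eta> x)\<^sup>2 \<partial>m) + 2 * (\<integral>x. (\<eta> x)\<^sup>2 \<partial>m) - 4 * (\<integral>x. (?mid x)\<^sup>2 \<partial>m) \<le> 8 * \<mu> / n"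
      using mid a(2) k(2) by (simp add: Q_def \<eta>_def)
    finally show "(\<integral>x. (avg a (word_ball S k) C x - avg a (word_ball S k) C (- s + x))\<^sup>2 \<partial>m) \<le> 8 * measure m C / n"
      by (simp add: \<eta>_def \<mu>_def)
  qed
qed

section \<open>Reiter's condition\<close>

definition prob_density :: "('a \<Rightarrow> real) \<Rightarrow> bool" where
  "prob_density p \<longleftrightarrow> integrable m p \<and> (\<forall>x. 0 \<le> p x) \<and> (\<integral>x. p x \<partial>m) = 1 \<and>
     (\<exists>A\<in>fmeasurable m. \<forall>x. x \<notin> A \<longrightarrow> p x = 0)"

text \<open>Reiter's condition in L1, with finite sets in place of the compact sets of its usual
  form.\<close>

definition reiter :: bool where
  "reiter \<longleftrightarrow> (\<forall>S \<delta>. finite S \<and> 0 < \<delta> \<longrightarrow>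
     (\<exists>p. prob_density p \<and> (\<forall>s\<in>S. (\<integral>x. \<bar>p (- s + x) - p x\<bar> \<partial>m) \<le> \<delta>)))"

text \<open>Treated separately because (iii) can be vacuous in a finite group, where perhaps no
  \<open>F\<close> has enough elements. The constant density is exactly invariant.\<close>

lemma reiter_if_finite:
  assumes "finite (UNIV :: 'a set)" shows reiter
proof -
  have U: "UNIV \<in> fmeasurable m" using finite_imp_compact[OF assms] by (rule compact_fmeasurable)
  then have fin: "emeasure m UNIV \<noteq> \<infinity>" by (auto simp: fmeasurable_def)
  have "0 < measure m UNIV"
    using emeasure_UNIV fin by (simp add: emeasure_eq_measure2[OF U] zero_less_measure_iff)
  moreover have "integrable m (\<lambda>x. 1 / measure m UNIV)"
    using fin by (intro finite_measure.integrable_const finite_measureI) simp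
  ultimately have "prob_density (\<lambda>x. 1 / measure m UNIV)"
    using U by (auto simp: prob_density_def)
  then show ?thesis unfolding reiter_def by force
qed

text \<open>The order of the choices matters. The compact set depends on \<open>F\<close>, and the
  radius \<open>k\<close> at which averages become almost invariant depends on the compact set; only
  \<open>k < N\<close> is known in advance. So \<open>N\<close> is fixed from
  \<open>\<delta>\<close> and the constant of \<open>avg_square_ge\<close>, which involves only
  \<open>e\<close> and \<open>n0\<close>, and \<open>F\<close> is made to contain the whole ball of
  radius \<open>N\<close>.\<close>

lemma reiter_if_small_products:
  assumes e: "0 < e" "e < 1" and n0: "1 \<le> n0"
    and small: "\<And>F::'a set. finite F \<Longrightarrow> n0 \<le> card F \<Longrightarrow> \<exists>C. compact C \<and>
      (\<forall>E. E \<subseteq> F \<and> n0 \<le> card E \<longrightarrow> measure m (E + C) < e * real (card E) * measure m C)"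
  shows reiter
proof (cases "finite (UNIV :: 'a set)")
  case infinite: False
  show ?thesis unfolding reiter_def
  proof (intro allI impI, elim conjE)
    fix S :: "'a set" and \<delta> :: real assume S: "finite S" and \<delta>: "0 < \<delta>"
    define c where "c = ((1 - e) / (real n0)\<^sup>2)\<^sup>2"
    have c: "0 < c" using e n0 by (simp add: c_def)
    \<comment> \<open>Young's parameter for the product of the difference and the sum of
      \<open>\<eta>\<close> and its translate: the sum contributes at most
      \<open>2 * \<kappa> * \<mu>\<close>, half of \<open>\<delta> * c * \<mu>\<close>. The choice
      of \<open>N\<close> bounds the contribution of the difference by the other half.\<close>
    define \<kappa> where "\<kappa> = \<delta> * c / 4"
    have \<kappa>: "0 < \<kappa>" using \<delta> c by (simp add: \<kappa>_def)
    obtain N :: nat where N: "8 / (\<kappa> * \<delta> * c) < N" using reals_Archimedean2 by blast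
    have "0 < 8 / (\<kappa> * \<delta> * c)" using \<kappa> \<delta> c by simp
    then have N0: "0 < N" using N by (metis less_trans of_nat_0_less_iff)
    \<comment> \<open>Word balls may stay small, for instance if \<open>S\<close> generates a finite
      subgroup; \<open>F0\<close> pads \<open>F\<close> to at least \<open>n0\<close>
      elements.\<close>
    obtain F0 :: "'a set" where F0: "finite F0" "card F0 = n0"
      using infinite_arbitrarily_large[OF infinite] by blast
    define F where "F = word_ball S N \<union> F0"
    have F: "finite F" "n0 \<le> card F" "word_ball S N \<subseteq> F"
      using F0 finite_word_ball[OF S] card_mono[of F F0] by (auto simp: F_def)
    obtain C where C: "compact C" and sm:
      "\<And>E. E \<subseteq> F \<Longrightarrow> n0 \<le> card E \<Longrightarrow> measure m (E + C) < e * real (card E) * measure m C"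
      using small[OF F(1,2)] by blast
    define \<mu> where "\<mu> = measure m C"
    \<comment> \<open>The strict inequality for \<open>E = F\<close> excludes a null set
      \<open>C\<close>.\<close>
    have "0 < e * real (card F) * \<mu>"
      using sm[OF order_refl F(2)] measure_nonneg[of m "F + C"] unfolding \<mu>_def by linarith
    then have \<mu>: "0 < \<mu>" using e by (simp add: zero_less_mult_iff \<mu>_def)
    obtain k a where k: "k < N" and a: "weights a (word_ball S k)" and inv:
      "\<And>s. s \<in> S \<Longrightarrow> (\<integral>x. (avg a (word_ball S k) C x - avg a (word_ball S k) C (- s + x))\<^sup>2 \<partial>m) \<le> 8 * \<mu> / N"
      using ex_almost_invariant_avg[OF C S N0 \<mu>[unfolded \<mu>_def], folded \<mu>_def] by blast
    define \<eta> where "\<eta> = avg a (word_ball S k) C"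
    \<comment> \<open>Extended by zero, the weights live on \<open>F\<close>, where the lower bound
      for the square norm applies.\<close>
    have "word_ball S k \<subseteq> F" using word_ball_mono[of k N S] k F by auto
    then obtain b where b: "weights b F" "avg b F C = \<eta>"
      using weights_mono[OF a _ F(1), of C] by (auto simp: \<eta>_def)
    define q where "q = (\<integral>x. (\<eta> x)\<^sup>2 \<partial>m)"
    have q: "c * \<mu> \<le> q"
      using avg_square_ge[OF C F(1,2) n0 e(2) less_imp_le[OF e(1)] sm b(1)] b(2)
      by (simp add: q_def \<mu>_def c_def)
    then have q0: "0 < q" using c \<mu> by (meson less_le_trans mult_pos_pos)
    have [measurable]: "C \<in> sets borel" using compact_fmeasurable[OF C] by (auto dest: fmeasurableD)
    have [measurable]: "\<eta> \<in> borel_measurable borel" by (simp add: \<eta>_def)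
    have i2: "integrable m (\<lambda>x. (\<eta> x)\<^sup>2)"
      using avg_square_integrable[OF a C] by (simp add: \<eta>_def)
    have q\<mu>: "q \<le> \<mu>" using avg_square_le[OF a C] by (simp add: q_def \<mu>_def \<eta>_def)
    have supp: "\<eta> x = 0" if "x \<notin> (\<Union>t\<in>word_ball S k. (\<lambda>x. t + x) ` C)" for x
      using that unfolding \<eta>_def avg_def indicator_translate by (intro sum.neutral) auto
    show "\<exists>p. prob_density p \<and> (\<forall>s\<in>S. (\<integral>x. \<bar>p (- s + x) - p x\<bar> \<partial>m) \<le> \<delta>)"
    proof (intro exI conjI ballI)
      show "prob_density (\<lambda>x. (\<eta> x)\<^sup>2 / q)"
        unfolding prob_density_def
      proof (intro conjI bexI allI impI)
        show "(\<Union>t\<in>word_ball S k. (\<lambda>x. t + x) ` C) \<in> fmeasurable m"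
          using compact_fmeasurable[OF compact_translate[OF C]]
          by (intro fmeasurable.finite_UN finite_word_ball S) auto
      qed (use i2 q0 supp in \<open>auto simp: q_def\<close>)
      fix s assume s: "s \<in> S"
      let ?\<eta>s = "\<lambda>x. \<eta> (- s + x)"
      have i2s: "integrable m (\<lambda>x. (?\<eta>s x)\<^sup>2)" using integrable_translate[OF i2] .
      have sq: "(\<integral>x. (?\<eta>s x)\<^sup>2 \<partial>m) = q" unfolding q_def by (rule integral_translate) simp
      have iprod: "integrable m (\<lambda>x. \<eta> x * ?\<eta>s x)"
      proof (rule Bochner_Integration.integrable_bound[where f = "\<lambda>x. (\<eta> x)\<^sup>2 + (?\<eta>s x)\<^sup>2"])
        show "AE x in m. norm (\<eta> x * ?\<eta>s x) \<le> norm ((\<eta> x)\<^sup>2 + (?\<eta>s x)\<^sup>2)"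
        proof (rule AE_I2)
          fix x
          have "2 * \<bar>\<eta> x\<bar> * \<bar>?\<eta>s x\<bar> \<le> (\<eta> x)\<^sup>2 + (?\<eta>s x)\<^sup>2"
            using zero_le_power2[of "\<bar>\<eta> x\<bar> - \<bar>?\<eta>s x\<bar>"] by (simp add: power2_diff)
          moreover have "0 \<le> \<bar>\<eta> x\<bar> * \<bar>?\<eta>s x\<bar>" by simp
          ultimately have "\<bar>\<eta> x\<bar> * \<bar>?\<eta>s x\<bar> \<le> (\<eta> x)\<^sup>2 + (?\<eta>s x)\<^sup>2"
            unfolding mult.assoc by linarith
          then show "norm (\<eta> x * ?\<eta>s x) \<le> norm ((\<eta> x)\<^sup>2 + (?\<eta>s x)\<^sup>2)"
            by (simp add: abs_mult)
        qed
      qed (use i2 i2s in auto)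
      have id: "integrable m (\<lambda>x. (\<eta> x - ?\<eta>s x)\<^sup>2)"
      proof -
        have "(\<lambda>x. (\<eta> x - ?\<eta>s x)\<^sup>2) = (\<lambda>x. (\<eta> x)\<^sup>2 + (?\<eta>s x)\<^sup>2 - 2 * (\<eta> x * ?\<eta>s x))"
          by (simp add: fun_eq_iff power2_diff)
        then show ?thesis using i2 i2s iprod by simp
      qed
      let ?b = "\<lambda>x. (\<eta> x - ?\<eta>s x)\<^sup>2 / (2 * \<kappa>) + \<kappa> * ((\<eta> x)\<^sup>2 + (?\<eta>s x)\<^sup>2)"
      have "(\<integral>x. \<bar>(?\<eta>s x)\<^sup>2 - (\<eta> x)\<^sup>2\<bar> \<partial>m) \<le> (\<integral>x. ?b x \<partial>m)"
      proof (rule integral_mono)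
        fix x
        let ?u = "\<bar>\<eta> x - ?\<eta>s x\<bar>" and ?v = "\<bar>\<eta> x + ?\<eta>s x\<bar>"
        have "2 * \<kappa> * (?u * ?v) \<le> ?u\<^sup>2 + \<kappa>\<^sup>2 * ?v\<^sup>2"
          using zero_le_power2[of "?u - \<kappa> * ?v"] by (simp add: power2_diff power_mult_distrib algebra_simps)
        also have "?v\<^sup>2 \<le> 2 * ((\<eta> x)\<^sup>2 + (?\<eta>s x)\<^sup>2)"
          using zero_le_power2[of "\<eta> x - ?\<eta>s x"] by (simp add: power2_diff power2_sum)
        finally have "2 * \<kappa> * (?u * ?v) \<le> ?u\<^sup>2 + \<kappa>\<^sup>2 * (2 * ((\<eta> x)\<^sup>2 + (?\<eta>s x)\<^sup>2))"
          by (simp add: mult_left_mono)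
        then have "?u * ?v \<le> ?b x"
          using \<kappa> by (simp add: field_simps power2_eq_square)
        moreover have "\<bar>(?\<eta>s x)\<^sup>2 - (\<eta> x)\<^sup>2\<bar> = ?u * ?v"
          by (simp add: abs_mult[symmetric] power2_eq_square algebra_simps abs_minus_commute)
        ultimately show "\<bar>(?\<eta>s x)\<^sup>2 - (\<eta> x)\<^sup>2\<bar> \<le> ?b x" by simp
      qed (use i2 i2s id in auto)
      also have "\<dots> = (\<integral>x. (\<eta> x - ?\<eta>s x)\<^sup>2 \<partial>m) / (2 * \<kappa>) + \<kappa> * (q + q)"
        using i2 i2s id sq by (simp add: q_def)
      also have "\<dots> \<le> (8 * \<mu> / N) / (2 * \<kappa>) + \<kappa> * (\<mu> + \<mu>)"
        using inv[OF s] \<kappa> q\<mu> by (intro add_mono divide_right_mono mult_left_mono) (auto simp: \<eta>_def)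
      also have "\<dots> \<le> \<delta> * c / 2 * \<mu> + \<delta> * c / 2 * \<mu>"
      proof (rule add_mono)
        have "4 / (N * \<kappa>) \<le> \<delta> * c / 2"
          using N N0 \<kappa> \<delta> c by (simp add: field_simps)
        then have "4 / (N * \<kappa>) * \<mu> \<le> \<delta> * c / 2 * \<mu>" using \<mu> by (intro mult_right_mono) auto
        then show "8 * \<mu> / N / (2 * \<kappa>) \<le> \<delta> * c / 2 * \<mu>" by (simp add: field_simps)
      qed (simp add: \<kappa>_def)
      also have "\<dots> = \<delta> * (c * \<mu>)" by simp
      also have "\<dots> \<le> \<delta> * q" using q \<delta> by (intro mult_left_mono) auto
      finally have "(\<integral>x. \<bar>(?\<eta>s x)\<^sup>2 - (\<eta> x)\<^sup>2\<bar> \<partial>m) \<le> \<delta> * q" .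
      moreover have "(\<lambda>x. \<bar>(?\<eta>s x)\<^sup>2 / q - (\<eta> x)\<^sup>2 / q\<bar>) = (\<lambda>x. \<bar>(?\<eta>s x)\<^sup>2 - (\<eta> x)\<^sup>2\<bar> / q)"
        using q0 by (simp add: fun_eq_iff abs_divide flip: diff_divide_distrib)
      ultimately show "(\<integral>x. \<bar>(?\<eta>s x)\<^sup>2 / q - (\<eta> x)\<^sup>2 / q\<bar> \<partial>m) \<le> \<delta>"
        using q0 by (simp add: field_simps)
    qed
  qed
qed (rule reiter_if_finite)

subsection \<open>Invariant means as limits of densities\<close>

lemma LinftyE:
  assumes "f \<in> Linfty m"
  obtains c where "0 \<le> c" "locally_AE m (\<lambda>x. norm (f x) \<le> c)"
proof -
  obtain c where "locally_AE m (\<lambda>x. norm (f x) \<le> c)"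
    using assms by (auto simp: Linfty_def)
  then have "locally_AE m (\<lambda>x. norm (f x) \<le> max 0 c)"
    unfolding locally_AE_def by (auto elim!: eventually_mono)
  then show ?thesis by (intro that[of "max 0 c"]) auto
qed

lemma locally_AE_mono:
  assumes "locally_AE m P" "\<And>x. P x \<Longrightarrow> Q x" shows "locally_AE m Q"
  using assms unfolding locally_AE_def by (blast intro: eventually_mono)

lemma locally_AE_conj:
  assumes "locally_AE m P" "locally_AE m Q" shows "locally_AE m (\<lambda>x. P x \<and> Q x)"
  unfolding locally_AE_def
proof (intro ballI impI)
  fix A assume "A \<in> sets m" "emeasure m A < \<infinity>"
  then have "AE x in m. x \<in> A \<longrightarrow> P x" "AE x in m. x \<in> A \<longrightarrow> Q x"
    using assms unfolding locally_AE_def by blast+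
  then show "AE x in m. x \<in> A \<longrightarrow> P x \<and> Q x" by eventually_elim auto
qed

lemma locally_AE_translate:
  assumes "locally_AE m P" shows "locally_AE m (\<lambda>x. P (s + x))"
  unfolding locally_AE_def
proof (intro ballI impI)
  fix A assume A: "A \<in> sets m" "emeasure m A < \<infinity>"
  let ?A = "(\<lambda>x. s + x) ` A"
  have "?A \<in> sets m" "emeasure m ?A < \<infinity>" using A by (auto simp: emeasure_translate)
  then have "AE x in m. x \<in> ?A \<longrightarrow> P x" using assms by (auto simp: locally_AE_def)
  then have "AE x in distr m m (\<lambda>x. s + x). x \<in> ?A \<longrightarrow> P x" unfolding distr_translate .
  then have "AE x in m. s + x \<in> ?A \<longrightarrow> P (s + x)" by (rule AE_distrD[rotated]) simp
  then show "AE x in m. x \<in> A \<longrightarrow> P (s + x)" by eventually_elim auto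
qed

lemma locally_measurable_iff:
  "locally_measurable m f \<longleftrightarrow>
     (\<forall>A\<in>fmeasurable m. (\<lambda>x. indicator A x *\<^sub>R f x) \<in> borel_measurable m)"
  by (auto simp: locally_measurable_def set_borel_measurable_def fmeasurable_def)

lemma Linfty_add:
  assumes "f \<in> Linfty m" "g \<in> Linfty m" shows "(\<lambda>x. f x + g x) \<in> Linfty m"
proof -
  obtain c d where "locally_AE m (\<lambda>x. norm (f x) \<le> c)" "locally_AE m (\<lambda>x. norm (g x) \<le> d)"
    using assms by (auto simp: Linfty_def)
  then have "locally_AE m (\<lambda>x. norm (f x) \<le> c \<and> norm (g x) \<le> d)" by (rule locally_AE_conj)
  then have "locally_AE m (\<lambda>x. norm (f x + g x) \<le> c + d)"
    by (rule locally_AE_mono) (meson add_mono norm_triangle_le)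
  moreover have "locally_measurable m (\<lambda>x. f x + g x)"
    unfolding locally_measurable_iff scaleR_add_right
    using assms by (intro ballI borel_measurable_add) (auto simp: Linfty_def locally_measurable_iff)
  ultimately show ?thesis by (auto simp: Linfty_def)
qed

lemma Linfty_cmult:
  assumes "f \<in> Linfty m" shows "(\<lambda>x. k * f x) \<in> Linfty m"
proof -
  obtain c where "locally_AE m (\<lambda>x. norm (f x) \<le> c)"
    using assms by (auto simp: Linfty_def)
  then have "locally_AE m (\<lambda>x. norm (k * f x) \<le> norm k * c)"
    by (rule locally_AE_mono) (simp add: norm_mult mult_left_mono)
  then show ?thesis
    using assms by (auto simp: Linfty_def locally_measurable_iff simp flip: mult_scaleR_right)
qed

lemma Linfty_const: "(\<lambda>x. k) \<in> Linfty m"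
  by (auto simp: Linfty_def locally_measurable_iff locally_AE_def fmeasurableD intro!: exI[of _ "norm k"])

lemma Linfty_translate:
  assumes "f \<in> Linfty m" shows "(\<lambda>x. f (s + x)) \<in> Linfty m"
proof -
  have "(\<lambda>x. indicator A x *\<^sub>R f (s + x)) \<in> borel_measurable m" if A: "A \<in> fmeasurable m" for A
  proof -
    let ?A = "(\<lambda>x. s + x) ` A"
    have "?A \<in> fmeasurable m"
      using A by (auto simp: fmeasurable_def emeasure_translate)
    then have [measurable]: "(\<lambda>x. indicator ?A x *\<^sub>R f x) \<in> borel_measurable m"
      using assms by (auto simp: Linfty_def locally_measurable_iff)
    have "(\<lambda>x. indicator ?A (s + x) *\<^sub>R f (s + x)) \<in> borel_measurable m"
      by (rule measurable_compose[where f = "\<lambda>x. s + x" and g = "\<lambda>x. indicator ?A x *\<^sub>R f x" and N = m]) simp_all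
    moreover have "indicator ?A (s + x) = (indicator A x :: real)" for x
      by (auto simp: indicator_def)
    ultimately show ?thesis by simp
  qed
  then show ?thesis
    using assms locally_AE_translate[of "\<lambda>x. norm (f x) \<le> _" s]
    by (auto simp: Linfty_def locally_measurable_iff)
qed

text \<open>The support condition in \<open>prob_density\<close> serves this purpose: local
  statements hold almost everywhere where a density does not vanish.\<close>

lemma AE_of_locally_AE:
  assumes "locally_AE m P" "prob_density p"
  shows "AE x in m. p x \<noteq> 0 \<longrightarrow> P x"
proof -
  obtain A where A: "A \<in> fmeasurable m" "\<And>x. x \<notin> A \<Longrightarrow> p x = 0"
    using assms(2) by (auto simp: prob_density_def)
  then have "AE x in m. x \<in> A \<longrightarrow> P x" using assms(1) by (auto simp: locally_AE_def fmeasurable_def)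
  then show ?thesis by eventually_elim (use A in auto)
qed

text \<open>\<open>f\<close> itself need not be Borel measurable, but its product with a measurable
  function that vanishes off a set of finite measure is.\<close>

lemma integrable_Linfty:
  assumes f: "f \<in> Linfty m" and p: "integrable m p"
    and A: "A \<in> fmeasurable m" "\<And>x. x \<notin> A \<Longrightarrow> p x = (0::real)"
  shows "integrable m (\<lambda>x. p x *\<^sub>R f x)"
proof -
  obtain c where c: "0 \<le> c" "locally_AE m (\<lambda>x. norm (f x) \<le> c)" using LinftyE[OF f] .
  have [measurable]: "(\<lambda>x. indicator A x *\<^sub>R f x) \<in> borel_measurable m"
    using f A by (auto simp: Linfty_def locally_measurable_iff)
  have [measurable]: "p \<in> borel_measurable m" using p by auto
  have "(\<lambda>x. p x *\<^sub>R (indicator A x *\<^sub>R f x)) \<in> borel_measurable m" by measurable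
  moreover have "(\<lambda>x. p x *\<^sub>R (indicator A x *\<^sub>R f x)) = (\<lambda>x. p x *\<^sub>R f x)"
    using A(2) by (auto simp: fun_eq_iff indicator_def)
  ultimately have meas: "(\<lambda>x. p x *\<^sub>R f x) \<in> borel_measurable m" by simp
  have "AE x in m. x \<in> A \<longrightarrow> norm (f x) \<le> c" using c(2) A by (auto simp: locally_AE_def fmeasurable_def)
  then have "AE x in m. norm (p x *\<^sub>R f x) \<le> norm (c * p x)"
  proof eventually_elim
    case (elim x)
    then show ?case
      using c(1) A(2)[of x] mult_left_mono[of "norm (f x)" c "\<bar>p x\<bar>"]
      by (cases "x \<in> A") (auto simp: abs_mult mult.commute)
  qed
  then show ?thesis using p meas by (intro Bochner_Integration.integrable_bound[OF _ meas, of "\<lambda>x. c * p x"]) auto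
qed

lemma norm_integral_Linfty_le:
  assumes f: "f \<in> Linfty m" "locally_AE m (\<lambda>x. norm (f x) \<le> c)" "0 \<le> c"
    and p: "integrable m p" and A: "A \<in> fmeasurable m" "\<And>x. x \<notin> A \<Longrightarrow> p x = (0::real)"
  shows "norm (\<integral>x. p x *\<^sub>R f x \<partial>m) \<le> c * (\<integral>x. \<bar>p x\<bar> \<partial>m)"
proof -
  have "AE x in m. x \<in> A \<longrightarrow> norm (f x) \<le> c" using f A by (auto simp: locally_AE_def fmeasurable_def)
  then have "AE x in m. norm (p x *\<^sub>R f x) \<le> c * \<bar>p x\<bar>"
  proof eventually_elim
    case (elim x)
    then show ?case
      using f(3) A(2)[of x] mult_left_mono[of "norm (f x)" c "\<bar>p x\<bar>"]
      by (cases "x \<in> A") (auto simp: mult.commute)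
  qed
  then have "(\<integral>x. norm (p x *\<^sub>R f x) \<partial>m) \<le> (\<integral>x. c * \<bar>p x\<bar> \<partial>m)"
    using p integrable_norm[OF integrable_Linfty[OF f(1) p A]] by (intro integral_mono_AE) auto
  with integral_norm_bound[of m "\<lambda>x. p x *\<^sub>R f x"] show ?thesis by simp
qed

section \<open>Means given by densities, and their limits\<close>

definition pairing :: "('a \<Rightarrow> real) \<Rightarrow> ('a \<Rightarrow> complex) \<Rightarrow> complex" where
  "pairing p f = (\<integral>x. p x *\<^sub>R f x \<partial>m)"

text \<open>Invariance is left out because a single density gives it only approximately; the
  conditions kept here hold for every density and pass to pointwise limits.\<close>

definition mean :: "(('a \<Rightarrow> complex) \<Rightarrow> complex) \<Rightarrow> bool" where
  "mean \<Lambda> \<longleftrightarrow>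
     (\<forall>f\<in>Linfty m. \<forall>g\<in>Linfty m. locally_AE m (\<lambda>x. f x = g x) \<longrightarrow> \<Lambda> f = \<Lambda> g) \<and>
     (\<forall>f\<in>Linfty m. \<forall>g\<in>Linfty m. \<Lambda> (\<lambda>x. f x + g x) = \<Lambda> f + \<Lambda> g) \<and>
     (\<forall>c. \<forall>f\<in>Linfty m. \<Lambda> (\<lambda>x. c * f x) = c * \<Lambda> f) \<and>
     (\<forall>f\<in>Linfty m. locally_AE m (\<lambda>x. f x \<in> \<real>\<^sub>\<ge>\<^sub>0) \<longrightarrow> \<Lambda> f \<in> \<real>\<^sub>\<ge>\<^sub>0) \<and>
     \<Lambda> (\<lambda>x. 1) = 1"

lemma prob_density_integrable:
  assumes "prob_density p" "f \<in> Linfty m" shows "integrable m (\<lambda>x. p x *\<^sub>R f x)"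
  using assms integrable_Linfty[OF assms(2)] by (auto simp: prob_density_def)

text \<open>The value 0 off \<open>Linfty m\<close> places the functional in the compact product of
  discs from which the cluster point is taken.\<close>

lemma mean_pairing:
  assumes p: "prob_density p"
  shows "mean (\<lambda>f. if f \<in> Linfty m then pairing p f else 0)"
  unfolding mean_def
proof (intro conjI ballI impI allI)
  note [simp] = Linfty_add Linfty_cmult Linfty_const
  note int = prob_density_integrable[OF p]
  fix f g assume f: "f \<in> Linfty m"
  {
    assume g: "g \<in> Linfty m" and eq: "locally_AE m (\<lambda>x. f x = g x)"
    have "pairing p f = pairing p g" unfolding pairing_def
    proof (rule integral_cong_AE)
      show "AE x in m. p x *\<^sub>R f x = p x *\<^sub>R g x"
        using AE_of_locally_AE[OF eq p] by eventually_elim auto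
    qed (use int f g in \<open>auto dest: borel_measurable_integrable\<close>)
    then show "(if f \<in> Linfty m then pairing p f else 0) = (if g \<in> Linfty m then pairing p g else 0)"
      using f g by simp
  }
  {
    assume g: "g \<in> Linfty m"
    then show "(if (\<lambda>x. f x + g x) \<in> Linfty m then pairing p (\<lambda>x. f x + g x) else 0) =
      (if f \<in> Linfty m then pairing p f else 0) + (if g \<in> Linfty m then pairing p g else 0)"
      using f int by (simp add: pairing_def scaleR_add_right)
  }
  show "(if (\<lambda>x. c * f x) \<in> Linfty m then pairing p (\<lambda>x. c * f x) else 0) =
      c * (if f \<in> Linfty m then pairing p f else 0)" for c
    using f int by (simp add: pairing_def flip: mult_scaleR_right)
  {
    assume nn: "locally_AE m (\<lambda>x. f x \<in> \<real>\<^sub>\<ge>\<^sub>0)"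
    have "AE x in m. p x *\<^sub>R f x = complex_of_real (p x * Re (f x))"
      using AE_of_locally_AE[OF nn p]
      by eventually_elim (auto simp: complex_eq_iff complex_nonneg_Reals_iff)
    then have "pairing p f = (\<integral>x. complex_of_real (p x * Re (f x)) \<partial>m)"
      unfolding pairing_def
    proof (intro integral_cong_AE)
      have meas: "(\<lambda>x. p x *\<^sub>R f x) \<in> borel_measurable m"
        using int[OF f] by (rule borel_measurable_integrable)
      then have "(\<lambda>x. complex_of_real (Re (p x *\<^sub>R f x))) \<in> borel_measurable m" by measurable
      then show "(\<lambda>x. complex_of_real (p x * Re (f x))) \<in> borel_measurable m" by simp
    qed (use int[OF f] in \<open>auto dest: borel_measurable_integrable\<close>)
    also have "\<dots> = complex_of_real (\<integral>x. p x * Re (f x) \<partial>m)" by (rule integral_complex_of_real)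
    also have "\<dots> \<in> \<real>\<^sub>\<ge>\<^sub>0"
    proof -
      have "AE x in m. 0 \<le> p x * Re (f x)"
        using AE_of_locally_AE[OF nn p]
        by eventually_elim (use p in \<open>auto simp: prob_density_def complex_nonneg_Reals_iff\<close>)
      then show ?thesis by (simp add: integral_nonneg_AE)
    qed
    finally show "(if f \<in> Linfty m then pairing p f else 0) \<in> \<real>\<^sub>\<ge>\<^sub>0" using f by simp
  }
next
  have "pairing p (\<lambda>x. 1) = (\<integral>x. complex_of_real (p x) \<partial>m)"
    by (simp add: pairing_def scaleR_conv_of_real)
  also have "\<dots> = 1" using p by (simp add: prob_density_def)
  finally show "(if (\<lambda>x. 1) \<in> Linfty m then pairing p (\<lambda>x. 1) else 0) = 1"
    by (simp add: Linfty_const)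
qed

text \<open>Left invariance of the measure moves the translation from \<open>f\<close> to
  \<open>p\<close>; the error is then an L1 distance, uniformly over all \<open>f\<close> with the
  same bound.\<close>

lemma pairing_translate:
  assumes p: "prob_density p" and f: "f \<in> Linfty m"
    and c: "locally_AE m (\<lambda>x. norm (f x) \<le> c)" "0 \<le> c"
  shows "norm (pairing p (\<lambda>x. f (s + x)) - pairing p f) \<le> c * (\<integral>x. \<bar>p (- s + x) - p x\<bar> \<partial>m)"
proof -
  obtain A where A: "A \<in> fmeasurable m" "\<And>x. x \<notin> A \<Longrightarrow> p x = 0" and ip: "integrable m p"
    using p by (auto simp: prob_density_def)
  let ?A = "(\<lambda>x. s + x) ` A"
  have A': "?A \<union> A \<in> fmeasurable m"
  proof (rule fmeasurable.Un)
    show "?A \<in> fmeasurable m" using A by (auto simp: fmeasurable_def emeasure_translate)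
  qed (rule A)
  have pA: "p (- s + x) = 0" if "x \<notin> ?A" for x
    using that by (intro A(2)) (simp add: translate_image)
  have ips: "integrable m (\<lambda>x. p (- s + x))" by (rule integrable_translate[OF ip])
  have i1: "integrable m (\<lambda>x. p (- s + x) *\<^sub>R f x)"
    using integrable_Linfty[OF f ips A'] pA by auto
  have i2: "integrable m (\<lambda>x. p x *\<^sub>R f x)" by (rule prob_density_integrable[OF p f])
  have "pairing p (\<lambda>x. f (s + x)) = (\<integral>x. p (- s + (s + x)) *\<^sub>R f (s + x) \<partial>m)"
    by (simp add: pairing_def add.assoc[symmetric])
  also have "\<dots> = (\<integral>x. p (- s + x) *\<^sub>R f x \<partial>m)"
    using i1 by (intro integral_translate) (auto dest: borel_measurable_integrable)
  finally have "pairing p (\<lambda>x. f (s + x)) - pairing p f = (\<integral>x. (p (- s + x) - p x) *\<^sub>R f x \<partial>m)"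
    using i1 i2 by (simp add: pairing_def scaleR_diff_left)
  also have "norm \<dots> \<le> c * (\<integral>x. \<bar>p (- s + x) - p x\<bar> \<partial>m)"
    using ips ip pA A by (intro norm_integral_Linfty_le[OF f c _ A']) auto
  finally show ?thesis .
qed

text \<open>In the topology of pointwise convergence each condition is a closed relation between
  finitely many evaluations, and its premises do not mention \<open>\<Lambda>\<close>.\<close>

lemma closed_mean: "closed {\<Lambda>. mean \<Lambda>}"
proof -
  let ?ev = "\<lambda>f. \<lambda>\<Lambda>::('a \<Rightarrow> complex) \<Rightarrow> complex. \<Lambda> f"
  have ev: "continuous_on UNIV (?ev f)" for f by (rule continuous_on_product_coordinates)
  have nn: "closed {\<Lambda>. ?ev f \<Lambda> \<in> \<real>\<^sub>\<ge>\<^sub>0}" for f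
    using closed_vimage[OF closed_nonneg_Reals_complex ev[of f]] by (simp add: vimage_def)
  have eq: "closed {\<Lambda>. ?ev f \<Lambda> = ?ev g \<Lambda>}" for f g
    by (rule closed_Collect_eq[OF ev ev])
  have add: "closed {\<Lambda>. ?ev h \<Lambda> = ?ev f \<Lambda> + ?ev g \<Lambda>}" for f g h
    by (rule closed_Collect_eq[OF ev continuous_on_add[OF ev ev]])
  have mult: "closed {\<Lambda>. ?ev g \<Lambda> = c * ?ev f \<Lambda>}" for c f g
    by (rule closed_Collect_eq[OF ev continuous_on_mult[OF continuous_on_const ev]])
  have one: "closed {\<Lambda>. ?ev f \<Lambda> = 1}" for f
    by (rule closed_Collect_eq[OF ev continuous_on_const])
  show ?thesis
    unfolding mean_def Ball_def
    by (rule closed_Collect_conj | rule closed_Collect_all | rule nn eq add mult one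
      | rule closed_Collect_imp[OF open_Collect_const])+
qed

text \<open>Tychonoff's theorem and the finite intersection property take the place of weak-star
  compactness.\<close>

lemma amenable_if_reiter:
  assumes reiter shows "amenable m"
proof -
  define c where "c f = (SOME c. 0 \<le> c \<and> locally_AE m (\<lambda>x. norm (f x) \<le> c))" for f :: "'a \<Rightarrow> complex"
  have c: "0 \<le> c f \<and> locally_AE m (\<lambda>x. norm (f x) \<le> c f)" if f: "f \<in> Linfty m" for f
  proof -
    have "\<exists>c. 0 \<le> c \<and> locally_AE m (\<lambda>x. norm (f x) \<le> c)" by (rule LinftyE[OF f]) auto
    then show ?thesis unfolding c_def by (rule someI_ex)
  qed
  define K where "K = PiE UNIV (\<lambda>f. cball (0::complex) (if f \<in> Linfty m then c f else 0))"
  have K: "compact K"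
    using compactin_PiE[of "\<lambda>_. euclidean" UNIV "\<lambda>f. cball (0::complex) (if f \<in> Linfty m then c f else 0)"]
    by (simp add: K_def euclidean_product_topology)
  \<comment> \<open>The tolerance is proportional to the bound \<open>c f\<close>, so one density
    satisfies the condition for all \<open>f\<close> at once.\<close>
  define M where "M = (\<lambda>(s, n). {\<Lambda>. mean \<Lambda> \<and>
     (\<forall>f\<in>Linfty m. norm (\<Lambda> (\<lambda>x. f (s + x)) - \<Lambda> f) \<le> c f / real (Suc n))})"
  have "K \<inter> (\<Inter>i\<in>UNIV. M i) \<noteq> {}"
  proof (rule compact_imp_fip_image[OF K])
    fix i :: "'a \<times> nat"
    obtain s n where [simp]: "i = (s, n)" by force
    have "closed {\<Lambda>. mean \<Lambda> \<and> (\<forall>f. f \<in> Linfty m \<longrightarrow> norm (\<Lambda> (\<lambda>x. f (s + x)) - \<Lambda> f) \<le> c f / real (Suc n))}"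
      by (intro closed_Collect_conj closed_mean closed_Collect_all closed_Collect_imp open_Collect_const
          closed_Collect_le continuous_intros continuous_on_product_coordinates)
    then show "closed (M i)" by (simp add: M_def Ball_def)
  next
    fix I :: "('a \<times> nat) set" assume I: "finite I"
    \<comment> \<open>The finest tolerance among finitely many; the inserted 0 covers an empty
      \<open>I\<close>.\<close>
    define n where "n = Max (insert 0 (snd ` I))"
    have n: "k \<le> n" if "(s, k) \<in> I" for s k
      unfolding n_def using I that by (intro Max_ge) force+
    have "finite (fst ` I)" "0 < 1 / real (Suc n)" using I by auto
    then obtain p where p: "prob_density p"
      and inv: "\<And>s. s \<in> fst ` I \<Longrightarrow> (\<integral>x. \<bar>p (- s + x) - p x\<bar> \<partial>m) \<le> 1 / real (Suc n)"
      using assms unfolding reiter_def by metis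
    let ?L = "\<lambda>f. if f \<in> Linfty m then pairing p f else 0"
    have "?L \<in> K"
    proof -
      obtain A where A: "A \<in> fmeasurable m" "\<And>x. x \<notin> A \<Longrightarrow> p x = 0" and ip: "integrable m p"
        "(\<integral>x. \<bar>p x\<bar> \<partial>m) = 1"
        using p by (auto simp: prob_density_def)
      have "norm (pairing p f) \<le> c f" if "f \<in> Linfty m" for f
        using norm_integral_Linfty_le[OF that _ _ ip(1) A, of "c f"] c[OF that] ip(2)
        by (simp add: pairing_def)
      then show ?thesis by (auto simp: K_def)
    qed
    moreover have "?L \<in> M i" if "i \<in> I" for i
    proof -
      obtain s k where i: "i = (s, k)" by force
      have "norm (pairing p (\<lambda>x. f (s + x)) - pairing p f) \<le> c f / real (Suc k)" if f: "f \<in> Linfty m" for f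
      proof -
        have "norm (pairing p (\<lambda>x. f (s + x)) - pairing p f) \<le> c f * (\<integral>x. \<bar>p (- s + x) - p x\<bar> \<partial>m)"
          using c[OF f] by (intro pairing_translate[OF p f]) auto
        also have "\<dots> \<le> c f * (1 / real (Suc n))"
          using c[OF f] \<open>i \<in> I\<close> i by (intro mult_left_mono inv) force+
        also have "\<dots> \<le> c f * (1 / real (Suc k))"
          using c[OF f] n[of s k] \<open>i \<in> I\<close> i by (intro mult_left_mono) (auto simp: field_simps)
        finally show ?thesis by simp
      qed
      then show ?thesis using mean_pairing[OF p] by (simp add: M_def i Linfty_translate)
    qed
    ultimately show "K \<inter> (\<Inter>i\<in>I. M i) \<noteq> {}" by blast
  qed
  then obtain \<Lambda> where \<Lambda>: "\<And>s n. \<Lambda> \<in> M (s, n)" by auto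
  have "\<Lambda> (\<lambda>x. f (s + x)) = \<Lambda> f" if f: "f \<in> Linfty m" for s f
  proof -
    have "(\<lambda>n. c f / real (Suc n)) \<longlonglongrightarrow> 0" by (rule LIMSEQ_Suc[OF lim_const_over_n])
    then have "norm (\<Lambda> (\<lambda>x. f (s + x)) - \<Lambda> f) \<le> 0"
      using \<Lambda>[of s] f by (intro LIMSEQ_le_const) (auto simp: M_def)
    then show ?thesis by simp
  qed
  moreover have "mean \<Lambda>" using \<Lambda>[of 0 0] by (simp add: M_def)
  ultimately have "left_invariant_mean m \<Lambda>" unfolding left_invariant_mean_def mean_def by blast
  then show ?thesis by (auto simp: amenable_def)
qed

end

subsection \<open>Ekeland's variational principle\<close>

text \<open>Stated for a distance function on a set, because distinct functions may have L1 distance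
  0. Completeness is asked in the form that the proof produces, for sequences with summable steps.
  The sequence moves from each point to a near-minimizer of \<open>J\<close> among the points where
  \<open>J\<close> has decreased by at least \<open>e\<close> times the distance travelled.\<close>

lemma ekeland:
  fixes d :: "'b \<Rightarrow> 'b \<Rightarrow> real" and J :: "'b \<Rightarrow> real"
  assumes x0: "x0 \<in> D"
    and d0: "\<And>x y. 0 \<le> d x y" and refl: "\<And>x. d x x = 0"
    and tri: "\<And>x y z. x \<in> D \<Longrightarrow> y \<in> D \<Longrightarrow> z \<in> D \<Longrightarrow> d x z \<le> d x y + d y z"
    and J0: "\<And>x. x \<in> D \<Longrightarrow> 0 \<le> J x"
    and lip: "\<And>x y. x \<in> D \<Longrightarrow> y \<in> D \<Longrightarrow> J y \<le> J x + L * d x y"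
    and compl: "\<And>X. (\<And>n. X n \<in> D) \<Longrightarrow> summable (\<lambda>n. d (X n) (X (Suc n))) \<Longrightarrow>
      \<exists>x\<in>D. (\<lambda>n. d (X n) x) \<longlonglongrightarrow> 0"
    and e: "0 < (e::real)"
  obtains x where "x \<in> D" "\<And>y. y \<in> D \<Longrightarrow> J x \<le> J y + e * d x y"
proof -
  define S where "S x = {y \<in> D. J y + e * d x y \<le> J x}" for x
  have S_refl: "x \<in> S x" if "x \<in> D" for x using that by (simp add: S_def refl)
  have ex: "\<exists>y\<in>S x. \<forall>z\<in>S x. J y \<le> J z + (1/2) ^ n" if x: "x \<in> D" for x and n :: nat
  proof -
    have bdd: "bdd_below (J ` S x)" using J0 by (intro bdd_belowI[of _ 0]) (auto simp: S_def)
    have "Inf (J ` S x) < Inf (J ` S x) + (1/2) ^ n" by simp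
    then obtain y where y: "y \<in> S x" "J y < Inf (J ` S x) + (1/2) ^ n"
      using cInf_lessD[of "J ` S x"] S_refl[OF x] by blast
    moreover have "Inf (J ` S x) \<le> J z" if "z \<in> S x" for z
      using that bdd by (intro cInf_lower) auto
    ultimately have "\<forall>z\<in>S x. J y \<le> J z + (1/2) ^ n" by fastforce
    with y(1) show ?thesis by blast
  qed
  have "\<exists>X. \<forall>n. X n \<in> D \<and> (X (Suc n) \<in> S (X n) \<and> (\<forall>z\<in>S (X n). J (X (Suc n)) \<le> J z + (1/2) ^ n))"
  proof (rule dependent_nat_choice)
    show "\<exists>y. y \<in> D \<and> (y \<in> S x \<and> (\<forall>z\<in>S x. J y \<le> J z + (1/2) ^ n))" if "x \<in> D" for x n
      using ex[OF that, of n] by (auto simp: S_def)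
  qed (use x0 in auto)
  then obtain X where XD: "\<And>n. X n \<in> D" and XS: "\<And>n. X (Suc n) \<in> S (X n)"
    and Xmin: "\<And>n z. z \<in> S (X n) \<Longrightarrow> J (X (Suc n)) \<le> J z + (1/2) ^ n" by blast
  have dec: "e * d (X n) (X (Suc n)) \<le> J (X n) - J (X (Suc n))" for n
    using XS[of n] by (simp add: S_def)
  \<comment> \<open>The descent pays for the path: \<open>e\<close> times its length telescopes to
    at most \<open>J (X 0)\<close>.\<close>
  have "summable (\<lambda>n. d (X n) (X (Suc n)))"
  proof (rule summableI_nonneg_bounded)
    fix n
    have "e * (\<Sum>i<n. d (X i) (X (Suc i))) \<le> (\<Sum>i<n. J (X i) - J (X (Suc i)))"
      unfolding sum_distrib_left by (intro sum_mono dec)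
    also have "\<dots> = J (X 0) - J (X n)" by (rule sum_lessThan_telescope')
    also have "\<dots> \<le> J (X 0)" using J0[OF XD[of n]] by simp
    finally show "(\<Sum>i<n. d (X i) (X (Suc i))) \<le> J (X 0) / e"
      using e by (simp add: field_simps)
  qed (rule d0)
  then obtain x where x: "x \<in> D" and lim: "(\<lambda>n. d (X n) x) \<longlonglongrightarrow> 0"
    using compl[of X] XD by blast
  have XX: "J (X (n + k)) + e * d (X n) (X (n + k)) \<le> J (X n)" for n k
  proof (induction k)
    case (Suc k)
    have "e * d (X n) (X (n + Suc k)) \<le> e * (d (X n) (X (n + k)) + d (X (n + k)) (X (n + Suc k)))"
      using e by (intro mult_left_mono tri XD) auto
    then show ?case using Suc dec[of "n + k"] by (simp add: algebra_simps)
  qed (simp add: refl)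
  \<comment> \<open>The limit inherits the descent inequality: replacing it by a late term of the
    sequence changes \<open>J\<close> by at most \<open>L\<close> times, and the penalty by at most
    \<open>e\<close> times, a distance that tends to 0.\<close>
  have xS: "J x + e * d (X n) x \<le> J (X n)" for n
  proof (rule LIMSEQ_le_const)
    have "(\<lambda>k. J (X n) + (L + e) * d (X (k + n)) x) \<longlonglongrightarrow> J (X n) + (L + e) * 0"
      by (intro tendsto_intros LIMSEQ_ignore_initial_segment lim)
    then show "(\<lambda>k. J (X n) + (L + e) * d (X (k + n)) x) \<longlonglongrightarrow> J (X n)" by simp
    have "J x + e * d (X n) x \<le> J (X n) + (L + e) * d (X (k + n)) x" for k
    proof -
      have "J x \<le> J (X (k + n)) + L * d (X (k + n)) x" by (intro lip XD x)
      moreover have "e * d (X n) x \<le> e * (d (X n) (X (k + n)) + d (X (k + n)) x)"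
        using e by (intro mult_left_mono tri XD x) auto
      ultimately show ?thesis using XX[of n k] by (simp add: algebra_simps)
    qed
    then show "\<exists>N. \<forall>k\<ge>N. J x + e * d (X n) x \<le> J (X n) + (L + e) * d (X (k + n)) x" by blast
  qed
  have "J x \<le> J y + e * d x y" if y: "y \<in> D" for y
  proof (rule ccontr)
    assume less: "\<not> ?thesis"
    \<comment> \<open>A point that violates the claim is admissible at every stage, so it competes
      with every near-minimizer, and in the limit \<open>J x \<le> J y\<close>.\<close>
    have "y \<in> S (X n)" for n
    proof -
      have "e * d (X n) y \<le> e * (d (X n) x + d x y)"
        using e by (intro mult_left_mono tri XD x y) auto
      then show ?thesis using xS[of n] less y by (simp add: S_def algebra_simps)
    qed
    then have le: "J (X (Suc n)) \<le> J y + (1/2) ^ n" for n using Xmin by blast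
    have "J x \<le> J y"
    proof (rule LIMSEQ_le_const)
      have "(\<lambda>n. J y + (1/2::real) ^ n) \<longlonglongrightarrow> J y + 0"
        by (intro tendsto_intros LIMSEQ_power_zero) auto
      then show "(\<lambda>n. J y + (1/2::real) ^ n) \<longlonglongrightarrow> J y" by simp
      have "J x \<le> J y + (1/2) ^ n" for n
        using xS[of "Suc n"] le[of n] mult_nonneg_nonneg[OF less_imp_le[OF e] d0[of "X (Suc n)" x]] by linarith
      then show "\<exists>N. \<forall>n\<ge>N. J x \<le> J y + (1/2) ^ n" by blast
    qed
    then show False using less mult_nonneg_nonneg[OF less_imp_le[OF e] d0[of x y]] by linarith
  qed
  with x that show ?thesis by blast
qed

text \<open>The Riesz-Fischer argument. Sign and vanishing of the limit are required at every point,
  not just almost everywhere, since the set of densities to which this is applied is defined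
  pointwise.\<close>

lemma L1_limit:
  fixes X :: "nat \<Rightarrow> 'b \<Rightarrow> real"
  assumes X: "\<And>n. integrable M (X n)" "\<And>n x. 0 \<le> X n x"
    and sum: "summable (\<lambda>n. \<integral>x. \<bar>X n x - X (Suc n) x\<bar> \<partial>M)"
  obtains h where "integrable M h" "\<And>x. 0 \<le> h x" "\<And>x. (\<And>n. X n x = 0) \<Longrightarrow> h x = 0"
    "(\<lambda>n. \<integral>x. X n x \<partial>M) \<longlonglongrightarrow> (\<integral>x. h x \<partial>M)"
    "(\<lambda>n. \<integral>x. \<bar>X n x - h x\<bar> \<partial>M) \<longlonglongrightarrow> 0"
proof -
  define f where "f n x = \<bar>X n x - X (Suc n) x\<bar>" for n x
  have [measurable]: "X n \<in> borel_measurable M" for n using X(1) by auto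
  have f: "integrable M (f n)" for n unfolding f_def using X(1) by auto
  have AEs: "AE x in M. summable (\<lambda>n. f n x)"
  proof -
    have "(\<integral>\<^sup>+x. (\<Sum>n. ennreal (f n x)) \<partial>M) = (\<Sum>n. \<integral>\<^sup>+x. ennreal (f n x) \<partial>M)"
      by (rule nn_integral_suminf) (simp add: f_def)
    also have "\<dots> = (\<Sum>n. ennreal (\<integral>x. f n x \<partial>M))"
      by (intro suminf_cong nn_integral_eq_integral f) (auto simp: f_def)
    also have "\<dots> \<noteq> \<infinity>"
      using sum by (subst suminf_ennreal2) (auto simp: f_def[abs_def])
    finally have "AE x in M. (\<Sum>n. ennreal (f n x)) \<noteq> \<infinity>"
      by (intro nn_integral_PInf_AE) (auto simp: f_def)
    then show ?thesis
      by eventually_elim (auto simp: f_def intro!: summable_suminf_not_top)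
  qed
  \<comment> \<open>\<open>lim\<close> is unspecified at points of divergence; the maximum with 0
    secures the sign there.\<close>
  define h where "h x = max 0 (lim (\<lambda>n. X n x))" for x
  define G where "G x = X 0 x + (\<Sum>n. f n x)" for x
  have [measurable]: "h \<in> borel_measurable M"
    unfolding h_def by (intro borel_measurable_max borel_measurable_lim_metric) auto
  have "integrable M (\<lambda>x. \<Sum>n. f n x)"
  proof (rule integrable_suminf[OF f])
    show "AE x in M. summable (\<lambda>n. norm (f n x))" using AEs by (simp add: f_def)
    show "summable (\<lambda>n. \<integral>x. norm (f n x) \<partial>M)" using sum by (simp add: f_def)
  qed
  then have G: "integrable M G" unfolding G_def using X(1) by simp
  have conv: "(\<lambda>n. X n x) \<longlonglongrightarrow> h x" "\<bar>X n x\<bar> \<le> G x" "\<bar>h x\<bar> \<le> G x" if s: "summable (\<lambda>n. f n x)" for x n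
  proof -
    have tel: "X n x = X 0 x - (\<Sum>i<n. X i x - X (Suc i) x)" for n
      using sum_lessThan_telescope'[of "\<lambda>i. X i x" n] by simp
    have "summable (\<lambda>n. X n x - X (Suc n) x)"
      using s unfolding f_def by (rule summable_rabs_cancel)
    then have "(\<lambda>n. X 0 x - (\<Sum>i<n. X i x - X (Suc i) x)) \<longlonglongrightarrow> X 0 x - (\<Sum>i. X i x - X (Suc i) x)"
      by (intro tendsto_intros summable_LIMSEQ)
    then have c: "convergent (\<lambda>n. X n x)"
      unfolding tel[symmetric] by (auto simp: convergent_def)
    then have l: "(\<lambda>n. X n x) \<longlonglongrightarrow> lim (\<lambda>n. X n x)" by (rule convergent_LIMSEQ_iff[THEN iffD1])
    moreover have "0 \<le> lim (\<lambda>n. X n x)"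
      using X(2) by (intro LIMSEQ_le_const[OF l]) auto
    ultimately show L: "(\<lambda>n. X n x) \<longlonglongrightarrow> h x" by (simp add: h_def)
    have b: "\<bar>X n x\<bar> \<le> G x" for n
    proof -
      have "\<bar>\<Sum>i<n. X i x - X (Suc i) x\<bar> \<le> (\<Sum>i<n. f i x)"
        unfolding f_def by (rule sum_abs)
      also have "\<dots> \<le> (\<Sum>i. f i x)"
        by (intro sum_le_suminf s) (auto simp: f_def)
      finally show ?thesis using X(2)[of 0 x] X(2)[of n x] tel[of n] by (simp add: G_def)
    qed
    then show "\<bar>X n x\<bar> \<le> G x" .
    show "\<bar>h x\<bar> \<le> G x"
      using tendsto_rabs[OF L] b by (intro LIMSEQ_le_const2) auto
  qed
  have AEc: "AE x in M. (\<lambda>n. X n x) \<longlonglongrightarrow> h x" using AEs by eventually_elim (rule conv)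
  have "AE x in M. \<bar>h x\<bar> \<le> G x" using AEs by eventually_elim (rule conv)
  then have ih: "integrable M h"
    using G by (intro Bochner_Integration.integrable_bound[OF G]) auto
  have "(\<lambda>n. \<integral>x. X n x \<partial>M) \<longlonglongrightarrow> (\<integral>x. h x \<partial>M)"
  proof (rule integral_dominated_convergence[where w = G])
    show "AE x in M. norm (X n x) \<le> G x" for n using AEs by eventually_elim (simp add: conv)
  qed (use G AEc in auto)
  moreover have "(\<lambda>n. \<integral>x. \<bar>X n x - h x\<bar> \<partial>M) \<longlonglongrightarrow> (\<integral>x. 0 \<partial>M)"
  proof (rule integral_dominated_convergence[where w = "\<lambda>x. 2 * G x"])
    show "AE x in M. norm \<bar>X n x - h x\<bar> \<le> 2 * G x" for n
      using AEs
    proof eventually_elim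
      case (elim x)
      then show ?case using conv(2)[OF elim, of n] conv(3)[OF elim] by simp
    qed
    show "AE x in M. (\<lambda>n. \<bar>X n x - h x\<bar>) \<longlonglongrightarrow> 0"
      using AEc by eventually_elim (simp add: tendsto_rabs_zero_iff LIM_zero)
  qed (use G in auto)
  moreover have "h x = 0" if "\<And>n. X n x = 0" for x using that by (simp add: h_def)
  ultimately show ?thesis using ih by (intro that[of h]) (auto simp: h_def)
qed

subsection \<open>Variation of integrable functions\<close>

lemma suminf_indicator_atLeastLessThan:
  "(\<Sum>j. indicator {a..<b} j :: ennreal) = of_nat (b - a)"
proof -
  have "(\<Sum>j. indicator {a..<b} j :: ennreal) = (\<Sum>j\<in>{a..<b}. indicator {a..<b} j)"
    by (rule suminf_finite) auto
  then show ?thesis by simp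
qed

context left_haar begin

text \<open>For a compact \<open>C\<close> inside \<open>A\<close>, the part of a translate of
  \<open>C\<close> outside \<open>C\<close> lies in the corresponding part for \<open>A\<close> or
  in \<open>A - C\<close>, and inner regularity makes \<open>A - C\<close> small.\<close>

lemma measure_le_boundary:
  assumes S: "finite S"
    and NC: "\<And>C. compact C \<Longrightarrow> measure m C \<le> (\<Sum>t\<in>S. measure m ((\<lambda>x. t + x) ` C - C))"
    and A: "A \<in> fmeasurable m"
  shows "measure m A \<le> (\<Sum>t\<in>S. measure m ((\<lambda>x. t + x) ` A - A))"
proof (rule field_le_epsilon)
  fix e :: real assume "0 < e"
  \<comment> \<open>One error for each element of \<open>S\<close> and one for
    \<open>A - C\<close>.\<close>
  define e' where "e' = e / (card S + 1)"
  have "0 < e'" using \<open>0 < e\<close> by (simp add: e'_def add_pos_nonneg)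
  then obtain C where C: "compact C" "C \<subseteq> A" "measure m (A - C) < e'"
    using inner_regular[OF A] by blast
  have Cm: "C \<in> fmeasurable m" by (rule compact_fmeasurable[OF C(1)])
  have meas: "A \<in> sets borel" "C \<in> sets borel" using A Cm by (auto dest: fmeasurableD)
  have T: "(\<lambda>x. t + x) ` B \<in> fmeasurable m" if "B \<in> fmeasurable m" for t B
    using that by (auto simp: fmeasurable_def emeasure_translate)
  have bd: "measure m ((\<lambda>x. t + x) ` C - C) \<le> measure m ((\<lambda>x. t + x) ` A - A) + e'" for t
  proof -
    have "measure m ((\<lambda>x. t + x) ` C - C) \<le> measure m (((\<lambda>x. t + x) ` A - A) \<union> (A - C))"
      using C(2) T[OF A, of t] A meas
      by (intro measure_mono_fmeasurable fmeasurable.Un fmeasurable_Diff) auto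
    also have "\<dots> \<le> measure m ((\<lambda>x. t + x) ` A - A) + measure m (A - C)"
      using meas by (intro measure_Un_le) auto
    finally show ?thesis using C(3) by simp
  qed
  have "measure m A = measure m C + measure m (A - C)"
    using measurable_measure_Diff[OF A _ C(2)] meas by simp
  also have "\<dots> \<le> (\<Sum>t\<in>S. measure m ((\<lambda>x. t + x) ` C - C)) + e'"
    using NC[OF C(1)] C(3) by simp
  also have "\<dots> \<le> (\<Sum>t\<in>S. measure m ((\<lambda>x. t + x) ` A - A) + e') + e'"
    using bd by (intro add_right_mono sum_mono)
  also have "\<dots> = (\<Sum>t\<in>S. measure m ((\<lambda>x. t + x) ` A - A)) + e' * (card S + 1)"
    by (simp add: sum.distrib algebra_simps)
  also have "e' * (card S + 1) = e" by (simp add: e'_def)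
  finally show "measure m A \<le> (\<Sum>t\<in>S. measure m ((\<lambda>x. t + x) ` A - A)) + e" .
qed

text \<open>Layer-cake decomposition into the superlevel sets.\<close>

lemma integral_nat_le_variation:
  fixes v :: "'a \<Rightarrow> nat"
  assumes S: "finite S"
    and NC: "\<And>C. compact C \<Longrightarrow> measure m C \<le> (\<Sum>t\<in>S. measure m ((\<lambda>x. t + x) ` C - C))"
    and [measurable]: "v \<in> measurable borel (count_space UNIV)"
    and int: "integrable m (\<lambda>x. real (v x))"
  shows "(\<integral>x. real (v x) \<partial>m) \<le> (\<Sum>t\<in>S. \<integral>x. \<bar>real (v (- t + x)) - real (v x)\<bar> \<partial>m)"
proof -
  define A where "A j = {x. j < v x}" for j
  have [measurable]: "A j \<in> sets borel" for j unfolding A_def by measurable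
  have v: "(of_nat (v x) :: ennreal) = (\<Sum>j. indicator (A j) x)" for x
  proof -
    have "(\<lambda>j. indicator (A j) x :: ennreal) = indicator {0..<v x}"
      by (auto simp: A_def indicator_def)
    then show ?thesis using suminf_indicator_atLeastLessThan[of 0 "v x"] by simp
  qed
  have fin: "(\<integral>\<^sup>+x. of_nat (v x) \<partial>m) < \<infinity>"
    using int by (simp add: integrable_iff_bounded ennreal_of_nat_eq_real_of_nat)
  have Af: "A j \<in> fmeasurable m" for j
  proof (rule fmeasurableI)
    have "emeasure m (A j) = (\<integral>\<^sup>+x. indicator (A j) x \<partial>m)" by simp
    also have "\<dots> \<le> (\<integral>\<^sup>+x. of_nat (v x) \<partial>m)"
    proof (rule nn_integral_mono)
      fix x
      have "(1::ennreal) \<le> of_nat (v x)" if "j < v x"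
        using that of_nat_mono[of 1 "v x", where 'a = ennreal] by simp
      then show "indicator (A j) x \<le> (of_nat (v x) :: ennreal)"
        by (simp add: A_def indicator_def)
    qed
    finally show "emeasure m (A j) < \<infinity>" using fin by (rule order.strict_trans1)
  qed simp
  let ?B = "\<lambda>t j. (\<lambda>x. t + x) ` A j - A j"
  have B: "emeasure m (?B t j) = ennreal (measure m (?B t j))" for t j
    using Af[of j] by (intro emeasure_eq_measure2 fmeasurable_Diff) (auto simp: fmeasurable_def emeasure_translate)
  have le: "emeasure m (A j) \<le> (\<Sum>t\<in>S. emeasure m (?B t j))" for j
    using measure_le_boundary[OF S NC Af]
    by (simp add: B emeasure_eq_measure2[OF Af] sum_ennreal ennreal_leI)
  \<comment> \<open>Subtraction on \<open>nat\<close> truncates, so the levels counted here are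
    those of the positive part of the difference.\<close>
  have sumB: "(\<Sum>j. indicator (?B t j) x) = (of_nat (v (- t + x) - v x) :: ennreal)" for t x
  proof -
    have "x \<in> ?B t j \<longleftrightarrow> j \<in> {v x..<v (- t + x)}" for j
      unfolding translate_image by (auto simp: A_def)
    then have "(\<lambda>j. indicator (?B t j) x :: ennreal) = indicator {v x..<v (- t + x)}"
      unfolding indicator_def by presburger
    then show ?thesis using suminf_indicator_atLeastLessThan by simp
  qed
  have i: "integrable m (\<lambda>x. \<bar>real (v (- t + x)) - real (v x)\<bar>)" for t
    using int integrable_translate[OF int, of "- t"] by auto
  have "ennreal (\<integral>x. real (v x) \<partial>m) = (\<integral>\<^sup>+x. of_nat (v x) \<partial>m)"
    using int by (simp add: nn_integral_eq_integral[symmetric] ennreal_of_nat_eq_real_of_nat)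
  also have "\<dots> = (\<Sum>j. emeasure m (A j))"
    unfolding v by (subst nn_integral_suminf) auto
  also have "\<dots> \<le> (\<Sum>j. \<Sum>t\<in>S. emeasure m (?B t j))"
    by (intro suminf_le le) auto
  also have "\<dots> = (\<Sum>t\<in>S. \<Sum>j. emeasure m (?B t j))"
    by (intro suminf_sum) auto
  also have "\<dots> = (\<Sum>t\<in>S. \<integral>\<^sup>+x. of_nat (v (- t + x) - v x) \<partial>m)"
  proof (rule sum.cong[OF refl])
    fix t
    have "(\<integral>\<^sup>+x. of_nat (v (- t + x) - v x) \<partial>m) = (\<integral>\<^sup>+x. (\<Sum>j. indicator (?B t j) x) \<partial>m)"
      unfolding sumB ..
    also have "\<dots> = (\<Sum>j. emeasure m (?B t j))"
      by (subst nn_integral_suminf) auto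
    finally show "(\<Sum>j. emeasure m (?B t j)) = (\<integral>\<^sup>+x. of_nat (v (- t + x) - v x) \<partial>m)" ..
  qed
  also have "\<dots> \<le> (\<Sum>t\<in>S. \<integral>\<^sup>+x. ennreal \<bar>real (v (- t + x)) - real (v x)\<bar> \<partial>m)"
    by (intro sum_mono nn_integral_mono) (auto simp: ennreal_of_nat_eq_real_of_nat intro!: ennreal_leI)
  also have "\<dots> = (\<Sum>t\<in>S. ennreal (\<integral>x. \<bar>real (v (- t + x)) - real (v x)\<bar> \<partial>m))"
    by (intro sum.cong refl nn_integral_eq_integral i) auto
  also have "\<dots> = ennreal (\<Sum>t\<in>S. \<integral>x. \<bar>real (v (- t + x)) - real (v x)\<bar> \<partial>m)"
    by (intro sum_ennreal) auto
  finally show ?thesis by (subst (asm) ennreal_le_iff) (auto intro!: sum_nonneg)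
qed

text \<open>Both sides are homogeneous, so rounding \<open>u\<close> down to multiples of
  \<open>1 / (n + 1)\<close> reduces the claim to integer values. With integer levels the layer-cake
  formula is a countable sum, which avoids a product with the possibly not sigma-finite
  \<open>m\<close>.\<close>

lemma integral_le_variation:
  fixes u :: "'a \<Rightarrow> real"
  assumes S: "finite S"
    and NC: "\<And>C. compact C \<Longrightarrow> measure m C \<le> (\<Sum>t\<in>S. measure m ((\<lambda>x. t + x) ` C - C))"
    and u: "integrable m u" "\<And>x. 0 \<le> u x"
  shows "(\<integral>x. u x \<partial>m) \<le> (\<Sum>t\<in>S. \<integral>x. \<bar>u (- t + x) - u x\<bar> \<partial>m)"
proof -
  have [measurable]: "u \<in> borel_measurable borel" using borel_measurable_integrable[OF u(1)] by simp
  define v where "v n x = nat \<lfloor>real (Suc n) * u x\<rfloor>" for n x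
  define w where "w n x = real (v n x) / real (Suc n)" for n x
  have [measurable]: "v n \<in> measurable borel (count_space UNIV)" for n
    unfolding v_def by measurable
  have [measurable]: "w n \<in> borel_measurable borel" for n unfolding w_def by measurable
  have rv: "real (v n x) = of_int \<lfloor>real (Suc n) * u x\<rfloor>" for n x
    using u(2)[of x] by (simp add: v_def)
  have w_le: "w n x \<le> u x" and w_ge: "u x - 1 / real (Suc n) \<le> w n x" and w0: "0 \<le> w n x" for n x
  proof -
    show "w n x \<le> u x"
      using of_int_floor_le[of "real (Suc n) * u x"] by (simp add: w_def rv field_simps del: of_nat_Suc)
    have "real (Suc n) * u x - 1 \<le> real (v n x)" unfolding rv by linarith
    then have "u x \<le> (real (v n x) + 1) / real (Suc n)"
      by (subst pos_le_divide_eq) (simp_all add: mult.commute del: of_nat_Suc)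
    then show "u x - 1 / real (Suc n) \<le> w n x"
      by (simp add: w_def add_divide_distrib del: of_nat_Suc)
  qed (simp add: w_def)
  have lim: "(\<lambda>n. w n x) \<longlonglongrightarrow> u x" for x
  proof (rule tendsto_sandwich)
    have "(\<lambda>n. u x - 1 / real (Suc n)) \<longlonglongrightarrow> u x - 0"
      by (intro tendsto_diff tendsto_const LIMSEQ_Suc[OF lim_const_over_n])
    then show "(\<lambda>n. u x - 1 / real (Suc n)) \<longlonglongrightarrow> u x" by simp
  qed (use w_le w_ge in auto)
  have iw: "integrable m (w n)" for n
    using u w_le w0 by (intro Bochner_Integration.integrable_bound[OF u(1)]) auto
  have "(\<integral>x. w n x \<partial>m) \<le> (\<Sum>t\<in>S. \<integral>x. \<bar>w n (- t + x) - w n x\<bar> \<partial>m)" for n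
  proof -
    have vw: "real (v n x) = real (Suc n) * w n x" for x by (simp add: w_def del: of_nat_Suc)
    have "integrable m (\<lambda>x. real (v n x))"
      unfolding vw using iw by simp
    then have "(\<integral>x. real (v n x) \<partial>m) \<le> (\<Sum>t\<in>S. \<integral>x. \<bar>real (v n (- t + x)) - real (v n x)\<bar> \<partial>m)"
      by (intro integral_nat_le_variation[OF S NC]) auto
    then have "real (Suc n) * (\<integral>x. w n x \<partial>m) \<le> real (Suc n) * (\<Sum>t\<in>S. \<integral>x. \<bar>w n (- t + x) - w n x\<bar> \<partial>m)"
      unfolding vw right_diff_distrib[symmetric] abs_mult by (simp add: sum_distrib_left del: of_nat_Suc)
    then show ?thesis by (simp del: of_nat_Suc)
  qed
  moreover have "(\<lambda>n. \<integral>x. w n x \<partial>m) \<longlonglongrightarrow> (\<integral>x. u x \<partial>m)"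
    using u w_le w0 lim by (intro integral_dominated_convergence[where w = u]) auto
  moreover have "(\<lambda>n. \<Sum>t\<in>S. \<integral>x. \<bar>w n (- t + x) - w n x\<bar> \<partial>m)
      \<longlonglongrightarrow> (\<Sum>t\<in>S. \<integral>x. \<bar>u (- t + x) - u x\<bar> \<partial>m)"
  proof (intro tendsto_sum integral_dominated_convergence[where w = "\<lambda>x. u (- _ + x) + u x"])
    fix t
    show "AE x in m. (\<lambda>n. \<bar>w n (- t + x) - w n x\<bar>) \<longlonglongrightarrow> \<bar>u (- t + x) - u x\<bar>"
      using lim by (intro AE_I2 tendsto_rabs tendsto_diff)
    show "integrable m (\<lambda>x. u (- t + x) + u x)"
      using u(1) integrable_translate[OF u(1)] by simp
    show "AE x in m. norm \<bar>w n (- t + x) - w n x\<bar> \<le> u (- t + x) + u x" for n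
    proof (rule AE_I2)
      fix x show "norm \<bar>w n (- t + x) - w n x\<bar> \<le> u (- t + x) + u x"
        using w0[of n x] w0[of n "- t + x"] w_le[of n x] w_le[of n "- t + x"] by simp
    qed
  qed simp_all
  ultimately show ?thesis by (intro LIMSEQ_le) auto
qed

section \<open>The smooth variation functional\<close>

definition ratio :: "('a \<Rightarrow> real) \<Rightarrow> 'a \<Rightarrow> 'a \<Rightarrow> real" where
  "ratio u t x = (u x - u (- t + x)) / (u x + u (- t + x))"

text \<open>For \<open>a, b \<ge> 0\<close> the expression
  \<open>2 * r * (a - b) - r\<^sup>2 * (a + b)\<close> is linear in \<open>(a, b)\<close> and
  concave in \<open>r\<close>, with maximum \<open>(a - b)\<^sup>2 / (a + b)\<close> at
  \<open>r = (a - b) / (a + b)\<close>, the value given by \<open>ratio\<close>. The functional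
  below is thus a supremum of linear ones.\<close>

definition tangent :: "('a \<Rightarrow> real) \<Rightarrow> ('a \<Rightarrow> real) \<Rightarrow> 'a \<Rightarrow> 'a \<Rightarrow> real" where
  "tangent \<rho> f t x = 2 * \<rho> x * (f x - f (- t + x)) - (\<rho> x)\<^sup>2 * (f x + f (- t + x))"

text \<open>This functional integrates \<open>(u - v)\<^sup>2 / (u + v)\<close>, with \<open>v\<close> the translate of \<open>u\<close> by \<open>t\<close>: a smooth,
  convex, 1-homogeneous substitute for \<open>\<bar>u - v\<bar>\<close> whose gradient is bounded; \<^term>\<open>tangent\<close> gives
  its supporting linear functionals.\<close>

definition sq_variation :: "'a set \<Rightarrow> ('a \<Rightarrow> real) \<Rightarrow> real" where
  "sq_variation S u = (\<Sum>t\<in>S. \<integral>x. tangent (ratio u t) u t x \<partial>m)"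

lemma abs_ratio_le:
  assumes "\<And>x. 0 \<le> u x" shows "\<bar>ratio u t x\<bar> \<le> 1"
  using assms[of x] assms[of "- t + x"] by (auto simp: ratio_def abs_divide divide_le_eq_1)

lemma ratio_measurable [measurable]:
  assumes [measurable]: "u \<in> borel_measurable borel" shows "ratio u t \<in> borel_measurable borel"
  unfolding ratio_def by measurable

text \<open>Completing the square: the sides differ by the squared distance of
  \<open>\<rho> x\<close> from the ratio, times the sum of the two values of \<open>u\<close>. If
  that sum is 0, both values vanish, and so do both sides.\<close>

lemma tangent_le_ratio:
  assumes "\<And>x. 0 \<le> u x"
  shows "tangent \<rho> u t x \<le> tangent (ratio u t) u t x"
proof -
  define a b where "a = u x" and "b = u (- t + x)"
  have ab: "0 \<le> a" "0 \<le> b" using assms by (auto simp: a_def b_def)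
  show ?thesis
  proof (cases "a + b = 0")
    case True
    then have "a = 0" "b = 0" using ab by auto
    then show ?thesis by (simp add: tangent_def a_def b_def)
  next
    case False
    define r where "r = (a - b) / (a + b)"
    have *: "r * (a + b) = a - b" using False by (simp add: r_def)
    have "0 \<le> (a + b) * (r - \<rho> x)\<^sup>2" using ab by simp
    also have "\<dots> = r * (r * (a + b)) - 2 * \<rho> x * (r * (a + b)) + (\<rho> x)\<^sup>2 * (a + b)"
      by (simp add: power2_eq_square algebra_simps)
    also have "\<dots> = (2 * r * (a - b) - r * (r * (a + b))) - (2 * \<rho> x * (a - b) - (\<rho> x)\<^sup>2 * (a + b))"
      unfolding * by (simp add: algebra_simps)
    finally show ?thesis
      by (simp add: tangent_def ratio_def a_def[symmetric] b_def[symmetric] r_def[symmetric]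
          power2_eq_square mult.assoc)
  qed
qed

lemma abs_tangent_le:
  assumes "\<bar>\<rho> x\<bar> \<le> 1"
  shows "\<bar>tangent \<rho> f t x\<bar> \<le> 3 * (\<bar>f x\<bar> + \<bar>f (- t + x)\<bar>)"
proof -
  have "\<bar>2 * \<rho> x * (f x - f (- t + x))\<bar> \<le> 2 * (\<bar>f x\<bar> + \<bar>f (- t + x)\<bar>)"
    using mult_mono[OF assms abs_triangle_ineq4[of "f x" "f (- t + x)"]] by (simp add: abs_mult mult.assoc)
  moreover have "\<bar>(\<rho> x)\<^sup>2 * (f x + f (- t + x))\<bar> \<le> \<bar>f x\<bar> + \<bar>f (- t + x)\<bar>"
  proof -
    have "(\<rho> x)\<^sup>2 \<le> 1" using assms by (simp add: abs_square_le_1)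
    then have "(\<rho> x)\<^sup>2 * \<bar>f x + f (- t + x)\<bar> \<le> 1 * (\<bar>f x\<bar> + \<bar>f (- t + x)\<bar>)"
      by (intro mult_mono abs_triangle_ineq) auto
    then show ?thesis by (simp add: abs_mult)
  qed
  ultimately have "\<bar>2 * \<rho> x * (f x - f (- t + x))\<bar> + \<bar>(\<rho> x)\<^sup>2 * (f x + f (- t + x))\<bar> \<le> 3 * (\<bar>f x\<bar> + \<bar>f (- t + x)\<bar>)"
    by simp
  then show ?thesis unfolding tangent_def by (rule order_trans[OF abs_triangle_ineq4])
qed

text \<open>The pointwise factor 3 consists of 2 from the linear and 1 from the quadratic term in
  \<open>\<rho>\<close>. It doubles because \<open>f\<close> and its translate have the same L1
  norm.\<close>

lemma
  assumes f: "integrable m f" and [measurable]: "\<rho> \<in> borel_measurable borel"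
    and \<rho>: "\<And>x. \<bar>\<rho> x\<bar> \<le> 1"
  shows integrable_tangent: "integrable m (tangent \<rho> f t)"
    and integral_tangent_le: "(\<integral>x. tangent \<rho> f t x \<partial>m) \<le> 6 * (\<integral>x. \<bar>f x\<bar> \<partial>m)"
proof -
  have [measurable]: "f \<in> borel_measurable borel" using borel_measurable_integrable[OF f] by simp
  have ft: "integrable m (\<lambda>x. f (- t + x))" by (rule integrable_translate[OF f])
  have bd: "integrable m (\<lambda>x. 3 * (\<bar>f x\<bar> + \<bar>f (- t + x)\<bar>))" using f ft by auto
  show i: "integrable m (tangent \<rho> f t)"
  proof (rule Bochner_Integration.integrable_bound[OF bd])
    show "tangent \<rho> f t \<in> borel_measurable m" unfolding tangent_def by measurable
    show "AE x in m. norm (tangent \<rho> f t x) \<le> norm (3 * (\<bar>f x\<bar> + \<bar>f (- t + x)\<bar>))"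
      using abs_tangent_le[of \<rho>, OF \<rho>] by (intro AE_I2) simp
  qed
  have "(\<integral>x. tangent \<rho> f t x \<partial>m) \<le> (\<integral>x. 3 * (\<bar>f x\<bar> + \<bar>f (- t + x)\<bar>) \<partial>m)"
    using abs_tangent_le[of \<rho>, OF \<rho>] abs_le_D1 by (intro integral_mono i bd) blast
  also have "\<dots> = 3 * ((\<integral>x. \<bar>f x\<bar> \<partial>m) + (\<integral>x. \<bar>f (- t + x)\<bar> \<partial>m))"
    using f ft by simp
  also have "(\<integral>x. \<bar>f (- t + x)\<bar> \<partial>m) = (\<integral>x. \<bar>f x\<bar> \<partial>m)"
    by (rule integral_translate) simp
  finally show "(\<integral>x. tangent \<rho> f t x \<partial>m) \<le> 6 * (\<integral>x. \<bar>f x\<bar> \<partial>m)" by simp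
qed

lemma integrable_tangent_ratio:
  assumes "integrable m u" "\<And>x. 0 \<le> u x" "integrable m f"
  shows "integrable m (tangent (ratio u t) f t)"
  using assms by (intro integrable_tangent abs_ratio_le ratio_measurable) (auto dest: borel_measurable_integrable)

lemma tangent_diff: "tangent \<rho> (\<lambda>x. f x - g x) t x = tangent \<rho> f t x - tangent \<rho> g t x"
  by (simp add: tangent_def algebra_simps)

text \<open>Convexity: the supporting functional at \<open>v\<close> touches the variation at
  \<open>v\<close> and stays below it at \<open>u\<close>.\<close>

lemma sq_variation_diff_le:
  assumes u: "integrable m u" "\<And>x. 0 \<le> u x" and v: "integrable m v" "\<And>x. 0 \<le> v x"
  shows "sq_variation S v - sq_variation S u \<le> (\<Sum>t\<in>S. \<integral>x. tangent (ratio v t) (\<lambda>x. v x - u x) t x \<partial>m)"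
proof -
  have "sq_variation S v - sq_variation S u = (\<Sum>t\<in>S. (\<integral>x. tangent (ratio v t) v t x \<partial>m) - (\<integral>x. tangent (ratio u t) u t x \<partial>m))"
    by (simp add: sq_variation_def sum_subtractf)
  also have "\<dots> \<le> (\<Sum>t\<in>S. (\<integral>x. tangent (ratio v t) v t x \<partial>m) - (\<integral>x. tangent (ratio v t) u t x \<partial>m))"
    using u v by (intro sum_mono diff_left_mono integral_mono integrable_tangent_ratio tangent_le_ratio)
  also have "\<dots> = (\<Sum>t\<in>S. \<integral>x. tangent (ratio v t) (\<lambda>x. v x - u x) t x \<partial>m)"
    unfolding tangent_diff using integrable_tangent_ratio[OF v] u v by simp
  finally show ?thesis .
qed

lemma sq_variation_lipschitz:
  assumes u: "integrable m u" "\<And>x. 0 \<le> u x" and v: "integrable m v" "\<And>x. 0 \<le> v x"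
  shows "sq_variation S v \<le> sq_variation S u + (6 * card S) * (\<integral>x. \<bar>v x - u x\<bar> \<partial>m)"
proof -
  have "sq_variation S v - sq_variation S u \<le> (\<Sum>t\<in>S. \<integral>x. tangent (ratio v t) (\<lambda>x. v x - u x) t x \<partial>m)"
    by (rule sq_variation_diff_le[OF u v])
  also have "\<dots> \<le> (\<Sum>t\<in>S. 6 * (\<integral>x. \<bar>v x - u x\<bar> \<partial>m))"
    using u v by (intro sum_mono integral_tangent_le abs_ratio_le ratio_measurable)
      (auto dest: borel_measurable_integrable)
  finally show ?thesis by simp
qed

lemma sq_variation_nonneg:
  assumes "\<And>x. 0 \<le> u x" shows "0 \<le> sq_variation S u"
  unfolding sq_variation_def
proof (intro sum_nonneg Bochner_Integration.integral_nonneg)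
  show "0 \<le> tangent (ratio u t) u t x" for t x
    using tangent_le_ratio[of u "\<lambda>_. 0" t x] assms by (simp add: tangent_def)
qed

text \<open>Taking \<open>\<rho>\<close> to be \<open>\<theta>\<close> times the sign of the
  difference bounds each smooth term from below by \<open>2 * \<theta>\<close> times the L1
  variation minus \<open>2 * \<theta>\<^sup>2\<close> times the integral.\<close>

lemma sq_variation_ge:
  assumes S: "finite S" "S \<noteq> {}"
    and NC: "\<And>C. compact C \<Longrightarrow> measure m C \<le> (\<Sum>t\<in>S. measure m ((\<lambda>x. t + x) ` C - C))"
    and u: "integrable m u" "\<And>x. 0 \<le> u x"
  shows "(\<integral>x. u x \<partial>m) / (2 * card S) \<le> sq_variation S u"
proof -
  \<comment> \<open>Maximises \<open>2 * \<theta> - 2 * card S * \<theta>\<^sup>2\<close>, the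
    factor that is left after summation over \<open>S\<close>.\<close>
  define \<theta> where "\<theta> = 1 / (2 * real (card S))"
  have k: "1 \<le> card S" using S by (simp add: Suc_leI card_gt_0_iff)
  have \<theta>: "0 < \<theta>" "\<theta> \<le> 1" using k by (auto simp: \<theta>_def)
  have [measurable]: "u \<in> borel_measurable borel" using borel_measurable_integrable[OF u(1)] by simp
  define \<rho> where "\<rho> t x = \<theta> * sgn (u x - u (- t + x))" for t x
  have [measurable]: "\<rho> t \<in> borel_measurable borel" for t unfolding \<rho>_def by measurable
  have \<rho>1: "\<bar>\<rho> t x\<bar> \<le> 1" for t x using \<theta> by (auto simp: \<rho>_def abs_mult sgn_if)
  have ut: "integrable m (\<lambda>x. u (- t + x))" for t by (rule integrable_translate[OF u(1)])
  have "2 * \<theta> * (\<integral>x. \<bar>u (- t + x) - u x\<bar> \<partial>m) - 2 * \<theta>\<^sup>2 * (\<integral>x. u x \<partial>m)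
      \<le> (\<integral>x. tangent (ratio u t) u t x \<partial>m)" for t
  proof -
    have "(\<integral>x. u (- t + x) \<partial>m) = (\<integral>x. u x \<partial>m)" by (rule integral_translate) simp
    then have "2 * \<theta> * (\<integral>x. \<bar>u (- t + x) - u x\<bar> \<partial>m) - 2 * \<theta>\<^sup>2 * (\<integral>x. u x \<partial>m)
        = (\<integral>x. 2 * \<theta> * \<bar>u (- t + x) - u x\<bar> - \<theta>\<^sup>2 * (u x + u (- t + x)) \<partial>m)"
      using u ut by simp
    also have "\<dots> \<le> (\<integral>x. tangent (ratio u t) u t x \<partial>m)"
    proof (rule integral_mono)
      fix x
      have "2 * \<theta> * \<bar>u (- t + x) - u x\<bar> - \<theta>\<^sup>2 * (u x + u (- t + x)) \<le> tangent (\<rho> t) u t x"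
        using u(2)[of x] u(2)[of "- t + x"]
        by (auto simp: tangent_def \<rho>_def sgn_if algebra_simps)
      also have "\<dots> \<le> tangent (ratio u t) u t x" by (rule tangent_le_ratio[OF u(2)])
      finally show "2 * \<theta> * \<bar>u (- t + x) - u x\<bar> - \<theta>\<^sup>2 * (u x + u (- t + x)) \<le> tangent (ratio u t) u t x" .
    qed (use u ut integrable_tangent_ratio[OF u u(1)] in auto)
    finally show ?thesis .
  qed
  then have "(\<Sum>t\<in>S. 2 * \<theta> * (\<integral>x. \<bar>u (- t + x) - u x\<bar> \<partial>m) - 2 * \<theta>\<^sup>2 * (\<integral>x. u x \<partial>m)) \<le> sq_variation S u"
    unfolding sq_variation_def by (intro sum_mono)
  then have "2 * \<theta> * (\<Sum>t\<in>S. \<integral>x. \<bar>u (- t + x) - u x\<bar> \<partial>m) - card S * (2 * \<theta>\<^sup>2 * (\<integral>x. u x \<partial>m)) \<le> sq_variation S u"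
    by (simp add: sum_subtractf sum_distrib_left)
  moreover have "2 * \<theta> * (\<integral>x. u x \<partial>m) \<le> 2 * \<theta> * (\<Sum>t\<in>S. \<integral>x. \<bar>u (- t + x) - u x\<bar> \<partial>m)"
    using \<theta> by (intro mult_left_mono integral_le_variation[OF S(1) NC u]) auto
  moreover have "card S * (2 * \<theta>\<^sup>2 * (\<integral>x. u x \<partial>m)) = \<theta> * (\<integral>x. u x \<partial>m)"
    using k by (simp add: \<theta>_def power2_eq_square)
  moreover have "(\<integral>x. u x \<partial>m) / (2 * card S) = \<theta> * (\<integral>x. u x \<partial>m)" by (simp add: \<theta>_def)
  ultimately show ?thesis by linarith
qed

subsection \<open>First-order condition on densities\<close>

text \<open>On the segment from \<open>h\<close> to \<open>g\<close> the increment is bounded by the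
  supporting functional at the moved point; after division by the step this converges to the one at
  \<open>h + w\<close>. The function \<open>w\<close> keeps the denominators of \<open>ratio\<close>
  positive wherever the direction \<open>g - h\<close> contributes.\<close>

lemma first_order_condition:
  assumes h: "integrable m h" "\<And>x. 0 \<le> h x" and g: "integrable m g" "\<And>x. 0 \<le> g x"
    and w: "integrable m w" "\<And>x. 0 \<le> w x"
    and supp: "\<And>t x. t \<in> S \<Longrightarrow> w x + w (- t + x) = 0 \<Longrightarrow> g x = h x \<and> g (- t + x) = h (- t + x)"
    and min: "\<And>s. 0 < s \<Longrightarrow> s \<le> 1 \<Longrightarrow>
      sq_variation S (\<lambda>x. h x + w x) \<le> sq_variation S (\<lambda>x. (1 - s) * h x + s * g x + w x) + e * s"
  shows "- e \<le> (\<Sum>t\<in>S. \<integral>x. tangent (ratio (\<lambda>x. h x + w x) t) (\<lambda>x. g x - h x) t x \<partial>m)"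
proof -
  have [measurable]: "h \<in> borel_measurable borel" "g \<in> borel_measurable borel" "w \<in> borel_measurable borel"
    using h(1) g(1) w(1) by (auto dest!: borel_measurable_integrable)
  define u where "u s x = (1 - s) * h x + s * g x + w x" for s x
  define f where "f x = g x - h x" for x
  have f: "integrable m f" unfolding f_def using g h by simp
  have u: "integrable m (u s)" "0 \<le> u s x" if "0 \<le> s" "s \<le> 1" for s x
    unfolding u_def using h g w that by (auto intro!: add_nonneg_nonneg mult_nonneg_nonneg)
  define s where "s n = inverse (real (Suc n))" for n
  have s: "0 < s n" "s n \<le> 1" for n
    using inverse_le_1_iff[of "real (Suc n)"] by (auto simp: s_def simp del: of_nat_Suc)
  have [measurable]: "ratio (u r) t \<in> borel_measurable borel" for r t unfolding u_def by measurable
  have le: "- e \<le> (\<Sum>t\<in>S. \<integral>x. tangent (ratio (u (s n)) t) f t x \<partial>m)" for n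
  proof -
    have "sq_variation S (u 0) \<le> sq_variation S (u (s n)) + e * s n"
      using min[OF s[of n]] by (simp add: u_def[abs_def])
    moreover have "sq_variation S (u (s n)) - sq_variation S (u 0) \<le>
        (\<Sum>t\<in>S. \<integral>x. tangent (ratio (u (s n)) t) (\<lambda>x. u (s n) x - u 0 x) t x \<partial>m)"
      using s[of n] by (intro sq_variation_diff_le u) auto
    moreover have "tangent \<rho> (\<lambda>x. u (s n) x - u 0 x) t x = s n * tangent \<rho> f t x" for \<rho> t x
      by (simp add: tangent_def u_def f_def algebra_simps)
    ultimately have "s n * (- e) \<le> s n * (\<Sum>t\<in>S. \<integral>x. tangent (ratio (u (s n)) t) f t x \<partial>m)"
      by (simp add: sum_distrib_left mult.commute)
    then show ?thesis using s(1)[of n] by (simp only: mult_le_cancel_left_pos)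
  qed
  have "(\<lambda>n. \<Sum>t\<in>S. \<integral>x. tangent (ratio (u (s n)) t) f t x \<partial>m)
      \<longlonglongrightarrow> (\<Sum>t\<in>S. \<integral>x. tangent (ratio (u 0) t) f t x \<partial>m)"
  proof (rule tendsto_sum)
    fix t assume t: "t \<in> S"
    show "(\<lambda>n. \<integral>x. tangent (ratio (u (s n)) t) f t x \<partial>m) \<longlonglongrightarrow> (\<integral>x. tangent (ratio (u 0) t) f t x \<partial>m)"
    proof (rule integral_dominated_convergence[where w = "\<lambda>x. 3 * (\<bar>f x\<bar> + \<bar>f (- t + x)\<bar>)"])
      show "integrable m (\<lambda>x. 3 * (\<bar>f x\<bar> + \<bar>f (- t + x)\<bar>))"
        using f integrable_translate[OF f] by auto
      have meas: "tangent (ratio (u r) t) f t \<in> borel_measurable m" for r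
        unfolding tangent_def f_def by measurable
      show "tangent (ratio (u 0) t) f t \<in> borel_measurable m" by (rule meas)
      show "tangent (ratio (u (s n)) t) f t \<in> borel_measurable m" for n by (rule meas)
      show "AE x in m. norm (tangent (ratio (u (s n)) t) f t x) \<le> 3 * (\<bar>f x\<bar> + \<bar>f (- t + x)\<bar>)" for n
      proof (rule AE_I2)
        fix x
        have "\<bar>ratio (u (s n)) t x\<bar> \<le> 1" using s[of n] by (intro abs_ratio_le u) auto
        then show "norm (tangent (ratio (u (s n)) t) f t x) \<le> 3 * (\<bar>f x\<bar> + \<bar>f (- t + x)\<bar>)"
          using abs_tangent_le[of "ratio (u (s n)) t" x f t] by simp
      qed
      show "AE x in m. (\<lambda>n. tangent (ratio (u (s n)) t) f t x) \<longlonglongrightarrow> tangent (ratio (u 0) t) f t x"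
      proof (rule AE_I2)
        fix x
        show "(\<lambda>n. tangent (ratio (u (s n)) t) f t x) \<longlonglongrightarrow> tangent (ratio (u 0) t) f t x"
        proof (cases "w x + w (- t + x) = 0")
          case True
          then have "f x = 0" "f (- t + x) = 0" using supp[OF t] by (auto simp: f_def)
          then show ?thesis by (simp add: tangent_def)
        next
          case False
          then have "u 0 x + u 0 (- t + x) \<noteq> 0"
            using h(2)[of x] h(2)[of "- t + x"] w(2)[of x] w(2)[of "- t + x"] by (simp add: u_def)
          moreover have "(\<lambda>n. u (s n) y) \<longlonglongrightarrow> u 0 y" for y
            unfolding u_def s_def by (intro tendsto_intros LIMSEQ_inverse_real_of_nat)
          ultimately show ?thesis
            unfolding tangent_def ratio_def by (intro tendsto_intros)
        qed
      qed
    qed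
  qed
  then have "- e \<le> (\<Sum>t\<in>S. \<integral>x. tangent (ratio (u 0) t) f t x \<partial>m)"
    using le by (intro LIMSEQ_le_const) auto
  then show ?thesis by (simp add: u_def[abs_def] f_def[abs_def])
qed

text \<open>The part of \<open>w\<close> on the set \<open>f x < c\<close> is integrable and
  vanishes off \<open>X\<close>. Unless it is null it can be normalised to a test density, for which
  the hypothesis fails. The positive \<open>w\<close> thus does the work of duality on
  \<open>X\<close>.\<close>

lemma AE_ge_if_integral_ge:
  fixes f w :: "'a \<Rightarrow> real" and c b :: real
  assumes [measurable]: "f \<in> borel_measurable borel" and fb: "\<And>x. \<bar>f x\<bar> \<le> b"
    and w: "integrable m w" "\<And>x. 0 \<le> w x" "\<And>x. x \<in> X \<longleftrightarrow> 0 < w x"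
    and ge: "\<And>g. integrable m g \<Longrightarrow> (\<And>x. 0 \<le> g x) \<Longrightarrow> (\<And>x. x \<notin> X \<Longrightarrow> g x = 0) \<Longrightarrow>
      (\<integral>x. g x \<partial>m) = 1 \<Longrightarrow> c \<le> (\<integral>x. f x * g x \<partial>m)"
  shows "AE x in m. x \<in> X \<longrightarrow> c \<le> f x"
proof -
  have [measurable]: "w \<in> borel_measurable borel" using w(1) by (auto dest!: borel_measurable_integrable)
  define v where "v x = (if f x < c then w x else 0)" for x
  have [measurable]: "v \<in> borel_measurable borel" unfolding v_def by measurable
  have v0: "0 \<le> v x" for x using w(2) by (simp add: v_def)
  have v: "integrable m v"
    using w(2) by (intro Bochner_Integration.integrable_bound[OF w(1)]) (auto simp: v_def)
  have "AE x in m. v x = 0"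
  proof (cases "(\<integral>x. v x \<partial>m) = 0")
    case True
    then show ?thesis using v v0 by (simp add: integral_nonneg_eq_0_iff_AE)
  next
    case False
    define q where "q = (\<integral>x. v x \<partial>m)"
    have q: "0 < q" using False v0 by (simp add: q_def less_le Bochner_Integration.integral_nonneg)
    have fv: "integrable m (\<lambda>x. v x * f x)"
    proof (rule Bochner_Integration.integrable_bound)
      show "integrable m (\<lambda>x. b * v x)" using v by simp
      show "AE x in m. norm (v x * f x) \<le> norm (b * v x)"
      proof (rule AE_I2)
        fix x
        have "\<bar>f x\<bar> \<le> \<bar>b\<bar>" using fb[of x] by linarith
        then show "norm (v x * f x) \<le> norm (b * v x)"
          by (simp add: abs_mult mult.commute mult_right_mono)
      qed
    qed simp
    have "c \<le> (\<integral>x. f x * (v x / q) \<partial>m)"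
    proof (rule ge)
      show "v x / q = 0" if "x \<notin> X" for x
        using that w(2)[of x] w(3)[of x] by (auto simp: v_def)
    qed (use v v0 q in \<open>auto simp: q_def\<close>)
    also have "\<dots> = (\<integral>x. v x * f x \<partial>m) / q" by (simp add: mult.commute)
    finally have "c * (\<integral>x. v x \<partial>m) \<le> (\<integral>x. v x * f x \<partial>m)"
      using q by (simp add: field_simps q_def)
    then have "(\<integral>x. v x * (c - f x) \<partial>m) \<le> 0"
      using v fv by (simp add: right_diff_distrib mult.commute)
    moreover have nn: "0 \<le> v x * (c - f x)" for x using w(2)[of x] by (simp add: v_def)
    ultimately have "(\<integral>x. v x * (c - f x) \<partial>m) = 0"
      by (intro antisym Bochner_Integration.integral_nonneg) auto
    moreover have "integrable m (\<lambda>x. v x * (c - f x))" using v fv by (simp add: right_diff_distrib)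
    ultimately have "AE x in m. v x * (c - f x) = 0"
      using nn by (simp add: integral_nonneg_eq_0_iff_AE)
    then show ?thesis by eventually_elim (auto simp: v_def split: if_splits)
  qed
  then show ?thesis
    by eventually_elim (use w(3) in \<open>auto simp: v_def not_less split: if_splits\<close>)
qed

text \<open>The constants share one budget. With \<open>k = card S\<close>, the variation is at
  least \<open>1 / (2 * k)\<close>. The Ekeland slope and the added function \<open>w\<close> cost
  at most \<open>1 / (8 * k)\<close> each. This leaves \<open>1 / (4 * k)\<close> for
  \<open>f\<close>, which is twice the sum in the claim.\<close>

lemma ex_bounded_gradient:
  fixes w0 :: "'a \<Rightarrow> real"
  assumes S: "finite S" "S \<noteq> {}"
    and NC: "\<And>C. compact C \<Longrightarrow> measure m C \<le> (\<Sum>t\<in>S. measure m ((\<lambda>x. t + x) ` C - C))"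
    and X: "\<And>t x. t \<in> S \<Longrightarrow> - t + x \<in> X \<longleftrightarrow> x \<in> X"
    and w0: "integrable m w0" "\<And>x. 0 \<le> w0 x" "\<And>x. x \<in> X \<longleftrightarrow> 0 < w0 x" "0 < (\<integral>x. w0 x \<partial>m)"
  obtains \<rho> where "\<And>t. \<rho> t \<in> borel_measurable borel" "\<And>t x. \<bar>\<rho> t x\<bar> \<le> (1::real)"
    "AE x in m. x \<in> X \<longrightarrow> 1 / (8 * real (card S)) \<le> (\<Sum>t\<in>S. \<rho> t x - \<rho> t (t + x))"
proof -
  define k where "k = real (card S)"
  have k: "1 \<le> k" using S by (simp add: k_def Suc_leI card_gt_0_iff)
  \<comment> \<open>The total mass of \<open>w\<close>; each of the \<open>k\<close> terms of the
    first-order condition loses at most \<open>6 * \<omega>\<close> to it.\<close>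
  define \<omega> where "\<omega> = 1 / (48 * k\<^sup>2)"
  have \<omega>: "0 < \<omega>" using k by (simp add: \<omega>_def)
  define w where "w x = \<omega> / (\<integral>x. w0 x \<partial>m) * w0 x" for x
  have w: "integrable m w" "\<And>x. 0 \<le> w x" "\<And>x. x \<in> X \<longleftrightarrow> 0 < w x" "(\<integral>x. w x \<partial>m) = \<omega>"
  proof -
    define c where "c = \<omega> / (\<integral>x. w0 x \<partial>m)"
    have c: "0 < c" using w0(4) \<omega> by (simp add: c_def)
    have eq: "w = (\<lambda>x. c * w0 x)" by (simp add: fun_eq_iff w_def c_def)
    show "integrable m w" "\<And>x. 0 \<le> w x" "\<And>x. x \<in> X \<longleftrightarrow> 0 < w x"
      unfolding eq using w0(1-3) c by (auto simp: zero_less_mult_iff)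
    show "(\<integral>x. w x \<partial>m) = \<omega>" unfolding eq using w0(4) by (simp add: c_def)
  qed
  define D where "D = {h :: 'a \<Rightarrow> real. integrable m h \<and> (\<forall>x. 0 \<le> h x) \<and> (\<forall>x. x \<notin> X \<longrightarrow> h x = 0) \<and> (\<integral>x. h x \<partial>m) = 1}"
  have D: "integrable m h" "\<And>x. 0 \<le> h x" "\<And>x. x \<notin> X \<Longrightarrow> h x = 0" "(\<integral>x. h x \<partial>m) = 1" if "h \<in> D" for h
    using that by (auto simp: D_def)
  have uD: "integrable m (\<lambda>x. h x + w x)" "0 \<le> h x + w x" if "h \<in> D" for h x
    using D[OF that] w by (auto intro: add_nonneg_nonneg)
  define d where "d h g = (\<integral>x. \<bar>h x - g x\<bar> \<partial>m)" for h g :: "'a \<Rightarrow> real"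
  define J' where "J' h = sq_variation S (\<lambda>x. h x + w x)" for h
  have D0: "(\<lambda>x. w0 x / (\<integral>x. w0 x \<partial>m)) \<in> D"
  proof -
    have "w0 x = 0" if "x \<notin> X" for x using that w0(2)[of x] w0(3)[of x] by auto
    then show ?thesis using w0 by (auto simp: D_def)
  qed
  \<comment> \<open>Two densities are at most 2 apart in L1, so this slope costs at most
    \<open>1 / (8 * k)\<close>.\<close>
  have k16: "0 < 1 / (16 * k)" using k by simp
  obtain h where h: "h \<in> D" and hmin: "\<And>g. g \<in> D \<Longrightarrow> J' h \<le> J' g + 1 / (16 * k) * d h g"
  proof (rule ekeland[of _ D d J' "6 * k" "1 / (16 * k)", OF D0 _ _ _ _ _ _ k16])
    show "0 \<le> d f g" for f g by (simp add: d_def)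
    show "d f f = 0" for f by (simp add: d_def)
    show "d f g' \<le> d f g + d g g'" if "f \<in> D" "g \<in> D" "g' \<in> D" for f g g'
    proof -
      note i = D(1)[OF that(1)] D(1)[OF that(2)] D(1)[OF that(3)]
      have "d f g' \<le> (\<integral>x. \<bar>f x - g x\<bar> + \<bar>g x - g' x\<bar> \<partial>m)"
        unfolding d_def using i by (intro integral_mono) auto
      then show ?thesis using i by (simp add: d_def)
    qed
    show "0 \<le> J' f" if "f \<in> D" for f
      unfolding J'_def using uD[OF that] by (intro sq_variation_nonneg)
    show "J' g \<le> J' f + 6 * k * d f g" if "f \<in> D" "g \<in> D" for f g
      using sq_variation_lipschitz[OF uD[OF that(1)] uD[OF that(2)], of S]
      by (simp add: J'_def k_def d_def abs_minus_commute)
    show "\<exists>h\<in>D. (\<lambda>n. d (Y n) h) \<longlonglongrightarrow> 0"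
      if Y: "\<And>n. Y n \<in> D" and sum: "summable (\<lambda>n. d (Y n) (Y (Suc n)))" for Y
    proof -
      obtain h where h: "integrable m h" "\<And>x. 0 \<le> h x" "\<And>x. (\<And>n. Y n x = 0) \<Longrightarrow> h x = 0"
        "(\<lambda>n. \<integral>x. Y n x \<partial>m) \<longlonglongrightarrow> (\<integral>x. h x \<partial>m)"
        "(\<lambda>n. \<integral>x. \<bar>Y n x - h x\<bar> \<partial>m) \<longlonglongrightarrow> 0"
        using L1_limit[of m Y, OF D(1)[OF Y] D(2)[OF Y] sum[unfolded d_def]] by blast
      have "(\<integral>x. h x \<partial>m) = 1"
        using h(4) D(4)[OF Y] by (simp add: LIMSEQ_const_iff)
      moreover have "h x = 0" if "x \<notin> X" for x using h(3) D(3)[OF Y] that by blast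
      ultimately have "h \<in> D" using h by (simp add: D_def)
      then show ?thesis using h(5) unfolding d_def by blast
    qed
  qed blast
  define u where "u x = h x + w x" for x
  define \<rho> where "\<rho> t = ratio u t" for t
  have u: "integrable m u" "\<And>x. 0 \<le> u x" unfolding u_def using uD[OF h] by auto
  have [measurable]: "u \<in> borel_measurable borel" using u(1) by (auto dest!: borel_measurable_integrable)
  have [measurable]: "\<rho> t \<in> borel_measurable borel" for t unfolding \<rho>_def by measurable
  have \<rho>1: "\<bar>\<rho> t x\<bar> \<le> 1" for t x unfolding \<rho>_def by (rule abs_ratio_le[OF u(2)])
  define f where "f x = (\<Sum>t\<in>S. 2 * (\<rho> t x - \<rho> t (t + x)))" for x
  have "AE x in m. x \<in> X \<longrightarrow> 1 / (4 * k) \<le> f x"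
  proof (rule AE_ge_if_integral_ge[OF _ _ w(1-3)])
    show "f \<in> borel_measurable borel" unfolding f_def by measurable
    show "\<bar>f x\<bar> \<le> (\<Sum>t\<in>S. 4)" for x
      unfolding f_def
    proof (rule order_trans[OF sum_abs sum_mono])
      fix t show "\<bar>2 * (\<rho> t x - \<rho> t (t + x))\<bar> \<le> 4"
        using \<rho>1[of t x] \<rho>1[of t "t + x"] by (simp add: abs_le_iff)
    qed
    fix g :: "'a \<Rightarrow> real" assume g: "integrable m g" "\<And>x. 0 \<le> g x" "\<And>x. x \<notin> X \<Longrightarrow> g x = 0" "(\<integral>x. g x \<partial>m) = 1"
    have gD: "g \<in> D" using g by (simp add: D_def)
    have [measurable]: "g \<in> borel_measurable borel" using g(1) by (auto dest!: borel_measurable_integrable)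
    note h' = D[OF h]
    have "- (1 / (8 * k)) \<le> (\<Sum>t\<in>S. \<integral>x. tangent (ratio (\<lambda>x. h x + w x) t) (\<lambda>x. g x - h x) t x \<partial>m)"
    proof (rule first_order_condition[OF h'(1,2) g(1,2) w(1,2)])
      fix t x assume t: "t \<in> S" and "w x + w (- t + x) = 0"
      then have "w x = 0" "w (- t + x) = 0" using w(2)[of x] w(2)[of "- t + x"] by linarith+
      then have "x \<notin> X" "- t + x \<notin> X" using w(3) by auto
      then show "g x = h x \<and> g (- t + x) = h (- t + x)" using g(3) h'(3) by simp
    next
      fix s :: real assume s: "0 < s" "s \<le> 1"
      let ?hs = "\<lambda>x. (1 - s) * h x + s * g x"
      have hsD: "?hs \<in> D"
        using s h' g unfolding D_def by (auto intro!: add_nonneg_nonneg mult_nonneg_nonneg)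
      have "d h ?hs = (\<integral>x. s * \<bar>h x - g x\<bar> \<partial>m)"
      proof -
        have "\<bar>h x - ((1 - s) * h x + s * g x)\<bar> = s * \<bar>h x - g x\<bar>" for x
        proof -
          have "h x - ((1 - s) * h x + s * g x) = s * (h x - g x)" by (simp add: algebra_simps)
          then show ?thesis using s by (simp add: abs_mult)
        qed
        then show ?thesis by (simp add: d_def)
      qed
      also have "\<dots> \<le> (\<integral>x. s * (h x + g x) \<partial>m)"
        using h' g s by (intro integral_mono mult_left_mono) (auto simp: abs_le_iff add_nonneg_nonneg)
      also have "\<dots> = 2 * s" using h' g by simp
      finally have "d h ?hs \<le> 2 * s" .
      then have "1 / (16 * k) * d h ?hs \<le> 1 / (16 * k) * (2 * s)"
        using k by (intro mult_left_mono) auto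
      then show "sq_variation S (\<lambda>x. h x + w x) \<le> sq_variation S (\<lambda>x. (1 - s) * h x + s * g x + w x) + 1 / (8 * k) * s"
        using hmin[OF hsD] by (simp add: J'_def)
    qed
    then have fo: "- (1 / (8 * k)) \<le> (\<Sum>t\<in>S. \<integral>x. tangent (\<rho> t) (\<lambda>x. g x - h x) t x \<partial>m)"
      by (simp add: \<rho>_def u_def[abs_def])
    have it: "integrable m (tangent (\<rho> t) v t)" if "integrable m v" for t v
      using that \<rho>1 by (intro integrable_tangent) auto
    \<comment> \<open>Write \<open>g - h\<close> as \<open>g - u + w\<close>. The \<open>u\<close>
      term is the variation itself and the \<open>w\<close> term is small; in the \<open>g\<close>
      term the negative square is dropped and the translation is moved onto
      \<open>\<rho> t\<close>.\<close>
    have split: "(\<integral>x. tangent (\<rho> t) (\<lambda>x. g x - h x) t x \<partial>m) \<le>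
        (\<integral>x. 2 * (\<rho> t x - \<rho> t (t + x)) * g x \<partial>m) - (\<integral>x. tangent (\<rho> t) u t x \<partial>m) + 6 * \<omega>" for t
    proof -
      have "tangent (\<rho> t) (\<lambda>x. g x - h x) t x
          = tangent (\<rho> t) g t x - tangent (\<rho> t) u t x + tangent (\<rho> t) w t x" for x
        by (simp add: tangent_def u_def algebra_simps)
      then have "(\<integral>x. tangent (\<rho> t) (\<lambda>x. g x - h x) t x \<partial>m)
          = (\<integral>x. tangent (\<rho> t) g t x \<partial>m) - (\<integral>x. tangent (\<rho> t) u t x \<partial>m) + (\<integral>x. tangent (\<rho> t) w t x \<partial>m)"
        using it[OF g(1)] it[OF u(1)] it[OF w(1)] by simp
      moreover have "(\<integral>x. tangent (\<rho> t) w t x \<partial>m) \<le> 6 * \<omega>"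
      proof -
        have "(\<integral>x. tangent (\<rho> t) w t x \<partial>m) \<le> 6 * (\<integral>x. \<bar>w x\<bar> \<partial>m)"
          using \<rho>1 by (intro integral_tangent_le w) auto
        then show ?thesis using w by simp
      qed
      moreover have "(\<integral>x. tangent (\<rho> t) g t x \<partial>m) \<le> (\<integral>x. 2 * (\<rho> t x - \<rho> t (t + x)) * g x \<partial>m)"
      proof -
        have gt: "integrable m (\<lambda>x. g (- t + x))" by (rule integrable_translate[OF g(1)])
        have i1: "integrable m (\<lambda>x. g x * \<rho> t x)"
          by (rule Bochner_Integration.integrable_bound[OF g(1)])
            (use \<rho>1[of t] in \<open>auto simp: abs_mult intro!: mult_left_le\<close>)
        have i2: "integrable m (\<lambda>x. g (- t + x) * \<rho> t x)"
          by (rule Bochner_Integration.integrable_bound[OF gt])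
            (use \<rho>1[of t] in \<open>auto simp: abs_mult intro!: mult_left_le\<close>)
        have i3: "integrable m (\<lambda>x. g x * \<rho> t (t + x))"
          by (rule Bochner_Integration.integrable_bound[OF g(1)])
            (use \<rho>1[of t] in \<open>auto simp: abs_mult intro!: mult_left_le\<close>)
        have "(\<integral>x. tangent (\<rho> t) g t x \<partial>m) \<le> (\<integral>x. 2 * (g x * \<rho> t x - g (- t + x) * \<rho> t x) \<partial>m)"
        proof (rule integral_mono[OF it[OF g(1)]])
          fix x
          have "0 \<le> (\<rho> t x)\<^sup>2 * (g x + g (- t + x))" using g(2) by simp
          then show "tangent (\<rho> t) g t x \<le> 2 * (g x * \<rho> t x - g (- t + x) * \<rho> t x)"
            by (simp add: tangent_def algebra_simps)
        qed (use i1 i2 in auto)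
        also have "\<dots> = 2 * ((\<integral>x. g x * \<rho> t x \<partial>m) - (\<integral>x. g (- t + x) * \<rho> t x \<partial>m))"
          using i1 i2 by simp
        also have "(\<integral>x. g (- t + x) * \<rho> t x \<partial>m) = (\<integral>x. g x * \<rho> t (t + x) \<partial>m)"
          using integral_translate[of "\<lambda>x. g x * \<rho> t (t + x)" "- t"] by (simp add: add.assoc[symmetric])
        also have "2 * ((\<integral>x. g x * \<rho> t x \<partial>m) - (\<integral>x. g x * \<rho> t (t + x) \<partial>m))
            = (\<integral>x. 2 * (\<rho> t x - \<rho> t (t + x)) * g x \<partial>m)"
        proof -
          have "2 * (\<rho> t x - \<rho> t (t + x)) * g x = 2 * (g x * \<rho> t x - g x * \<rho> t (t + x))" for x
            by (simp add: algebra_simps)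
          then show ?thesis using i1 i3 by simp
        qed
        finally show ?thesis .
      qed
      ultimately show ?thesis by linarith
    qed
    have "- (1 / (8 * k)) \<le> (\<Sum>t\<in>S. (\<integral>x. 2 * (\<rho> t x - \<rho> t (t + x)) * g x \<partial>m)
        - (\<integral>x. tangent (\<rho> t) u t x \<partial>m) + 6 * \<omega>)"
      using fo split by (rule order_trans[OF _ sum_mono])
    also have "\<dots> = (\<Sum>t\<in>S. \<integral>x. 2 * (\<rho> t x - \<rho> t (t + x)) * g x \<partial>m) - sq_variation S u + k * (6 * \<omega>)"
      by (simp add: sum.distrib sum_subtractf sq_variation_def \<rho>_def k_def)
    also have "(\<Sum>t\<in>S. \<integral>x. 2 * (\<rho> t x - \<rho> t (t + x)) * g x \<partial>m) = (\<integral>x. f x * g x \<partial>m)"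
    proof -
      have "integrable m (\<lambda>x. 2 * (\<rho> t x - \<rho> t (t + x)) * g x)" for t
      proof -
        have "\<bar>2 * (\<rho> t x - \<rho> t (t + x))\<bar> \<le> 4" for x
          using \<rho>1[of t x] \<rho>1[of t "t + x"] by (simp add: abs_le_iff)
        then have b: "norm (2 * (\<rho> t x - \<rho> t (t + x)) * g x) \<le> norm (4 * g x)" for x
          using mult_right_mono[of "\<bar>2 * (\<rho> t x - \<rho> t (t + x))\<bar>" 4 "\<bar>g x\<bar>"]
          by (simp only: real_norm_def abs_mult[of _ "g x"] abs_numeral abs_ge_zero)
        show ?thesis
        proof (rule Bochner_Integration.integrable_bound)
          show "integrable m (\<lambda>x. 4 * g x)" using g(1) by simp
          show "AE x in m. norm (2 * (\<rho> t x - \<rho> t (t + x)) * g x) \<le> norm (4 * g x)"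
            by (rule AE_I2[OF b])
        qed simp
      qed
      then show ?thesis unfolding f_def sum_distrib_right by simp
    qed
    finally have "sq_variation S u - k * (6 * \<omega>) - 1 / (8 * k) \<le> (\<integral>x. f x * g x \<partial>m)" by simp
    moreover have "1 / (2 * k) \<le> sq_variation S u"
    proof -
      have "1 \<le> (\<integral>x. u x \<partial>m)" unfolding u_def using h' w \<omega> by simp
      then have "1 / (2 * k) \<le> (\<integral>x. u x \<partial>m) / (2 * card S)"
        using k unfolding k_def of_nat_mult of_nat_numeral by (intro divide_right_mono) auto
      then show ?thesis using sq_variation_ge[OF S NC u] by linarith
    qed
    moreover have "k * (6 * \<omega>) = 1 / (8 * k)" using k by (simp add: \<omega>_def power2_eq_square)
    moreover have "1 / (2 * k) = 1 / (4 * k) + 1 / (8 * k) + 1 / (8 * k)" using k by (simp add: field_simps)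
    ultimately show "1 / (4 * k) \<le> (\<integral>x. f x * g x \<partial>m)" by linarith
  qed
  moreover have "1 / (8 * k) \<le> (\<Sum>t\<in>S. \<rho> t x - \<rho> t (t + x))" if "1 / (4 * k) \<le> f x" for x
  proof -
    have "1 / (4 * k) = 2 * (1 / (8 * k))" using k by simp
    moreover have "f x = 2 * (\<Sum>t\<in>S. \<rho> t x - \<rho> t (t + x))" unfolding f_def sum_distrib_left ..
    ultimately show ?thesis using that by linarith
  qed
  ultimately have "AE x in m. x \<in> X \<longrightarrow> 1 / (8 * k) \<le> (\<Sum>t\<in>S. \<rho> t x - \<rho> t (t + x))"
    by (auto elim: eventually_mono)
  then show ?thesis using \<rho>1 by (intro that[of \<rho>]) (auto simp: k_def)
qed

end

subsection \<open>Gluing over cosets of an open subgroup\<close>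

text \<open>The subgroup generated by \<open>S\<close> and a compact neighbourhood of 0.
  Sigma-compactness will give a strictly positive integrable function on each coset. Openness gives
  the cosets positive measure and lets only countably many of them meet an open set of finite
  measure.\<close>

lemma open_subgroup_generated:
  fixes S :: "'a::{topological_group_add, t2_space} set"
  assumes lc: "locally_compact_space (euclidean :: 'a topology)" and S: "finite S"
  obtains H :: "'a set" and K :: "nat \<Rightarrow> 'a set"
  where "open H" "0 \<in> H" "S \<subseteq> H" "\<forall>x\<in>H. \<forall>y\<in>H. x + y \<in> H"
    "\<forall>x\<in>H. - x \<in> H" "\<forall>n. compact (K n)" "H = (\<Union>n. K n)"
proof -
  have "\<exists>U V. open U \<and> compact V \<and> (0::'a) \<in> U \<and> U \<subseteq> V"
    using lc unfolding locally_compact_space_def by simp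
  then obtain U V :: "'a set" where UV: "open U" "compact V" "0 \<in> U" "U \<subseteq> V"
    by (elim exE conjE)
  \<comment> \<open>Closed under negation, so that the finite sums of its elements already form a
    subgroup.\<close>
  define Q where "Q = V \<union> uminus ` V \<union> S \<union> uminus ` S"
  have neg: "compact (uminus ` A)" if "compact A" for A :: "'a set"
    using that by (intro compact_continuous_image continuous_intros)
  have Q: "compact Q"
    unfolding Q_def by (intro compact_Un neg UV(2) finite_imp_compact[OF S])
  have Q_neg: "- x \<in> Q" if "x \<in> Q" for x using that by (auto simp: Q_def)
  define P where "P = rec_nat {0} (\<lambda>_ A. (\<lambda>(x, y). x + y) ` (Q \<times> A))"
  have P0: "P 0 = {0}" and PS: "P (Suc n) = (\<lambda>(x, y). x + y) ` (Q \<times> P n)" for n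
    by (simp_all add: P_def)
  have cP: "compact (P n)" for n
  proof (induction n)
    case (Suc n)
    show ?case unfolding PS
      by (intro compact_continuous_image compact_Times Q Suc) (auto intro!: continuous_intros simp: case_prod_beta)
  qed (simp add: P0)
  define H where "H = (\<Union>n. P n)"
  have add': "x + y \<in> H" if "y \<in> H" "x \<in> P n" for x y n
    using that(2)
  proof (induction n arbitrary: x)
    case (Suc n)
    then obtain q p where x: "x = q + p" "q \<in> Q" "p \<in> P n" by (auto simp: PS)
    obtain k where "p + y \<in> P k" using Suc.IH[OF x(3)] by (auto simp: H_def)
    then have "q + (p + y) \<in> P (Suc k)" using x(2) unfolding PS by (intro image_eqI[of _ _ "(q, p + y)"]) auto
    then show ?case using x by (auto simp: H_def add.assoc)
  qed (use that P0 in simp)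
  have add: "x + y \<in> H" if x: "x \<in> H" and y: "y \<in> H" for x y
  proof -
    obtain n where "x \<in> P n" using x by (auto simp: H_def)
    then show ?thesis by (rule add'[OF y])
  qed
  have H0: "0 \<in> H" unfolding H_def using P0 by blast
  have QH: "Q \<subseteq> H"
  proof
    fix q assume "q \<in> Q"
    then have "q \<in> P (Suc 0)" unfolding PS P0 by (intro image_eqI[of _ _ "(q, 0)"]) auto
    then show "q \<in> H" by (auto simp: H_def)
  qed
  have neg': "- x \<in> H" if "x \<in> P n" for x n
    using that
  proof (induction n arbitrary: x)
    case (Suc n)
    then obtain q p where x: "x = q + p" "q \<in> Q" "p \<in> P n" by (auto simp: PS)
    show ?case using add[OF Suc.IH[OF x(3)], of "- q"] QH Q_neg[OF x(2)] by (auto simp: x(1) minus_add)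
  qed (use H0 P0 in simp)
  have "open H"
  proof (subst open_subopen, intro ballI)
    fix h assume h: "h \<in> H"
    let ?U = "(\<lambda>x. - h + x) -` U"
    have "open ?U" by (rule open_vimage[OF UV(1)]) (intro continuous_intros)
    moreover have "h \<in> ?U" using UV by simp
    moreover have "?U \<subseteq> H"
    proof
      fix x assume "x \<in> ?U"
      then have "- h + x \<in> H" using UV QH by (auto simp: Q_def)
      from add[OF h this] show "x \<in> H" by (simp add: add.assoc[symmetric])
    qed
    ultimately show "\<exists>T. open T \<and> h \<in> T \<and> T \<subseteq> H" by blast
  qed
  moreover have "S \<subseteq> H" using QH by (auto simp: Q_def)
  moreover have "- x \<in> H" if "x \<in> H" for x using that neg' by (auto simp: H_def)
  ultimately show ?thesis using that[of H P] H0 add cP H_def by blast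
qed

context left_haar begin

lemma ex_positive_integrable:
  fixes L :: "nat \<Rightarrow> 'a set"
  assumes L: "\<And>n. L n \<in> fmeasurable m" and X: "X = (\<Union>n. L n)" "emeasure m X \<noteq> 0"
  obtains w :: "'a \<Rightarrow> real" where "integrable m w" "\<And>x. 0 \<le> w x" "\<And>x. x \<in> X \<longleftrightarrow> 0 < w x"
    "0 < (\<integral>x. w x \<partial>m)"
proof -
  have [measurable]: "L n \<in> sets borel" for n using L[of n] by (auto dest: fmeasurableD)
  \<comment> \<open>Dividing by \<open>1 + measure m (L n)\<close> lets one geometric series
    dominate both the pointwise sums and the integrals.\<close>
  define c where "c n = (1/2) ^ n / (1 + measure m (L n))" for n
  have c: "0 < c n" "c n \<le> (1/2) ^ n" "c n * measure m (L n) \<le> (1/2) ^ n" for n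
  proof -
    have p: "0 < 1 + measure m (L n)" by (simp add: add_pos_nonneg)
    show "0 < c n" using p by (simp add: c_def)
    have "(1/2) ^ n * measure m (L n) \<le> (1/2) ^ n * (1 + measure m (L n))" by (intro mult_left_mono) auto
    then show "c n * measure m (L n) \<le> (1/2) ^ n"
      using p by (simp add: c_def pos_divide_le_eq)
    have "(1/2) ^ n * 1 \<le> (1/2) ^ n * (1 + measure m (L n))" by (intro mult_left_mono) auto
    then show "c n \<le> (1/2) ^ n" using p by (simp add: c_def pos_divide_le_eq)
  qed
  define f where "f n x = c n * indicator (L n) x" for n and x :: 'a
  have f0: "0 \<le> f n x" for n x using c(1)[of n] by (simp add: f_def less_imp_le)
  have geo: "summable (\<lambda>n. (1/2 :: real) ^ n)" by (intro summable_geometric) simp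
  have sf: "summable (\<lambda>n. f n x)" for x
  proof (rule summable_comparison_test'[OF geo])
    show "norm (f n x) \<le> (1/2) ^ n" for n
      using c(1,2)[of n] by (auto simp: f_def indicator_def)
  qed
  define w where "w x = (\<Sum>n. f n x)" for x
  have fi: "integrable m (f n)" for n
    unfolding f_def using L[of n] by (intro integrable_mult_right integrable_real_indicator) (auto simp: fmeasurable_def)
  have iw: "integrable m w"
    unfolding w_def
  proof (rule integrable_suminf[OF fi])
    show "AE x in m. summable (\<lambda>n. norm (f n x))" using sf f0 by simp
    have "(\<integral>x. norm (f n x) \<partial>m) = c n * measure m (L n)" for n
      using f0 by (simp add: f_def)
    then show "summable (\<lambda>n. \<integral>x. norm (f n x) \<partial>m)"
      using c by (intro summable_comparison_test'[OF geo]) (auto simp: less_imp_le)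
  qed
  have w0: "0 \<le> w x" for x unfolding w_def by (intro suminf_nonneg sf f0)
  have wX: "x \<in> X \<longleftrightarrow> 0 < w x" for x
  proof
    assume "x \<in> X"
    then obtain n where "x \<in> L n" using X by auto
    then have "0 < f n x" using c by (simp add: f_def)
    then show "0 < w x" unfolding w_def by (intro suminf_pos2[OF sf f0])
  next
    assume "0 < w x"
    show "x \<in> X"
    proof (rule ccontr)
      assume "x \<notin> X"
      then have "f n x = 0" for n using X by (simp add: f_def)
      then show False using \<open>0 < w x\<close> by (simp add: w_def)
    qed
  qed
  have "0 < (\<integral>x. w x \<partial>m)"
  proof (rule ccontr)
    assume "\<not> ?thesis"
    then have "(\<integral>x. w x \<partial>m) = 0"
      using w0 by (intro antisym Bochner_Integration.integral_nonneg) auto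
    then have "AE x in m. w x = 0" using iw w0 by (simp add: integral_nonneg_eq_0_iff_AE)
    then have "AE x in m. x \<notin> X" by eventually_elim (simp add: wX)
    then have "X \<in> null_sets m" using X by (subst (asm) AE_iff_null_sets[symmetric]) auto
    then show False using X by auto
  qed
  with iw w0 wX that show ?thesis by blast
qed

text \<open>Finitely many of the disjoint traces on \<open>U\<close> have total measure at most that
  of \<open>U\<close>, so only countably many have positive measure; a nonempty open trace always
  does.\<close>

lemma countable_disjoint_open:
  assumes op: "\<And>X. X \<in> \<C> \<Longrightarrow> open X" and dis: "disjoint \<C>" and U: "open U" "U \<in> fmeasurable m"
  shows "countable {X \<in> \<C>. X \<inter> U \<noteq> {}}"
proof -
  let ?f = "\<lambda>X. measure m (X \<inter> U)"
  let ?D = "{X \<in> \<C>. X \<inter> U \<noteq> {}}"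
  have fm: "X \<inter> U \<in> fmeasurable m" if "X \<in> \<C>" for X
    using fmeasurable_Int_fmeasurable[OF U(2), of X] op[OF that] by (simp add: Int_commute)
  have "?f summable_on ?D"
  proof (rule nonneg_bdd_above_summable_on)
    show "bdd_above (sum ?f ` {F. F \<subseteq> ?D \<and> finite F})"
    proof (rule bdd_aboveI2)
      fix F assume F: "F \<in> {F. F \<subseteq> ?D \<and> finite F}"
      have sets: "X \<inter> U \<in> sets m" if "X \<in> F" for X using F fm that by (intro fmeasurableD) auto
      have "measure m (\<Union>X\<in>F. X \<inter> U) = sum ?f F"
      proof (rule measure_finite_Union)
        show "disjoint_family_on (\<lambda>X. X \<inter> U) F"
          using F dis unfolding disjoint_family_on_def disjoint_def by blast
        show "emeasure m (X \<inter> U) \<noteq> \<infinity>" if "X \<in> F" for X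
          using fm[of X] F that by (auto simp: fmeasurable_def)
      qed (use F sets in auto)
      moreover have "measure m (\<Union>X\<in>F. X \<inter> U) \<le> measure m U"
        using F sets by (intro measure_mono_fmeasurable sets.finite_UN U(2)) auto
      ultimately show "sum ?f F \<le> measure m U" by simp
    qed
  qed simp
  then have "countable {X \<in> ?D. ?f X \<noteq> 0}" by (rule summable_countable_real)
  moreover have "?f X \<noteq> 0" if X: "X \<in> ?D" for X
  proof -
    obtain x where "x \<in> X \<inter> U" using X by auto
    then have "emeasure m (X \<inter> U) \<noteq> 0" using X by (intro open_pos open_Int op U(1)) auto
    then show ?thesis using emeasure_eq_measure2[OF fm] X by auto
  qed
  ultimately show ?thesis by (simp cong: conj_cong)
qed

section \<open>From an invariant mean to almost invariant compact sets\<close>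

lemma
  assumes "left_invariant_mean m \<Lambda>"
  shows left_invariant_mean_add:
      "f \<in> Linfty m \<Longrightarrow> g \<in> Linfty m \<Longrightarrow> \<Lambda> (\<lambda>x. f x + g x) = \<Lambda> f + \<Lambda> g"
    and left_invariant_mean_cmult: "f \<in> Linfty m \<Longrightarrow> \<Lambda> (\<lambda>x. k * f x) = k * \<Lambda> f"
    and left_invariant_mean_nonneg:
      "f \<in> Linfty m \<Longrightarrow> locally_AE m (\<lambda>x. f x \<in> \<real>\<^sub>\<ge>\<^sub>0) \<Longrightarrow> \<Lambda> f \<in> \<real>\<^sub>\<ge>\<^sub>0"
    and left_invariant_mean_one: "\<Lambda> (\<lambda>x. 1) = 1"
    and left_invariant_mean_translate: "f \<in> Linfty m \<Longrightarrow> \<Lambda> (\<lambda>x. f (s + x)) = \<Lambda> f"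
proof -
  note M = assms[unfolded left_invariant_mean_def, THEN conjunct2]
  show "f \<in> Linfty m \<Longrightarrow> g \<in> Linfty m \<Longrightarrow> \<Lambda> (\<lambda>x. f x + g x) = \<Lambda> f + \<Lambda> g"
    by (rule M[THEN conjunct1, rule_format])
  show "f \<in> Linfty m \<Longrightarrow> \<Lambda> (\<lambda>x. k * f x) = k * \<Lambda> f"
    by (rule M[THEN conjunct2, THEN conjunct1, rule_format])
  show "f \<in> Linfty m \<Longrightarrow> locally_AE m (\<lambda>x. f x \<in> \<real>\<^sub>\<ge>\<^sub>0) \<Longrightarrow> \<Lambda> f \<in> \<real>\<^sub>\<ge>\<^sub>0"
    by (rule M[THEN conjunct2, THEN conjunct2, THEN conjunct1, rule_format])
  show "\<Lambda> (\<lambda>x. 1) = 1"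
    by (rule M[THEN conjunct2, THEN conjunct2, THEN conjunct2, THEN conjunct1])
  show "f \<in> Linfty m \<Longrightarrow> \<Lambda> (\<lambda>x. f (s + x)) = \<Lambda> f"
    by (rule M[THEN conjunct2, THEN conjunct2, THEN conjunct2, THEN conjunct2, rule_format])
qed

lemma left_invariant_mean_sum:
  assumes M: "left_invariant_mean m \<Lambda>" and "finite S" "\<And>t. t \<in> S \<Longrightarrow> f t \<in> Linfty m"
  shows "(\<lambda>x. \<Sum>t\<in>S. f t x) \<in> Linfty m \<and> \<Lambda> (\<lambda>x. \<Sum>t\<in>S. f t x) = (\<Sum>t\<in>S. \<Lambda> (f t))"
  using assms(2,3)
proof (induction S rule: finite_induct)
  case empty
  have "\<Lambda> (\<lambda>x. 0 * 1) = 0 * \<Lambda> (\<lambda>x. 1)"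
    by (rule left_invariant_mean_cmult[OF M Linfty_const])
  then show ?case by (simp add: Linfty_const)
next
  case (insert t S)
  have "\<Lambda> (\<lambda>x. f t x + (\<Sum>t\<in>S. f t x)) = \<Lambda> (f t) + \<Lambda> (\<lambda>x. \<Sum>t\<in>S. f t x)"
    using insert by (intro left_invariant_mean_add[OF M]) auto
  then show ?case using insert by (simp add: Linfty_add)
qed

text \<open>The bounds obtained on single cosets are the same for all cosets, so the functions glue
  to elements of \<open>Linfty m\<close> even if there are uncountably many cosets.\<close>

lemma folner_if_amenable:
  fixes S :: "'a set"
  assumes lc: "locally_compact_space (euclidean :: 'a topology)" and am: "amenable m"
    and S: "finite S" "S \<noteq> {}"
  shows "\<exists>C. compact C \<and> (\<Sum>t\<in>S. measure m ((\<lambda>x. t + x) ` C - C)) < measure m C"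
proof (rule ccontr)
  assume "\<not> ?thesis"
  then have NC: "measure m C \<le> (\<Sum>t\<in>S. measure m ((\<lambda>x. t + x) ` C - C))" if "compact C" for C
    using that by (auto simp: not_less)
  obtain H :: "'a set" and K :: "nat \<Rightarrow> 'a set" where H: "open H" "0 \<in> H" "S \<subseteq> H"
    and H': "\<forall>x\<in>H. \<forall>y\<in>H. x + y \<in> H" "\<forall>x\<in>H. - x \<in> H" "\<forall>n. compact (K n)"
    and HK: "H = (\<Union>n. K n)"
    by (rule open_subgroup_generated[OF lc S(1)])
  note add = H'(1)[rule_format] and neg = H'(2)[rule_format] and K = H'(3)[rule_format] HK
  \<comment> \<open>These are the right cosets \<open>H + g\<close>, which left translation by
    elements of \<open>S\<close> preserves.\<close>
  define coset where "coset g = {x. x - g \<in> H}" for g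
  have self: "g \<in> coset g" for g using H by (simp add: coset_def)
  have eq: "coset x = coset g" if "x \<in> coset g" for x g
  proof -
    have xg: "x - g \<in> H" using that by (simp add: coset_def)
    have gx: "g - x \<in> H" using neg[OF xg] by simp
    have "y - x \<in> H \<longleftrightarrow> y - g \<in> H" for y
      using add[OF _ xg, of "y - x"] add[OF _ gx, of "y - g"] by (auto simp: diff_add_eq_diff_diff_swap add_diff_eq)
    then show ?thesis by (simp add: coset_def)
  qed
  have shift: "s + x \<in> coset g \<longleftrightarrow> x \<in> coset g" if "s \<in> H" for s x g
  proof -
    have "(s + x) - g = s + (x - g)" by (simp add: add_diff_eq)
    moreover have "x - g = - s + (s + (x - g))" by (simp add: add.assoc[symmetric])
    ultimately show ?thesis using add[OF that, of "x - g"] add[OF neg[OF that], of "s + (x - g)"]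
      by (auto simp: coset_def)
  qed
  have op: "open (coset g)" for g
  proof -
    have "coset g = (\<lambda>x. x - g) -` H" by (auto simp: coset_def)
    then show ?thesis by (simp only:) (intro open_vimage H(1) continuous_intros)
  qed
  have [measurable]: "coset g \<in> sets borel" for g using op by auto
  define c where "c = 1 / (8 * real (card S))"
  have c: "0 < c" using S by (simp add: c_def card_gt_0_iff)
  have "\<exists>\<rho>. (\<forall>t. \<rho> t \<in> borel_measurable borel) \<and> (\<forall>t x. \<bar>\<rho> t x\<bar> \<le> 1) \<and>
      (AE x in m. x \<in> X \<longrightarrow> c \<le> (\<Sum>t\<in>S. \<rho> t x - \<rho> t (t + x)))" if X: "X \<in> range coset" for X
  proof -
    obtain g where g: "X = coset g" using X by auto
    have Kg: "(\<lambda>k. k + g) ` K n \<in> fmeasurable m" for n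
      by (intro compact_fmeasurable compact_continuous_image K continuous_intros)
    have coset_eq: "coset g = (\<Union>n. (\<lambda>k. k + g) ` K n)"
    proof (intro set_eqI iffI)
      fix x assume "x \<in> coset g"
      then obtain n where "x - g \<in> K n" using K(2) by (auto simp: coset_def)
      then show "x \<in> (\<Union>n. (\<lambda>k. k + g) ` K n)" by (intro UN_I[of n] image_eqI[of _ _ "x - g"]) auto
    qed (use K(2) in \<open>auto simp: coset_def\<close>)
    show ?thesis
    proof (rule ex_positive_integrable[OF Kg coset_eq open_pos[OF op self]])
      fix w :: "'a \<Rightarrow> real"
      assume w: "integrable m w" "\<And>x. 0 \<le> w x" "\<And>x. x \<in> coset g \<longleftrightarrow> 0 < w x" "0 < (\<integral>x. w x \<partial>m)"
      have inv: "- t + x \<in> coset g \<longleftrightarrow> x \<in> coset g" if "t \<in> S" for t x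
        using that H(3) neg by (intro shift) auto
      show ?thesis
      proof (rule ex_bounded_gradient[OF S NC inv w])
        fix \<rho> :: "'a \<Rightarrow> 'a \<Rightarrow> real"
        assume "\<And>t. \<rho> t \<in> borel_measurable borel" "\<And>t x. \<bar>\<rho> t x\<bar> \<le> 1"
          "AE x in m. x \<in> coset g \<longrightarrow> 1 / (8 * real (card S)) \<le> (\<Sum>t\<in>S. \<rho> t x - \<rho> t (t + x))"
        then show ?thesis unfolding g c_def by (intro exI[of _ \<rho>] conjI allI)
      qed
    qed
  qed
  then have "\<forall>X\<in>range coset. \<exists>\<rho>. (\<forall>t. \<rho> t \<in> borel_measurable borel) \<and> (\<forall>t x. \<bar>\<rho> t x\<bar> \<le> 1) \<and>
      (AE x in m. x \<in> X \<longrightarrow> c \<le> (\<Sum>t\<in>S. \<rho> t x - \<rho> t (t + x)))"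
    by (rule ballI)
  from bchoice[OF this] obtain \<rho> where \<rho>': "\<forall>X\<in>range coset. (\<forall>t. \<rho> X t \<in> borel_measurable borel) \<and>
      (\<forall>t x. \<bar>\<rho> X t x\<bar> \<le> 1) \<and> (AE x in m. x \<in> X \<longrightarrow> c \<le> (\<Sum>t\<in>S. \<rho> X t x - \<rho> X t (t + x)))"
    by (elim exE)
  have \<rho>: "\<rho> X t \<in> borel_measurable borel" "\<bar>\<rho> X t x\<bar> \<le> 1"
    "AE x in m. x \<in> X \<longrightarrow> c \<le> (\<Sum>t\<in>S. \<rho> X t x - \<rho> X t (t + x))"
    if "X \<in> range coset" for X t x
  proof -
    note *  = bspec[OF \<rho>' that]
    show "\<rho> X t \<in> borel_measurable borel" by (rule *[THEN conjunct1, rule_format])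
    show "\<bar>\<rho> X t x\<bar> \<le> 1" by (rule *[THEN conjunct2, THEN conjunct1, rule_format])
    show "AE x in m. x \<in> X \<longrightarrow> c \<le> (\<Sum>t\<in>S. \<rho> X t x - \<rho> X t (t + x))"
      by (rule *[THEN conjunct2, THEN conjunct2])
  qed
  \<comment> \<open>The value at \<open>x\<close> comes from the function chosen for the coset of
    \<open>x\<close>. As \<open>t + x\<close> lies in the same coset for \<open>t \<in> S\<close>,
    the inequality survives the gluing.\<close>
  define R where "R t x = \<rho> (coset x) t x" for t x
  have R1: "\<bar>R t x\<bar> \<le> 1" for t x unfolding R_def by (rule \<rho>(2)) simp
  have dis: "disjoint (range coset)"
  proof (rule disjointI)
    fix X Y assume XY: "X \<in> range coset" "Y \<in> range coset" "X \<noteq> Y"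
    obtain g where g: "X = coset g" using XY(1) by (rule rangeE)
    obtain h where h: "Y = coset h" using XY(2) by (rule rangeE)
    note gh = g h
    have "False" if x: "x \<in> X" "x \<in> Y" for x
    proof -
      have "X = coset x" "Y = coset x" using x eq[of x g] eq[of x h] unfolding gh by simp_all
      then show False using XY(3) by simp
    qed
    then show "X \<inter> Y = {}" by auto
  qed
  \<comment> \<open>With uncountably many cosets, neither Borel measurability of \<open>R\<close>
    nor a single exceptional null set is to be expected; a set of finite measure sees only countably
    many cosets, which suffices for the local notions.\<close>
  have cover: "\<exists>\<X>\<subseteq>range coset. countable \<X> \<and> A \<subseteq> \<Union>\<X>" if A: "A \<in> fmeasurable m" for A
  proof -
    obtain U where U: "open U" "A \<subseteq> U" "U \<in> fmeasurable m"
      by (rule outer_regular[OF A zero_less_one]) (rule that)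
    have "countable {X \<in> range coset. X \<inter> U \<noteq> {}}"
      using op dis by (intro countable_disjoint_open[OF _ _ U(1,3)]) auto
    moreover have "A \<subseteq> \<Union>{X \<in> range coset. X \<inter> U \<noteq> {}}"
    proof
      fix x assume "x \<in> A"
      then show "x \<in> \<Union>{X \<in> range coset. X \<inter> U \<noteq> {}}"
        using U(2) self[of x] by (intro UnionI[of "coset x"]) auto
    qed
    ultimately show ?thesis by (intro exI[of _ "{X \<in> range coset. X \<inter> U \<noteq> {}}"]) simp
  qed
  define R' where "R' t x = complex_of_real (R t x)" for t x
  have R': "R' t \<in> Linfty m" for t
  proof -
    have "(\<lambda>x. indicator A x *\<^sub>R R' t x) \<in> borel_measurable m" if A: "A \<in> fmeasurable m" for A
    proof -
      obtain \<X> where \<X>: "\<X> \<subseteq> range coset" "countable \<X>" "A \<subseteq> \<Union>\<X>" using cover[OF A] by blast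
      have [measurable]: "A \<in> sets borel" using A by (auto dest: fmeasurableD)
      have oX: "X \<in> sets borel" if "X \<in> \<X>" for X using that \<X>(1) op by auto
      show ?thesis
      \<comment> \<open>The additional piece, the complement of the countable union, misses
        \<open>A\<close>, so the function vanishes on it.\<close>
      proof (rule measurable_piecewise_restrict[of "insert (- \<Union>\<X>) \<X>"])
        have "\<Union>\<X> \<in> sets borel" using oX \<X>(2) by (intro sets.countable_Union) auto
        then show "\<Omega> \<inter> space m \<in> sets m" if "\<Omega> \<in> insert (- \<Union>\<X>) \<X>" for \<Omega>
          using that oX by auto
        fix \<Omega> assume "\<Omega> \<in> insert (- \<Union>\<X>) \<X>"
        then consider "\<Omega> = - \<Union>\<X>" | "\<Omega> \<in> \<X>" by auto
        then show "(\<lambda>x. indicator A x *\<^sub>R R' t x) \<in> borel_measurable (restrict_space m \<Omega>)"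
        proof cases
          case 1
          have "(\<lambda>x. 0 :: complex) \<in> borel_measurable (restrict_space m \<Omega>)" by simp
          then show ?thesis
            by (rule measurable_cong[THEN iffD1, rotated])
              (use 1 \<X>(3) in \<open>auto simp: space_restrict_space indicator_def\<close>)
        next
          case 2
          then have \<Omega>: "\<Omega> \<in> range coset" using \<X>(1) by auto
          have [measurable]: "\<rho> \<Omega> t \<in> borel_measurable borel" by (rule \<rho>(1)[OF \<Omega>])
          have "(\<lambda>x. indicator A x *\<^sub>R complex_of_real (\<rho> \<Omega> t x)) \<in> borel_measurable m" by measurable
          then have meas: "(\<lambda>x. indicator A x *\<^sub>R complex_of_real (\<rho> \<Omega> t x)) \<in> borel_measurable (restrict_space m \<Omega>)"
            by (rule measurable_restrict_space1)
          have "coset x = \<Omega>" if "x \<in> \<Omega>" for x using that \<Omega> eq by auto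
          then have cong: "indicator A x *\<^sub>R R' t x = indicator A x *\<^sub>R complex_of_real (\<rho> \<Omega> t x)"
            if "x \<in> space (restrict_space m \<Omega>)" for x
            using that by (simp add: R'_def R_def space_restrict_space)
          show ?thesis by (rule measurable_cong[THEN iffD2, OF cong meas])
        qed
      qed (use \<X>(2) in auto)
    qed
    moreover have "locally_AE m (\<lambda>x. norm (R' t x) \<le> 1)"
      using R1 by (simp add: locally_AE_def R'_def)
    ultimately show ?thesis by (auto simp: Linfty_def locally_measurable_iff)
  qed
  obtain \<Lambda> where \<Lambda>: "left_invariant_mean m \<Lambda>" using am by (auto simp: amenable_def)
  let ?d = "\<lambda>t x. R' t x + (- 1) * R' t (t + x)"
  have d: "?d t \<in> Linfty m" for t
    by (intro Linfty_add Linfty_cmult Linfty_translate R')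
  have \<Lambda>d: "\<Lambda> (?d t) = 0" for t
  proof -
    have R't: "(\<lambda>x. R' t (t + x)) \<in> Linfty m" by (rule Linfty_translate[OF R'])
    have "\<Lambda> (?d t) = \<Lambda> (R' t) + \<Lambda> (\<lambda>x. (- 1) * R' t (t + x))"
      by (rule left_invariant_mean_add[OF \<Lambda> R' Linfty_cmult[OF R't]])
    also have "\<Lambda> (\<lambda>x. (- 1) * R' t (t + x)) = (- 1) * \<Lambda> (\<lambda>x. R' t (t + x))"
      by (rule left_invariant_mean_cmult[OF \<Lambda> R't])
    also have "\<Lambda> (\<lambda>x. R' t (t + x)) = \<Lambda> (R' t)"
      by (rule left_invariant_mean_translate[OF \<Lambda> R'])
    finally show ?thesis by simp
  qed
  let ?G = "\<lambda>x. \<Sum>t\<in>S. ?d t x"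
  have G: "?G \<in> Linfty m" "\<Lambda> ?G = 0"
    using left_invariant_mean_sum[OF \<Lambda> S(1), of ?d] d \<Lambda>d by auto
  \<comment> \<open>With \<open>c\<close> subtracted the sum is still nonnegative locally almost
    everywhere, yet its mean is \<open>- c\<close>.\<close>
  let ?c = "\<lambda>x::'a. complex_of_real (- c) * 1"
  have cL: "?c \<in> Linfty m" by (intro Linfty_cmult Linfty_const)
  have "\<Lambda> (\<lambda>x. ?G x + ?c x) = \<Lambda> ?G + \<Lambda> ?c"
    by (rule left_invariant_mean_add[OF \<Lambda> G(1) cL])
  moreover have "\<Lambda> ?c = complex_of_real (- c) * \<Lambda> (\<lambda>x. 1)"
    by (rule left_invariant_mean_cmult[OF \<Lambda> Linfty_const])
  moreover have "\<Lambda> (\<lambda>x. 1) = 1" by (rule left_invariant_mean_one[OF \<Lambda>])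
  ultimately have \<Lambda>G: "\<Lambda> (\<lambda>x. ?G x + ?c x) = complex_of_real (- c)" using G(2) by simp
  have "locally_AE m (\<lambda>x. ?G x + ?c x \<in> \<real>\<^sub>\<ge>\<^sub>0)"
    unfolding locally_AE_def
  proof (intro ballI impI)
    fix A assume "A \<in> sets m" "emeasure m A < \<infinity>"
    then have "A \<in> fmeasurable m" by (intro fmeasurableI)
    from cover[OF this] obtain \<X> where \<X>: "\<X> \<subseteq> range coset" "countable \<X>" "A \<subseteq> \<Union>\<X>"
      by (elim exE conjE)
    have "AE x in m. \<forall>X\<in>\<X>. x \<in> X \<longrightarrow> c \<le> (\<Sum>t\<in>S. \<rho> X t x - \<rho> X t (t + x))"
    proof (rule AE_ball_countable'[OF _ \<X>(2)])
      fix X assume "X \<in> \<X>"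
      then have "X \<in> range coset" using \<X>(1) by (rule rev_subsetD)
      then show "AE x in m. x \<in> X \<longrightarrow> c \<le> (\<Sum>t\<in>S. \<rho> X t x - \<rho> X t (t + x))" by (rule \<rho>(3))
    qed
    then show "AE x in m. x \<in> A \<longrightarrow> ?G x + ?c x \<in> \<real>\<^sub>\<ge>\<^sub>0"
    proof eventually_elim
      case (elim x)
      show ?case
      proof
        assume "x \<in> A"
        then obtain X where X: "X \<in> \<X>" "x \<in> X" using \<X>(3) by auto
        obtain g where g: "X = coset g" using X(1) \<X>(1) by auto
        have cx: "coset x = X" using X(2) eq[of x g] unfolding g by simp
        have "coset (t + x) = X" if "t \<in> S" for t
        proof -
          have "t + x \<in> coset x" using that H(3) shift[of t x x] self[of x] by auto
          then show ?thesis using eq[of "t + x" x] cx by simp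
        qed
        then have "(\<Sum>t\<in>S. \<rho> X t x - \<rho> X t (t + x)) = (\<Sum>t\<in>S. R t x - R t (t + x))"
          using cx by (intro sum.cong) (auto simp: R_def)
        then have "c \<le> (\<Sum>t\<in>S. R t x - R t (t + x))" using elim X by auto
        then have "complex_of_real ((\<Sum>t\<in>S. R t x - R t (t + x)) - c) \<in> \<real>\<^sub>\<ge>\<^sub>0"
          unfolding nonneg_Reals_of_real_iff by simp
        moreover have "?G x + ?c x = complex_of_real ((\<Sum>t\<in>S. R t x - R t (t + x)) - c)"
          by (simp add: R'_def)
        ultimately show "?G x + ?c x \<in> \<real>\<^sub>\<ge>\<^sub>0" by (simp only:)
      qed
    qed
  qed
  then have "\<Lambda> (\<lambda>x. ?G x + ?c x) \<in> \<real>\<^sub>\<ge>\<^sub>0"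
    by (rule left_invariant_mean_nonneg[OF \<Lambda> Linfty_add[OF G(1) cL]])
  then show False using \<Lambda>G c by (simp del: of_real_minus)
qed

lemma folner_small_products:
  assumes F: "finite F" and C: "compact C"
    and le: "(\<Sum>t\<in>F. measure m ((\<lambda>x. t + x) ` C - C)) < measure m C"
    and E: "E \<subseteq> F"
  shows "measure m (E + C) < 2 * measure m C"
proof -
  have fm: "(\<lambda>x. t + x) ` C - C \<in> fmeasurable m" for t
    using compact_fmeasurable[OF compact_translate[OF C]] compact_fmeasurable[OF C]
    by (intro fmeasurable_Diff) (auto dest: fmeasurableD)
  have finE: "finite E" using E F by (rule finite_subset)
  have Cm: "C \<in> fmeasurable m" by (rule compact_fmeasurable[OF C])
  have Um: "(\<Union>t\<in>E. (\<lambda>x. t + x) ` C - C) \<in> fmeasurable m"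
    by (rule fmeasurable.finite_UN[OF finE fm])
  have EC: "E + C \<in> sets m"
    unfolding set_plus_eq_Union using finE compact_fmeasurable[OF compact_translate[OF C]]
    by (intro sets.finite_UN fmeasurableD) auto
  have "measure m (E + C) \<le> measure m (C \<union> (\<Union>t\<in>E. (\<lambda>x. t + x) ` C - C))"
  proof (rule measure_mono_fmeasurable[OF _ EC fmeasurable.Un[OF Cm Um]])
    show "E + C \<subseteq> C \<union> (\<Union>t\<in>E. (\<lambda>x. t + x) ` C - C)" unfolding set_plus_eq_Union by blast
  qed
  also have "\<dots> \<le> measure m C + measure m (\<Union>t\<in>E. (\<lambda>x. t + x) ` C - C)"
    by (intro measure_Un_le fmeasurableD Cm Um)
  also have "measure m (\<Union>t\<in>E. (\<lambda>x. t + x) ` C - C) \<le> (\<Sum>t\<in>E. measure m ((\<lambda>x. t + x) ` C - C))"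
    by (rule measure_UNION_le[OF finE fmeasurableD[OF fm]])
  also have "\<dots> \<le> (\<Sum>t\<in>F. measure m ((\<lambda>x. t + x) ` C - C))"
    using F E by (intro sum_mono2) auto
  finally show ?thesis using le by simp
qed

end

section \<open>The equivalence of the three conditions\<close>

theorem theorem5p1:
  fixes m :: "'a::{topological_group_add, t2_space} measure"
  assumes "locally_compact_space (euclidean :: 'a topology)"
    and "left_haar_measure m"
  shows
    "(amenable m \<longleftrightarrow>
        (\<forall>\<epsilon>>0::real. \<exists>n::nat. n \<ge> 1 \<and>
          (\<forall>F::'a set. finite F \<and> card F \<ge> n \<longrightarrow>
            (\<exists>C. compact C \<and>
              (\<forall>E. E \<subseteq> F \<and> card E \<ge> n \<longrightarrow>
                measure m (E + C) < \<epsilon> * real (card E) * measure m C)))))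
     \<and>
     (amenable m \<longleftrightarrow>
        (\<exists>\<epsilon>\<^sub>0::real. \<exists>n\<^sub>0::nat. 0 < \<epsilon>\<^sub>0 \<and> \<epsilon>\<^sub>0 < 1 \<and> n\<^sub>0 \<ge> 1 \<and>
          (\<forall>F::'a set. finite F \<and> card F \<ge> n\<^sub>0 \<longrightarrow>
            (\<exists>C. compact C \<and>
              (\<forall>E. E \<subseteq> F \<and> card E \<ge> n\<^sub>0 \<longrightarrow>
                measure m (E + C) < \<epsilon>\<^sub>0 * real (card E) * measure m C)))))"
    (is "(_ \<longleftrightarrow> ?ii) \<and> (_ \<longleftrightarrow> ?iii)")
proof -
  interpret left_haar m by standard (rule assms(2))
  have "?ii" if am: "amenable m"
  proof (intro allI impI)
    fix \<epsilon> :: real assume \<epsilon>: "0 < \<epsilon>"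
    \<comment> \<open>Beyond \<open>2 / \<epsilon>\<close> elements, the bound
      \<open>2 * measure m C\<close>, which ignores the size of \<open>E\<close>, is as good as the
      required one.\<close>
    obtain n :: nat where n: "max 1 (2 / \<epsilon>) < real n" using reals_Archimedean2 by blast
    have n1: "1 \<le> n" using n by simp
    have bound: "measure m (E + C) < \<epsilon> * real (card E) * measure m C"
      if F: "finite F" and C: "compact C"
        and le: "(\<Sum>t\<in>F. measure m ((\<lambda>x. t + x) ` C - C)) < measure m C"
        and E: "E \<subseteq> F" "n \<le> card E" for F E C
    proof -
      have "2 / \<epsilon> < real (card E)" using n E(2) by simp
      then have "2 \<le> \<epsilon> * real (card E)" using \<epsilon> by (simp add: field_simps)
      then have "2 * measure m C \<le> \<epsilon> * real (card E) * measure m C" by (rule mult_right_mono) simp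
      then show ?thesis using folner_small_products[OF F C le E(1)] by linarith
    qed
    show "\<exists>n. 1 \<le> n \<and> (\<forall>F::'a set. finite F \<and> n \<le> card F \<longrightarrow>
        (\<exists>C. compact C \<and> (\<forall>E. E \<subseteq> F \<and> n \<le> card E \<longrightarrow>
          measure m (E + C) < \<epsilon> * real (card E) * measure m C)))"
    proof (intro exI[of _ n] conjI n1 allI impI)
      fix F :: "'a set" assume F: "finite F \<and> n \<le> card F"
      then have "F \<noteq> {}" using n1 by auto
      then obtain C where C: "compact C" "(\<Sum>t\<in>F. measure m ((\<lambda>x. t + x) ` C - C)) < measure m C"
        using folner_if_amenable[OF assms(1) am conjunct1[OF F]] by blast
      then show "\<exists>C. compact C \<and> (\<forall>E. E \<subseteq> F \<and> n \<le> card E \<longrightarrow>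
          measure m (E + C) < \<epsilon> * real (card E) * measure m C)"
        using bound F by blast
    qed
  qed
  moreover have "?iii" if ?ii
  proof -
    have "0 < (1/2 :: real)" by simp
    from that[rule_format, OF this] show ?thesis by (intro exI[of _ "1/2"]) auto
  qed
  moreover have "amenable m" if ?iii
  proof -
    from that obtain e n0 where e: "0 < e" "e < 1" and n0: "1 \<le> n0"
      and F: "\<forall>F::'a set. finite F \<and> n0 \<le> card F \<longrightarrow> (\<exists>C. compact C \<and>
        (\<forall>E. E \<subseteq> F \<and> n0 \<le> card E \<longrightarrow> measure m (E + C) < e * real (card E) * measure m C))"
      by (elim exE conjE)
    show ?thesis
      by (rule amenable_if_reiter[OF reiter_if_small_products[OF e n0 F[rule_format, OF conjI]]])
  qed
  ultimately show ?thesis by blast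
qed

end
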